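(* Let $B,D\in\mathcal M_{d\times d}(\mathbb R)$ be constant matrices with $D$ symmetric positive semidefinite, and let $$Lf(x) = -(Bx)\cdot\nabla f(x) + \mathrm{div}(D\nabla f)(x)$$ be the generator of the corresponding Ornstein-Uhlenbeck process on $\mathbb R^d$, with semigroup $(P_t)_{t\ge 0}$. Suppose that $\ker D$ does not contain any non-trivial subspace which is invariant by $B^T$, that $\rho=\inf\{\Re(\lambda):\ \lambda\in\sigma(B)\}>0$, and let $N$ be the maximal dimension of a Jordan block of $B$ corresponding to an eigenvalue in $\{\lambda\in\sigma(B):\ \Re(\lambda)=\rho\}$. Let $\mu$ be the unique invariant measure of the process and let $$\|P_t-\mu\| = \sup\{\|P_tf-\mu f\|_{L^2(\mu)}:\ \|f\|_{L^2(\mu)}=1\}$$ be the $L^2(\mu)$ operator norm of $P_t-\mu$. Then there exists $c>0$ such that for all $t\ge0$ $$\frac1c\,(1+t^{2(N-1)})\,e^{-2\rho t}\ \le\ \|P_t-\mu\|^2\ \le\ c\,(1+t^{2(N-1)})\,e^{-2\rho t}.$$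
   Context: $\sigma(B)$ is the complex spectrum of $B$, and Jordan blocks are those of the complex Jordan decomposition. $\mu f=\int f\,d\mu$. Under the stated assumptions the process has a unique invariant measure $\mu$. *)

theory Defs
  imports
    "Jordan_Normal_Form.Jordan_Normal_Form_Uniqueness"
    "Jordan_Normal_Form.Spectral_Radius"
    "HOL-Probability.Probability"
begin

no_notation Matrix.vec_index (infixl \<open>$\<close> 100)
hide_const (open) VectorSpace.subspace

definition partial_deriv :: "'n::finite \<Rightarrow> (real^'n \<Rightarrow> real) \<Rightarrow> real^'n \<Rightarrow> real" where
  "partial_deriv i f x = frechet_derivative f (at x) (axis i 1)"

definition grad :: "(real^'n::finite \<Rightarrow> real) \<Rightarrow> real^'n \<Rightarrow> real^'n" where
  "grad f x = (\<chi> i. partial_deriv i f x)"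

definition divergence :: "(real^'n::finite \<Rightarrow> real^'n) \<Rightarrow> real^'n \<Rightarrow> real" where
  "divergence F x = (\<Sum>i\<in>UNIV. partial_deriv i (\<lambda>y. F y $ i) x)"

definition ou_generator ::
    "real^'n^'n \<Rightarrow> real^'n^'n \<Rightarrow> (real^'n::finite \<Rightarrow> real) \<Rightarrow> real^'n \<Rightarrow> real" where
  "ou_generator B D f x = - ((B *v x) \<bullet> grad f x) + divergence (\<lambda>y. D *v grad f y) x"

text \<open>The space of compactly supported functions of class C2. The differentiability requirement
  on the first partial derivatives makes them continuous.\<close>

definition C2_compact_support :: "(real^'n::finite \<Rightarrow> real) set" where
  "C2_compact_support = {f.
     (\<forall>x. f differentiable at x) \<and>
     (\<forall>i x. partial_deriv i f differentiable at x) \<and>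
     (\<forall>i j. continuous_on UNIV (partial_deriv j (partial_deriv i f))) \<and>
     compact (closure {x. f x \<noteq> 0})}"

definition markov_semigroup :: "(real \<Rightarrow> real^'n::finite \<Rightarrow> (real^'n) measure) \<Rightarrow> bool" where
  "markov_semigroup P \<longleftrightarrow>
     (\<forall>t\<ge>0. P t \<in> borel \<rightarrow>\<^sub>M prob_algebra borel) \<and>
     (\<forall>x. P 0 x = return borel x) \<and>
     (\<forall>s\<ge>0. \<forall>t\<ge>0. \<forall>x. P (s + t) x = P s x \<bind> P t)"

definition semigroup_op ::
    "(real \<Rightarrow> real^'n::finite \<Rightarrow> (real^'n) measure) \<Rightarrow> real \<Rightarrow> (real^'n \<Rightarrow> real) \<Rightarrow> real^'n \<Rightarrow> real" where
  "semigroup_op P t f x = (\<integral>y. f y \<partial>(P t x))"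

text \<open>\<open>L\<close> is the infinitesimal generator on the test functions, with respect to the supremum
  norm. For \<open>L = ou_generator B D\<close> this determines the Markov semigroup \<open>P\<close> uniquely.\<close>

definition has_generator ::
    "(real \<Rightarrow> real^'n::finite \<Rightarrow> (real^'n) measure) \<Rightarrow> ((real^'n \<Rightarrow> real) \<Rightarrow> real^'n \<Rightarrow> real) \<Rightarrow> bool" where
  "has_generator P L \<longleftrightarrow>
     (\<forall>f\<in>C2_compact_support.
        uniform_limit UNIV (\<lambda>t x. (semigroup_op P t f x - f x) / t) (L f) (at_right 0))"

definition invariant_measure ::
    "(real \<Rightarrow> real^'n::finite \<Rightarrow> (real^'n) measure) \<Rightarrow> (real^'n) measure \<Rightarrow> bool" where
  "invariant_measure P \<mu> \<longleftrightarrow>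
     \<mu> \<in> space (prob_algebra borel) \<and> (\<forall>t\<ge>0. \<mu> \<bind> P t = \<mu>)"

text \<open>The norms are extended nonnegative reals, so that no finiteness is built in.\<close>

definition l2_norm :: "'a measure \<Rightarrow> ('a \<Rightarrow> real) \<Rightarrow> ennreal" where
  "l2_norm M f =
     (let I = \<integral>\<^sup>+x. ennreal ((f x)\<^sup>2) \<partial>M
      in if I = \<infinity> then \<infinity> else ennreal (sqrt (enn2real I)))"

text \<open>A Borel function in \<open>L2(\<mu>)\<close> is integrable with respect to \<open>P t x\<close> for \<open>\<mu>\<close>-almost every
  \<open>x\<close> when \<open>\<mu>\<close> is invariant, so the value of the integral at the other points \<open>x\<close> does not
  matter.\<close>

definition deviation_norm ::
    "(real \<Rightarrow> real^'n::finite \<Rightarrow> (real^'n) measure) \<Rightarrow> (real^'n) measure \<Rightarrow> real \<Rightarrow> ennreal" where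
  "deviation_norm P \<mu> t =
     (SUP f \<in> {f \<in> borel_measurable borel. l2_norm \<mu> f = 1}.
        l2_norm \<mu> (\<lambda>x. semigroup_op P t f x - (\<integral>y. f y \<partial>\<mu>)))"

text \<open>The index type is enumerated (in the same way for rows and columns) to obtain a matrix
  to which the Jordan normal form theory applies. A different enumeration gives a similar
  matrix.\<close>

definition complex_mat :: "real^'n^'n \<Rightarrow> complex Matrix.mat" where
  "complex_mat (B :: real^'n::finite^'n) =
     Matrix.mat CARD('n) CARD('n)
       (\<lambda>(i, j). complex_of_real (B $ from_nat_into UNIV i $ from_nat_into UNIV j))"

definition least_real_part :: "real^'n::finite^'n \<Rightarrow> real" where
  "least_real_part B = Inf (Re ` spectrum (complex_mat B))"

definition max_jordan_block :: "real^'n::finite^'n \<Rightarrow> nat" where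
  "max_jordan_block B =
     Max {n. \<exists>n_as z. jordan_nf (complex_mat B) n_as \<and> (n, z) \<in> set n_as \<and>
                     Re z = least_real_part B}"

end

theory Submission
  imports Defs "HOL-Real_Asymp.Real_Asymp"
begin

text \<open>Write \<open>E t\<close> for the flow of \<open>- transpose B\<close> and let \<open>S\<close> solve the Lyapunov equation
  \<open>B S + S transpose B = 2 D\<close>; the kernel condition makes \<open>q \<xi> = (\<xi> \<bullet> S \<xi>) / 2\<close> positive definite.
  Testing the generator on plane waves with a moving frequency, cut off at a logarithmic scale,
  shows that \<open>P t\<close> maps \<open>cos (\<xi> \<bullet> x + \<theta>)\<close> to
  \<open>exp (q (E t \<xi>) - q \<xi>) cos (E t \<xi> \<bullet> x + \<theta>)\<close>, so that \<open>\<mu>\<close> is the centred Gaussian with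
  characteristic function \<open>exp (- q)\<close>. On trigonometric sums, which are dense in \<open>L2(\<mu>)\<close>, both
  \<open>\<parallel>P t f - \<mu> f\<parallel>\<^sup>2\<close> and \<open>\<parallel>f - \<mu> f\<parallel>\<^sup>2\<close> are power series with nonnegative coefficients in the Gram
  matrices of the frequencies \<open>E t \<xi>\<^sub>j\<close> and \<open>\<xi>\<^sub>j\<close> for \<open>S\<close>. The Schur product theorem therefore bounds
  their ratio by the supremum of \<open>q (E t \<xi>) / q \<xi>\<close>, and the functions \<open>sin (\<xi> \<bullet> x)\<close> show that this
  is optimal up to a constant. The supremum is comparable to the squared operator norm of \<open>E t\<close>,
  which is read off the Jordan chains of \<open>B\<close>.\<close>

text \<open>All that is given about \<open>P\<close> is its generator on compactly supported
  functions, in the supremum norm; there is no transition density to start from, and plane waves are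
  not test functions, hence the cutoff. The moving frequency is the characteristic of the drift: it
  cancels the term of \<open>L\<close> that grows with \<open>x\<close>. One factor
  \<open>r \<le> 1\<close> with \<open>q (E t \<xi>) \<le> r * q \<xi>\<close> controls every order
  of the power series: in Hermite terms the component of degree \<open>n\<close> contracts like the
  n-th tensor power of the linear component, hence at least as fast. Linear functions are therefore
  the slowest, and a sine with \<open>q \<xi> = 1\<close> is a bounded substitute for them. The
  constant term of the series does not contract; it is the mean, which is subtracted. Only the
  Jordan form of \<open>B\<close> is used: \<open>E t\<close> is the transpose of the flow of
  \<open>- B\<close>, and its bounds follow by duality. The L2 estimates concern squared norms in
  \<open>ennreal\<close>, with \<open>(a + b)^2 \<le> 2 a^2 + 2 b^2\<close> as triangle inequality,
  at the price of a constant factor.\<close>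

no_notation scalar_prod (infix "\<bullet>" 70)

section \<open>Jordan chains\<close>

text \<open>Columns \<open>j - k, \<dots>, j\<close> of \<open>J\<close> form an initial part of a Jordan block with eigenvalue \<open>z\<close>, and
  \<open>j - k\<close> is the first column of that block.\<close>

definition chain_column :: "complex Matrix.mat \<Rightarrow> nat \<Rightarrow> nat \<Rightarrow> complex \<Rightarrow> nat \<Rightarrow> bool" where
  "chain_column J n k z j \<longleftrightarrow> k \<le> j \<and> j < n \<and>
     (\<forall>i\<le>k. \<forall>l<n. J $$ (l, j - i) = (if l = j - i then z else if i < k \<and> Suc l = j - i then 1 else 0))"

lemma jordan_matrix_Cons_index:
  assumes "l < m + sum_list (map fst bs)" "c < m + sum_list (map fst bs)"
  shows "jordan_matrix ((m, z) # bs) $$ (l, c) =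
    (if l < m then if c < m then jordan_block m z $$ (l, c) else 0
     else if c < m then 0 else jordan_matrix bs $$ (l - m, c - m))"
  using assms by (simp add: jordan_matrix_Cons)

lemma jordan_matrix_chain_head:
  assumes "j < m"
  shows "chain_column (jordan_matrix ((m, z) # bs)) (m + sum_list (map fst bs)) j z j"
  unfolding chain_column_def
proof (intro conjI allI impI)
  fix i l assume l: "i \<le> j" "l < m + sum_list (map fst bs)"
  have "j - i < m" using assms by simp
  then show "jordan_matrix ((m, z) # bs) $$ (l, j - i) =
      (if l = j - i then z else if i < j \<and> Suc l = j - i then 1 else 0)"
    using l jordan_matrix_Cons_index[OF l(2), of "j - i" z] by (cases "l < m") auto
qed (use assms in auto)

lemma jordan_matrix_chain_tail:
  assumes "chain_column (jordan_matrix bs) (sum_list (map fst bs)) k z j"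
  shows "chain_column (jordan_matrix ((m, w) # bs)) (m + sum_list (map fst bs)) k z (m + j)"
proof -
  have *: "k \<le> j" "j < sum_list (map fst bs)"
    and J: "\<And>i l. i \<le> k \<Longrightarrow> l < sum_list (map fst bs) \<Longrightarrow> jordan_matrix bs $$ (l, j - i) =
      (if l = j - i then z else if i < k \<and> Suc l = j - i then 1 else 0)"
    using assms unfolding chain_column_def by auto
  show ?thesis
    unfolding chain_column_def
  proof (intro conjI allI impI)
    fix i l assume il: "i \<le> k" "l < m + sum_list (map fst bs)"
    have e: "m + j - i - m = j - i" "\<not> m + j - i < m" using il * by auto
    have c: "m + j - i < m + sum_list (map fst bs)" using * by auto
    show "jordan_matrix ((m, w) # bs) $$ (l, m + j - i) =
      (if l = m + j - i then z else if i < k \<and> Suc l = m + j - i then 1 else 0)"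
    proof (cases "l < m")
      case True
      then show ?thesis using il *
        by (simp add: jordan_matrix_Cons_index[OF il(2) c] e, linarith)
    next
      case False
      then have "l - m < sum_list (map fst bs)" using il by auto
      from J[OF il(1) this] have "jordan_matrix ((m, w) # bs) $$ (l, m + j - i) =
          (if l - m = j - i then z else if i < k \<and> Suc (l - m) = j - i then 1 else 0)"
        using False by (simp only: jordan_matrix_Cons_index[OF il(2) c] e if_False)
      moreover have "l - m = j - i \<longleftrightarrow> l = m + j - i" "Suc (l - m) = j - i \<longleftrightarrow> Suc l = m + j - i"
        using il * False by linarith+
      ultimately show ?thesis by (simp only:)
    qed
  qed (use * in auto)
qed

text \<open>Each column ends a chain that begins at the first column of its block. The inequality
  \<open>k < m\<close> later bounds the degree in \<open>t\<close> by the block size.\<close>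

lemma jordan_matrix_chain_column:
  assumes "j < sum_list (map fst bs)"
  shows "\<exists>m z k. (m, z) \<in> set bs \<and> k < m \<and> chain_column (jordan_matrix bs) (sum_list (map fst bs)) k z j"
  using assms
proof (induction bs arbitrary: j)
  case (Cons b bs)
  obtain m z where b: "b = (m, z)" by force
  show ?case
  proof (cases "j < m")
    case True
    then show ?thesis using jordan_matrix_chain_head[OF True, of z bs] b
      by (intro exI[of _ m] exI[of _ z] exI[of _ j]) simp
  next
    case False
    then have "j - m < sum_list (map fst bs)" using Cons.prems b by auto
    from Cons.IH[OF this] obtain m' z' k where "(m', z') \<in> set bs" "k < m'"
      "chain_column (jordan_matrix bs) (sum_list (map fst bs)) k z' (j - m)" by blast
    with jordan_matrix_chain_tail[OF this(3), of m z] False show ?thesis by (auto simp: b)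
  qed
qed auto

text \<open>The last column of a block ends a chain through the whole block, hence the length index
  \<open>m - 1\<close>.\<close>

lemma jordan_matrix_block_chain:
  assumes "(m, z) \<in> set bs" "0 < m"
  shows "\<exists>j. chain_column (jordan_matrix bs) (sum_list (map fst bs)) (m - 1) z j"
  using assms
proof (induction bs)
  case (Cons b bs)
  obtain m' z' where b: "b = (m', z')" by force
  show ?case
  proof (cases "b = (m, z)")
    case True
    then show ?thesis using jordan_matrix_chain_head[of "m - 1" m z bs] Cons.prems by auto
  next
    case False
    then obtain j where "chain_column (jordan_matrix bs) (sum_list (map fst bs)) (m - 1) z j"
      using Cons by auto
    from jordan_matrix_chain_tail[OF this, of m' z'] show ?thesis by (auto simp: b)
  qed
qed auto

section \<open>Jordan bases of complex vectors\<close>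

definition complexify :: "real^'n^'m \<Rightarrow> complex^'n^'m" where
  "complexify B = (\<chi> i j. complex_of_real (B $ i $ j))"

text \<open>A Jordan chain read downwards: \<open>v (j - k)\<close> is an eigenvector and
  \<open>v j\<close> the last generalised eigenvector.\<close>

definition chain_vectors :: "complex^'n^'n \<Rightarrow> (nat \<Rightarrow> complex^'n::finite) \<Rightarrow> nat \<Rightarrow> complex \<Rightarrow> nat \<Rightarrow> bool" where
  "chain_vectors A v k z j \<longleftrightarrow> k \<le> j \<and>
     (\<forall>i\<le>k. A *v v (j - i) = z *s v (j - i) + (if i < k then v (j - Suc i) else 0))"

lemma mat_mult_entry:
  assumes "X \<in> carrier_mat n n" "Y \<in> carrier_mat n n" "i < n" "j < n"
  shows "(X * Y) $$ (i, j) = (\<Sum>l<n. X $$ (i, l) * Y $$ (l, j))"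
  using assms by (auto simp: scalar_prod_def atLeast0LessThan)

text \<open>\<open>v\<close> consists of the columns of the similarity matrix and \<open>u\<close>
  of the rows of its inverse, re-indexed by the inverse \<open>h\<close> of the enumeration in
  \<open>complex_mat\<close>. The pairing of \<open>u\<close> and \<open>v\<close> is bilinear,
  without conjugation.\<close>

lemma jordan_basis:
  fixes B :: "real^'n::finite^'n"
  assumes "jordan_nf (complex_mat B) bs"
  obtains v u :: "nat \<Rightarrow> complex^'n"
  where "\<And>j. j < CARD('n) \<Longrightarrow> \<exists>m z k. (m, z) \<in> set bs \<and> k < m \<and> chain_vectors (complexify B) v k z j"
    and "\<And>m z. (m, z) \<in> set bs \<Longrightarrow> \<exists>j<CARD('n). chain_vectors (complexify B) v (m - 1) z j"
    and "\<And>i j. i < CARD('n) \<Longrightarrow> j < CARD('n) \<Longrightarrow> (\<Sum>l\<in>UNIV. u i $ l * v j $ l) = (if i = j then 1 else 0)"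
    and "\<And>x. x = (\<Sum>j<CARD('n). (\<Sum>l\<in>UNIV. u j $ l * x $ l) *s v j)"
proof -
  let ?n = "CARD('n)" and ?A = "complex_mat B" and ?J = "jordan_matrix bs"
  have A: "?A \<in> carrier_mat ?n ?n" by (simp add: complex_mat_def)
  from assms have pos: "0 \<notin> fst ` set bs" and "similar_mat ?A ?J" by (auto simp: jordan_nf_def)
  then obtain P Q where w: "similar_mat_wit ?A ?J P Q" unfolding similar_mat_def by auto
  note W = similar_mat_witD2[OF A w]
  have n: "sum_list (map fst bs) = ?n" using carrier_matD(1)[OF W(5)] jordan_matrix_dim(1)[of bs] by linarith
  have AP: "?A * P = P * ?J"
  proof -
    have "?A * P = P * ?J * (Q * P)"
      unfolding W(3) by (rule assoc_mult_mat[OF mult_carrier_mat[OF W(6,5)] W(7,6)])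
    also have "\<dots> = P * ?J" unfolding W(2) by (rule right_mult_one_mat[OF mult_carrier_mat[OF W(6,5)]])
    finally show ?thesis .
  qed
  define e :: "nat \<Rightarrow> 'n" where "e = from_nat_into UNIV"
  have e: "bij_betw e {..<?n} UNIV" unfolding e_def by (rule bij_betw_from_nat_into_finite) simp
  define h where "h = the_inv_into {..<?n} e"
  have h: "h l < ?n" "e (h l) = l" for l
    using e the_inv_into_into[of e "{..<?n}" l "{..<?n}"] f_the_inv_into_f[of e "{..<?n}" l]
    unfolding h_def bij_betw_def by auto
  have he: "i < ?n \<Longrightarrow> h (e i) = i" for i
    using e unfolding h_def bij_betw_def by (simp add: the_inv_into_f_f)
  have sumh: "(\<Sum>l\<in>UNIV. f l) = (\<Sum>i<?n. f (e i))" for f :: "'n \<Rightarrow> complex"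
    by (rule sum.reindex_bij_betw[OF e, symmetric])
  define v :: "nat \<Rightarrow> complex^'n" where "v j = (\<chi> l. P $$ (h l, j))" for j
  define u :: "nat \<Rightarrow> complex^'n" where "u j = (\<chi> l. Q $$ (j, h l))" for j
  have chain: "chain_vectors (complexify B) v k z j" if c: "chain_column ?J ?n k z j" for k z j
  proof -
    have kj: "k \<le> j" "j < ?n" using c by (auto simp: chain_column_def)
    have "complexify B *v v (j - i) = z *s v (j - i) + (if i < k then v (j - Suc i) else 0)" if i: "i \<le> k" for i
    proof (rule vec_eq_iff[THEN iffD2], intro allI)
      fix r :: 'n
      have ji: "j - i < ?n" using kj by auto
      have "(complexify B *v v (j - i)) $ r = (\<Sum>l<?n. complex_of_real (B $ r $ e l) * P $$ (l, j - i))"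
        by (simp add: matrix_vector_mult_def complexify_def v_def sumh he)
      also have "\<dots> = (\<Sum>l<?n. ?A $$ (h r, l) * P $$ (l, j - i))"
        using h by (intro sum.cong refl) (simp add: complex_mat_def e_def)
      also have "\<dots> = (?A * P) $$ (h r, j - i)"
        using h[of r] ji by (simp add: mat_mult_entry[OF A W(6)])
      also have "\<dots> = (P * ?J) $$ (h r, j - i)" by (simp only: AP)
      also have "\<dots> = (\<Sum>l<?n. P $$ (h r, l) * ?J $$ (l, j - i))"
        using h[of r] ji by (simp add: mat_mult_entry[OF W(6,5)])
      also have "\<dots> = (\<Sum>l<?n. P $$ (h r, l) * (if l = j - i then z else 0) +
           P $$ (h r, l) * (if l = j - Suc i then (if i < k then 1 else 0) else 0))"
      proof (intro sum.cong refl)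
        fix l assume "l \<in> {..<?n}"
        then have "?J $$ (l, j - i) = (if l = j - i then z else if i < k \<and> Suc l = j - i then 1 else 0)"
          using c i unfolding chain_column_def by auto
        \<comment> \<open>Under truncated subtraction \<open>l = j - Suc i\<close> also holds for
          \<open>l = 0\<close> and \<open>i = j\<close>, where \<open>Suc l = j - i\<close> fails;
          there \<open>i < k\<close> fails as well, since \<open>k \<le> j\<close>.\<close>
        then show "P $$ (h r, l) * ?J $$ (l, j - i) = P $$ (h r, l) * (if l = j - i then z else 0) +
           P $$ (h r, l) * (if l = j - Suc i then (if i < k then 1 else 0) else 0)"
          using kj by auto
      qed
      also have "\<dots> = P $$ (h r, j - i) * z + P $$ (h r, j - Suc i) * (if i < k then 1 else 0)"
        using kj by (subst sum.distrib) (auto simp: if_distrib[of "(*) _"] sum.delta cong: if_cong)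
      also have "\<dots> = (z *s v (j - i) + (if i < k then v (j - Suc i) else 0)) $ r"
        by (simp add: v_def)
      finally show "(complexify B *v v (j - i)) $ r = (z *s v (j - i) + (if i < k then v (j - Suc i) else 0)) $ r" .
    qed
    then show ?thesis using kj by (auto simp: chain_vectors_def)
  qed
  show ?thesis
  proof (rule that[of v u])
    show "\<exists>m z k. (m, z) \<in> set bs \<and> k < m \<and> chain_vectors (complexify B) v k z j" if "j < ?n" for j
      using jordan_matrix_chain_column[of j bs] that chain unfolding n by blast
    show "\<exists>j<?n. chain_vectors (complexify B) v (m - 1) z j" if "(m, z) \<in> set bs" for m z
    proof -
      have "0 < m" using that pos by force
      from jordan_matrix_block_chain[OF that this] obtain j where "chain_column ?J ?n (m - 1) z j"
        unfolding n by auto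
      then show ?thesis using chain by (auto simp: chain_column_def)
    qed
    show "(\<Sum>l\<in>UNIV. u i $ l * v j $ l) = (if i = j then 1 else 0)" if "i < ?n" "j < ?n" for i j
    proof -
      have "(\<Sum>l\<in>UNIV. u i $ l * v j $ l) = (Q * P) $$ (i, j)"
        using that by (simp add: mat_mult_entry[OF W(7,6)] u_def v_def sumh he)
      then show ?thesis using W(2) that by simp
    qed
    show "x = (\<Sum>j<?n. (\<Sum>l\<in>UNIV. u j $ l * x $ l) *s v j)" for x
    proof (rule vec_eq_iff[THEN iffD2], intro allI)
      fix r :: 'n
      have "(\<Sum>j<?n. (\<Sum>l\<in>UNIV. u j $ l * x $ l) *s v j) $ r
          = (\<Sum>j<?n. \<Sum>l<?n. P $$ (h r, j) * Q $$ (j, l) * x $ e l)"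
        by (simp add: v_def u_def sumh he sum_distrib_right sum_distrib_left mult_ac)
      also have "\<dots> = (\<Sum>l<?n. (P * Q) $$ (h r, l) * x $ e l)"
        using h[of r] by (subst sum.swap) (simp add: mat_mult_entry[OF W(6,7)] sum_distrib_right)
      also have "\<dots> = (\<Sum>l<?n. (if l = h r then x $ e l else 0))"
        unfolding W(1) using h by (intro sum.cong refl) auto
      also have "\<dots> = x $ r" using h[of r] by simp
      finally show "x $ r = (\<Sum>j<?n. (\<Sum>l\<in>UNIV. u j $ l * x $ l) *s v j) $ r" by simp
    qed
  qed
qed

section \<open>Solutions along Jordan chains\<close>

lemma has_vector_derivative_vec:
  fixes f :: "real \<Rightarrow> 'a::real_normed_vector^'n::finite"
  assumes "\<And>i. ((\<lambda>t. f t $ i) has_vector_derivative f' $ i) F"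
  shows "(f has_vector_derivative f') F"
  unfolding has_vector_derivative_def has_derivative_def
proof (intro conjI vec_tendstoI)
  fix i
  show "((\<lambda>y. ((f y - f (Lim F (\<lambda>x. x)) - (y - Lim F (\<lambda>x. x)) *\<^sub>R f') /\<^sub>R norm (y - Lim F (\<lambda>x. x))) $ i)
      \<longlongrightarrow> 0 $ i) F"
    using assms[of i] unfolding has_vector_derivative_def has_derivative_def by simp
qed (rule bounded_linear_scaleR_left)

lemma bounded_linear_matrix_vector_left: "bounded_linear (\<lambda>A::real^'n::finite^'m::finite. A *v x)"
  by (rule linear_conv_bounded_linear[THEN iffD1], unfold_locales)
     (simp_all add: matrix_vector_mult_add_rdistrib scaleR_matrix_vector_assoc)

text \<open>Gronwall in energy form: with \<open>K\<close> bounding the norm of \<open>B\<close>,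
  the square of the norm of \<open>y s\<close> grows at most like \<open>exp (2 * K * s)\<close>, so
  the weighted quantity \<open>h\<close> cannot leave 0.\<close>

lemma linear_ode_zero:
  fixes B :: "real^'n::finite^'n" and y :: "real \<Rightarrow> real^'n"
  assumes y: "\<And>t. (y has_vector_derivative - (B *v y t)) (at t)" and "y 0 = 0" "0 \<le> t"
  shows "y t = 0"
proof -
  obtain K where K: "\<And>x. norm (B *v x) \<le> norm x * K"
    using bounded_linear.bounded[OF matrix_vector_mul_bounded_linear[of B]] by blast
  define h where "h s = exp (- 2 * K * s) * (y s \<bullet> y s)" for s
  have "h t \<le> h 0"
  proof (rule DERIV_nonpos_imp_nonincreasing[OF \<open>0 \<le> t\<close>])
    fix s :: real
    have d: "((\<lambda>s. y s \<bullet> y s) has_real_derivative - 2 * (y s \<bullet> (B *v y s))) (at s)"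
      using has_derivative_inner[OF y[unfolded has_vector_derivative_def] y[unfolded has_vector_derivative_def], of s]
      unfolding has_field_derivative_def
      by (rule has_derivative_eq_rhs) (auto simp: fun_eq_iff inner_commute)
    have "(h has_real_derivative exp (- 2 * K * s) * (- 2 * (y s \<bullet> (B *v y s)) - 2 * K * (y s \<bullet> y s))) (at s)"
      unfolding h_def by (auto intro!: derivative_eq_intros d simp: algebra_simps)
    moreover have "- (y s \<bullet> (B *v y s)) \<le> K * (y s \<bullet> y s)"
    proof -
      have "\<bar>y s \<bullet> (B *v y s)\<bar> \<le> norm (y s) * (norm (y s) * K)"
        using Cauchy_Schwarz_ineq2[of "y s" "B *v y s"] mult_left_mono[OF K[of "y s"] norm_ge_zero[of "y s"]]
        by linarith
      then show ?thesis by (simp add: dot_square_norm power2_eq_square mult_ac)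
    qed
    then have "exp (- 2 * K * s) * (- 2 * (y s \<bullet> (B *v y s)) - 2 * K * (y s \<bullet> y s)) \<le> 0"
      by (intro mult_nonneg_nonpos) auto
    ultimately show "\<exists>d. (h has_real_derivative d) (at s) \<and> d \<le> 0" by blast
  qed
  then have "exp (- 2 * K * t) * (y t \<bullet> y t) \<le> 0" using assms(2) by (simp add: h_def)
  then show ?thesis
    by (metis exp_gt_zero inner_gt_zero_iff mult_pos_pos not_less)
qed

lemma linear_ode_unique:
  fixes B :: "real^'n::finite^'n" and y z :: "real \<Rightarrow> real^'n"
  assumes "\<And>t. (y has_vector_derivative - (B *v y t)) (at t)"
    and "\<And>t. (z has_vector_derivative - (B *v z t)) (at t)" and "y 0 = z 0" "0 \<le> t"
  shows "y t = z t"
  using linear_ode_zero[of "\<lambda>t. y t - z t" B t]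
    has_vector_derivative_diff[OF assms(1,2)] assms(3,4)
  by (simp add: matrix_vector_mult_diff_distrib algebra_simps)

text \<open>This is \<open>exp (- t A) v j\<close> along a Jordan chain: the scalar part gives the
  exponential factor, and the exponential series of the nilpotent shift \<open>v i\<close> to
  \<open>v (i - 1)\<close> stops after \<open>k\<close> steps.\<close>

definition chain_solution :: "(nat \<Rightarrow> complex^'n) \<Rightarrow> nat \<Rightarrow> complex \<Rightarrow> nat \<Rightarrow> real \<Rightarrow> complex^'n::finite" where
  "chain_solution v k z j t =
     exp (- z * of_real t) *s (\<Sum>i\<le>k. ((- of_real t) ^ i / fact i) *s v (j - i))"

lemma chain_solution_nth:
  "chain_solution v k z j t $ l =
     exp (- z * of_real t) * (\<Sum>i\<le>k. ((- of_real t) ^ i / fact i) * v (j - i) $ l)"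
  by (simp add: chain_solution_def)

lemma chain_solution_zero: "chain_solution v k z j 0 = v j"
proof -
  have "(\<Sum>i\<le>k. ((0::complex) ^ i / fact i) *s v (j - i)) = (\<Sum>i\<le>k. if i = 0 then v j else 0)"
    by (intro sum.cong) auto
  then show ?thesis by (simp add: chain_solution_def)
qed

lemma chain_solution_derivative:
  fixes v :: "nat \<Rightarrow> complex^'n::finite"
  assumes "chain_vectors A v k z j"
  shows "((\<lambda>t. chain_solution v k z j t $ l) has_vector_derivative
     - (A *v chain_solution v k z j t) $ l) (at t)"
proof -
  define c where "c i = v (j - i) $ l" for i
  let ?E = "exp (- z * of_real t)"
  define p where "p i = (- complex_of_real t) ^ i / fact i" for i
  have Av: "(A *v v (j - i)) $ l = z * c i + (if i < k then c (Suc i) else 0)" if "i \<le> k" for i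
    using assms that by (auto simp: chain_vectors_def c_def)
  have "((\<lambda>x. exp (- z * x) * (\<Sum>i\<le>k. ((- x) ^ i / fact i) * c i)) has_field_derivative
      - z * ?E * (\<Sum>i\<le>k. p i * c i) + ?E * (\<Sum>i\<le>k. - (of_nat i * (- of_real t) ^ (i - 1) / fact i) * c i)) (at (of_real t))"
    by (auto intro!: derivative_eq_intros sum.cong simp: p_def algebra_simps)
  then have D: "((\<lambda>t. chain_solution v k z j t $ l) has_vector_derivative
      - z * ?E * (\<Sum>i\<le>k. p i * c i) + ?E * (\<Sum>i\<le>k. - (of_nat i * (- of_real t) ^ (i - 1) / fact i) * c i)) (at t)"
    unfolding chain_solution_nth c_def[symmetric] by (rule has_vector_derivative_real_field)
  \<comment> \<open>Differentiating a power over its factorial lowers the index by one; this shift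
    matches the nilpotent part of \<open>A\<close> acting on the chain.\<close>
  have S: "(\<Sum>i\<le>k. - (of_nat i * (- of_real t) ^ (i - 1) / fact i) * c i) = - (\<Sum>i<k. p i * c (Suc i))"
  proof (cases k)
    case (Suc m)
    have "(\<Sum>i\<le>k. - (of_nat i * (- of_real t) ^ (i - 1) / fact i) * c i) =
        (\<Sum>i\<le>m. - (of_nat (Suc i) * (- of_real t) ^ i / fact (Suc i)) * c (Suc i))"
      unfolding Suc by (subst sum.atMost_Suc_shift) simp
    also have "\<dots> = (\<Sum>i\<le>m. - (p i * c (Suc i)))"
      by (intro sum.cong refl) (simp add: p_def field_simps del: of_nat_Suc)
    finally show ?thesis by (simp add: Suc sum_negf lessThan_Suc_atMost)
  qed simp
  have "(A *v chain_solution v k z j t) $ l = ?E * (\<Sum>i\<le>k. p i * (A *v v (j - i)) $ l)"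
    by (simp add: chain_solution_def p_def matrix_vector_mult_def sum_distrib_left sum_distrib_right
        sum.swap[of _ UNIV] mult_ac)
  also have "(\<Sum>i\<le>k. p i * (A *v v (j - i)) $ l) =
      z * (\<Sum>i\<le>k. p i * c i) + (\<Sum>i\<le>k. if i < k then p i * c (Suc i) else 0)"
    by (simp add: Av algebra_simps sum.distrib sum_distrib_left if_distrib[of "(*) _"] cong: if_cong)
  also have "(\<Sum>i\<le>k. if i < k then p i * c (Suc i) else 0) = (\<Sum>i<k. p i * c (Suc i))"
    by (intro sum.mono_neutral_cong_right) auto
  finally have "- (A *v chain_solution v k z j t) $ l =
     - z * ?E * (\<Sum>i\<le>k. p i * c i) + ?E * - (\<Sum>i<k. p i * c (Suc i))"
    by (simp add: algebra_simps)
  then show ?thesis using D unfolding S by (simp only: vector_uminus_component)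
qed

lemma norm_vec_smult: "norm (c *s (x::complex^'n::finite)) = cmod c * norm x"
proof -
  have "norm (c *s x) = L2_set (\<lambda>i. cmod c * norm (x $ i)) UNIV"
    by (simp add: norm_vec_def norm_mult)
  then show ?thesis by (simp add: norm_vec_def L2_set_right_distrib)
qed

lemma power_div_fact_le_exp: "x ^ i / fact i \<le> exp (x::real)" if "0 \<le> x"
proof -
  have "(\<Sum>n\<in>{i}. inverse (fact n) * x ^ n) \<le> (\<Sum>n. inverse (fact n) * x ^ n)"
    using that by (intro sum_le_suminf summable_exp) auto
  then show ?thesis by (simp add: exp_def scaleR_conv_of_real field_simps)
qed

text \<open>If \<open>a > \<rho>\<close>, the surplus decay \<open>exp (- (a - \<rho>) * t)\<close>
  absorbs every power of \<open>t\<close>; only for \<open>a = \<rho>\<close> does the degree have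
  to be controlled. This is why only the blocks with minimal real part enter the rate.\<close>

lemma poly_exp_dominated:
  fixes a \<rho> :: real
  assumes "\<rho> \<le> a" "a = \<rho> \<Longrightarrow> i \<le> m"
  shows "\<exists>K\<ge>0. \<forall>t\<ge>0. t ^ i / fact i * exp (- a * t) \<le> K * ((1 + t ^ m) * exp (- \<rho> * t))"
proof (cases "a = \<rho>")
  case True
  have "t ^ i / fact i * exp (- a * t) \<le> 1 * ((1 + t ^ m) * exp (- \<rho> * t))" if "0 \<le> t" for t :: real
  proof -
    have "t ^ i / fact i \<le> t ^ i / 1" using that by (intro divide_left_mono) (auto simp: fact_ge_1)
    also have "\<dots> \<le> 1 + t ^ m"
    proof (cases "t \<le> 1")
      case True then show ?thesis using that power_le_one[of t i] zero_le_power[of t m] by linarith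
    next
      case False then show ?thesis using power_increasing[of i m t] assms \<open>a = \<rho>\<close> by linarith
    qed
    finally have "t ^ i / fact i * exp (- a * t) \<le> (1 + t ^ m) * exp (- a * t)"
      by (rule mult_right_mono) simp
    then show ?thesis using True by simp
  qed
  then show ?thesis by (intro exI[of _ 1]) auto
next
  case False
  define d where "d = a - \<rho>"
  then have d: "0 < d" using False assms by simp
  have "t ^ i / fact i * exp (- a * t) \<le> (1 / d ^ i) * ((1 + t ^ m) * exp (- \<rho> * t))" if "0 \<le> t" for t :: real
  proof -
    have "t ^ i / fact i = (1 / d ^ i) * ((d * t) ^ i / fact i)" using d by (simp add: power_mult_distrib)
    also have "\<dots> \<le> (1 / d ^ i) * exp (d * t)"
      using d that by (intro mult_left_mono power_div_fact_le_exp) auto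
    finally have "t ^ i / fact i * exp (- a * t) \<le> (1 / d ^ i) * exp (d * t) * exp (- a * t)"
      by (intro mult_right_mono) auto
    also have "\<dots> = (1 / d ^ i) * exp (- \<rho> * t)"
      by (simp add: d_def flip: exp_add) (simp add: algebra_simps)
    also have "\<dots> \<le> (1 / d ^ i) * ((1 + t ^ m) * exp (- \<rho> * t))"
      using d that by (intro mult_left_mono) auto
    finally show ?thesis .
  qed
  then show ?thesis using d by (intro exI[of _ "1 / d ^ i"]) auto
qed

lemma chain_solution_bound:
  fixes v :: "nat \<Rightarrow> complex^'n::finite"
  assumes "\<rho> \<le> Re z" "Re z = \<rho> \<Longrightarrow> k \<le> m"
  shows "\<exists>K\<ge>0. \<forall>t\<ge>0. norm (chain_solution v k z j t) \<le> K * ((1 + t ^ m) * exp (- \<rho> * t))"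
proof -
  have "\<exists>K\<ge>0. \<forall>t\<ge>0. t ^ i / fact i * exp (- Re z * t) \<le> K * ((1 + t ^ m) * exp (- \<rho> * t))" if "i \<le> k" for i
    by (rule poly_exp_dominated) (use assms that in auto)
  then obtain K where K0: "\<And>i. i \<le> k \<Longrightarrow> K i \<ge> 0"
    and K: "\<And>i t. i \<le> k \<Longrightarrow> 0 \<le> t \<Longrightarrow> t ^ i / fact i * exp (- Re z * t) \<le> K i * ((1 + t ^ m) * exp (- \<rho> * t))"
    by metis
  have "norm (chain_solution v k z j t) \<le> (\<Sum>i\<le>k. K i * norm (v (j - i))) * ((1 + t ^ m) * exp (- \<rho> * t))"
    if t: "0 \<le> t" for t
  proof -
    have "norm (chain_solution v k z j t) = exp (- Re z * t) * norm (\<Sum>i\<le>k. ((- complex_of_real t) ^ i / fact i) *s v (j - i))"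
      by (simp add: chain_solution_def norm_vec_smult)
    also have "\<dots> \<le> exp (- Re z * t) * (\<Sum>i\<le>k. norm (((- complex_of_real t) ^ i / fact i) *s v (j - i)))"
      by (intro mult_left_mono norm_sum) auto
    also have "\<dots> = (\<Sum>i\<le>k. (t ^ i / fact i * exp (- Re z * t)) * norm (v (j - i)))"
      using t by (simp add: norm_vec_smult sum_distrib_left norm_divide norm_power mult_ac)
    also have "\<dots> \<le> (\<Sum>i\<le>k. (K i * ((1 + t ^ m) * exp (- \<rho> * t))) * norm (v (j - i)))"
      using t by (intro sum_mono mult_right_mono K) auto
    also have "\<dots> = (\<Sum>i\<le>k. K i * norm (v (j - i))) * ((1 + t ^ m) * exp (- \<rho> * t))"
      by (subst sum_distrib_right) (simp add: mult_ac)
    finally show ?thesis .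
  qed
  moreover have "0 \<le> (\<Sum>i\<le>k. K i * norm (v (j - i)))" using K0 by (intro sum_nonneg) auto
  ultimately show ?thesis by blast
qed

section \<open>Spectrum and extremal blocks read off a Jordan normal form\<close>

lemma jordan_nf_eigenvalues:
  fixes A :: "complex Matrix.mat"
  assumes A: "A \<in> carrier_mat n n" and jnf: "jordan_nf A bs"
  shows "spectrum A = snd ` set bs"
proof -
  \<comment> \<open>A block of size 0 would list a number that need not be a root of the
    characteristic polynomial.\<close>
  have pos: "0 \<notin> fst ` set bs" using jnf by (simp add: jordan_nf_def)
  have "poly (char_poly A) z = 0 \<longleftrightarrow> z \<in> snd ` set bs" for z
  proof -
    have "poly (char_poly A) z = (\<Prod>(m, a)\<leftarrow>bs. (z - a) ^ m)"
      unfolding jordan_nf_char_poly[OF jnf]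
      by (simp add: poly_prod_list case_prod_beta' o_def)
    then show ?thesis using pos by (force simp: prod_list_zero_iff)
  qed
  then show ?thesis unfolding spectrum_root_char_poly[OF A] by auto
qed

text \<open>By uniqueness of the Jordan normal form, the set in \<open>max_jordan_block\<close>,
  which ranges over all normal forms, is determined by the single list \<open>bs\<close>. It is
  finite and nonempty, so \<open>Max\<close> is attained; likewise \<open>Inf\<close> in
  \<open>least_real_part\<close> is a minimum.\<close>

lemma jordan_data:
  fixes B :: "real^'n::finite^'n"
  obtains bs where "jordan_nf (complex_mat B) bs"
    and "\<And>m z. (m, z) \<in> set bs \<Longrightarrow> least_real_part B \<le> Re z"
    and "\<And>m z. (m, z) \<in> set bs \<Longrightarrow> Re z = least_real_part B \<Longrightarrow> m \<le> max_jordan_block B"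
    and "\<exists>z. (max_jordan_block B, z) \<in> set bs \<and> Re z = least_real_part B"
proof -
  let ?A = "complex_mat B"
  have A: "?A \<in> carrier_mat (CARD('n)) (CARD('n))" by (simp add: complex_mat_def)
  obtain bs where bs: "jordan_nf ?A bs"
    using char_poly_factorized[OF A] jordan_nf_exists[OF A] by blast
  have spec: "spectrum ?A = snd ` set bs" by (rule jordan_nf_eigenvalues[OF A bs])
  have fin: "finite (Re ` spectrum ?A)" using card_finite_spectrum(1)[OF A] by simp
  have ne: "Re ` spectrum ?A \<noteq> {}" using spectrum_non_empty[OF A] by simp
  have "least_real_part B = Min (Re ` spectrum ?A)"
    unfolding least_real_part_def by (rule cInf_eq_Min[OF fin ne])
  then have min: "least_real_part B \<in> Re ` spectrum ?A" "\<And>x. x \<in> spectrum ?A \<Longrightarrow> least_real_part B \<le> Re x"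
    using Min_in[OF fin ne] Min_le[OF fin] by auto
  define S where "S = {n. \<exists>n_as z. jordan_nf ?A n_as \<and> (n, z) \<in> set n_as \<and> Re z = least_real_part B}"
  have S: "S = {n. \<exists>z. (n, z) \<in> set bs \<and> Re z = least_real_part B}"
    unfolding S_def using bs jordan_nf_unique[OF bs] by blast
  have "finite S" unfolding S by (rule finite_subset[of _ "fst ` set bs"]) force+
  moreover have "S \<noteq> {}" using min(1) unfolding S spec by force
  ultimately have "Max S \<in> S" "\<And>n. n \<in> S \<Longrightarrow> n \<le> Max S" by auto
  moreover have "max_jordan_block B = Max S" by (simp add: max_jordan_block_def S_def)
  ultimately show ?thesis
    using that[OF bs] min(2) unfolding S spec by force
qed

section \<open>The linear flow\<close>

text \<open>The order of the operator norm of \<open>exp (- t B)\<close>; its square is comparable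
  to the rate in the theorem.\<close>

definition flow_rate :: "real^'n::finite^'n \<Rightarrow> real \<Rightarrow> real" where
  "flow_rate B t = (1 + t ^ (max_jordan_block B - 1)) * exp (- least_real_part B * t)"

definition linear_flow :: "real^'n::finite^'n \<Rightarrow> (real \<Rightarrow> real^'n^'n) \<Rightarrow> bool" where
  "linear_flow B M \<longleftrightarrow> M 0 = mat 1 \<and> (\<forall>t. (M has_vector_derivative - (B ** M t)) (at t))"

definition vec_Re :: "complex^'n \<Rightarrow> real^'n" where "vec_Re w = (\<chi> i. Re (w $ i))"
definition vec_Im :: "complex^'n \<Rightarrow> real^'n" where "vec_Im w = (\<chi> i. Im (w $ i))"

lemma vec_Re_complexify: "vec_Re (complexify B *v w) = B *v vec_Re w"
  and vec_Im_complexify: "vec_Im (complexify B *v w) = B *v vec_Im w"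
  by (simp_all add: vec_Re_def vec_Im_def matrix_vector_mult_def complexify_def vec_eq_iff)

lemma norm_le_vec_Re_Im: "norm (w::complex^'n::finite) \<le> norm (vec_Re w) + norm (vec_Im w)"
proof -
  have "norm w = L2_set (\<lambda>i. cmod (w $ i)) UNIV" by (simp add: norm_vec_def)
  also have "\<dots> \<le> L2_set (\<lambda>i. \<bar>Re (w $ i)\<bar> + \<bar>Im (w $ i)\<bar>) UNIV"
    by (intro L2_set_mono cmod_le) auto
  also have "\<dots> \<le> L2_set (\<lambda>i. \<bar>Re (w $ i)\<bar>) UNIV + L2_set (\<lambda>i. \<bar>Im (w $ i)\<bar>) UNIV"
    by (rule L2_set_triangle_ineq)
  finally show ?thesis by (simp add: norm_vec_def vec_Re_def vec_Im_def)
qed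

lemma has_vector_derivative_Re:
  "(f has_vector_derivative f') F \<Longrightarrow> ((\<lambda>t. Re (f t)) has_vector_derivative Re f') F"
  by (rule bounded_linear.has_vector_derivative[OF bounded_linear_Re])

lemma has_vector_derivative_Im:
  "(f has_vector_derivative f') F \<Longrightarrow> ((\<lambda>t. Im (f t)) has_vector_derivative Im f') F"
  by (rule bounded_linear.has_vector_derivative[OF bounded_linear_Im])

lemma matrix_vector_mult_minus_left: "(- A) *v x = - (A *v (x::real^'n::finite))"
  by (simp add: matrix_vector_mult_def vec_eq_iff sum_negf)

lemma linear_flow_vector_derivative:
  assumes "linear_flow B M"
  shows "((\<lambda>t. M t *v x) has_vector_derivative - (B *v (M t *v x))) (at t)"
  using bounded_linear.has_vector_derivative[OF bounded_linear_matrix_vector_left, of M "- (B ** M t)" "at t" x] assms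
  by (simp add: linear_flow_def matrix_vector_mul_assoc matrix_vector_mult_minus_left)

text \<open>Since \<open>B\<close> is real, the real and imaginary parts of a complex solution are
  real solutions, and uniqueness identifies them with the flow.\<close>

lemma linear_flow_complex_solution:
  fixes W :: "real \<Rightarrow> complex^'n::finite"
  assumes M: "linear_flow B M"
    and W: "\<And>t l. ((\<lambda>t. W t $ l) has_vector_derivative - (complexify B *v W t) $ l) (at t)" and "0 \<le> t"
  shows "vec_Re (W t) = M t *v vec_Re (W 0)" "vec_Im (W t) = M t *v vec_Im (W 0)"
proof -
  have 0: "M 0 = mat 1" using M by (simp add: linear_flow_def)
  show "vec_Re (W t) = M t *v vec_Re (W 0)"
  proof (rule linear_ode_unique[OF _ linear_flow_vector_derivative[OF M] _ \<open>0 \<le> t\<close>])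
    show "((\<lambda>t. vec_Re (W t)) has_vector_derivative - (B *v vec_Re (W t))) (at t)" for t
      unfolding vec_Re_complexify[symmetric]
      by (rule has_vector_derivative_vec) (use has_vector_derivative_Re[OF W] in \<open>simp add: vec_Re_def\<close>)
  qed (simp add: 0)
  show "vec_Im (W t) = M t *v vec_Im (W 0)"
  proof (rule linear_ode_unique[OF _ linear_flow_vector_derivative[OF M] _ \<open>0 \<le> t\<close>])
    show "((\<lambda>t. vec_Im (W t)) has_vector_derivative - (B *v vec_Im (W t))) (at t)" for t
      unfolding vec_Im_complexify[symmetric]
      by (rule has_vector_derivative_vec) (use has_vector_derivative_Im[OF W] in \<open>simp add: vec_Im_def\<close>)
  qed (simp add: 0)
qed

text \<open>Both sides applied to \<open>x\<close> solve the same equation with initial value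
  \<open>B *v x\<close>. Transposing the flow reverses products, so commutation is what yields the
  equation with \<open>transpose B\<close>.\<close>

lemma linear_flow_commute:
  assumes M: "linear_flow B M" and "0 \<le> t"
  shows "M t ** B = B ** M t"
proof -
  have "M t *v (B *v x) = B *v (M t *v x)" for x
  proof (rule linear_ode_unique[OF linear_flow_vector_derivative[OF M] _ _ \<open>0 \<le> t\<close>])
    show "((\<lambda>t. B *v (M t *v x)) has_vector_derivative - (B *v (B *v (M t *v x)))) (at t)" for t
      using bounded_linear.has_vector_derivative[OF matrix_vector_mul_bounded_linear linear_flow_vector_derivative[OF M], of B x t]
      by (simp add: linear_neg)
  qed (use M in \<open>simp add: linear_flow_def\<close>)
  then show ?thesis by (simp add: matrix_eq matrix_vector_mul_assoc)
qed

lemma cmod_nth_le: "cmod ((w::complex^'n::finite) $ l) \<le> norm w"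
  unfolding norm_vec_def by (rule member_le_L2_set) auto

lemma sum_prod_le_norm:
  fixes u w :: "complex^'n::finite"
  shows "cmod (\<Sum>l\<in>UNIV. u $ l * w $ l) \<le> (\<Sum>l\<in>UNIV. cmod (u $ l)) * norm w"
proof -
  have "cmod (\<Sum>l\<in>UNIV. u $ l * w $ l) \<le> (\<Sum>l\<in>UNIV. cmod (u $ l) * cmod (w $ l))"
    by (rule order_trans[OF norm_sum]) (simp add: norm_mult)
  also have "\<dots> \<le> (\<Sum>l\<in>UNIV. cmod (u $ l) * norm w)"
    by (intro sum_mono mult_left_mono cmod_nth_le) auto
  finally show ?thesis by (simp add: sum_distrib_right)
qed

text \<open>The standard basis is expanded in the Jordan basis, and each Jordan vector evolves by
  its chain solution. Chains with real part above the minimum decay strictly faster; the others have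
  degree below the maximal block size.\<close>

lemma linear_flow_exists:
  fixes B :: "real^'n::finite^'n"
  obtains M C where "linear_flow B M" "0 < C"
    "\<And>t x. 0 \<le> t \<Longrightarrow> norm (M t *v x) \<le> C * flow_rate B t * norm x"
proof -
  let ?n = "CARD('n)" and ?\<rho> = "least_real_part B" and ?N = "max_jordan_block B"
  obtain bs where bs: "jordan_nf (complex_mat B) bs"
    and re: "\<And>m z. (m, z) \<in> set bs \<Longrightarrow> ?\<rho> \<le> Re z"
    and mx: "\<And>m z. (m, z) \<in> set bs \<Longrightarrow> Re z = ?\<rho> \<Longrightarrow> m \<le> ?N"
    and "\<exists>z. (?N, z) \<in> set bs \<and> Re z = ?\<rho>"
    by (rule jordan_data[of B]) blast
  obtain v u :: "nat \<Rightarrow> complex^'n"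
    where ch: "\<And>j. j < ?n \<Longrightarrow> \<exists>m z k. (m, z) \<in> set bs \<and> k < m \<and> chain_vectors (complexify B) v k z j"
      and "\<And>m z. (m, z) \<in> set bs \<Longrightarrow> \<exists>j<?n. chain_vectors (complexify B) v (m - 1) z j"
      and "\<And>i j. i < ?n \<Longrightarrow> j < ?n \<Longrightarrow> (\<Sum>l\<in>UNIV. u i $ l * v j $ l) = (if i = j then 1 else 0)"
      and ex: "\<And>x. x = (\<Sum>j<?n. (\<Sum>l\<in>UNIV. u j $ l * x $ l) *s v j)"
    by (rule jordan_basis[OF bs]) blast
  obtain m z k where mzk: "\<And>j. j < ?n \<Longrightarrow> (m j, z j) \<in> set bs \<and> k j < m j \<and> chain_vectors (complexify B) v (k j) (z j) j"
    using ch by metis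
  define w where "w j = chain_solution v (k j) (z j) j" for j
  have w: "((\<lambda>t. w j t $ l) has_vector_derivative - (complexify B *v w j t) $ l) (at t)" if "j < ?n" for j l t
    unfolding w_def by (rule chain_solution_derivative) (use mzk that in auto)
  \<comment> \<open>Column \<open>i\<close> is the evolution of \<open>axis i 1\<close>, whose
    coefficients in the basis \<open>v\<close> are \<open>u j $ i\<close>. The real part makes
    \<open>M\<close> real by construction; it still solves the equation because \<open>B\<close> is
    real.\<close>
  define M :: "real \<Rightarrow> real^'n^'n" where "M t = (\<chi> l i. Re (\<Sum>j<?n. u j $ i * w j t $ l))" for t
  have flow: "linear_flow B M"
    unfolding linear_flow_def
  proof (intro conjI allI)
    show "M 0 = mat 1"
    proof -
      have "(\<Sum>j<?n. u j $ i * w j 0 $ l) = (if l = i then 1 else 0)" for i l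
      proof -
        have "(\<Sum>j<?n. u j $ i * w j 0 $ l) = (\<Sum>j<?n. (\<Sum>q\<in>UNIV. u j $ q * axis i 1 $ q) *s v j) $ l"
          by (simp add: w_def chain_solution_zero axis_def if_distrib[of "(*) _"] cong: if_cong)
        also have "\<dots> = axis i 1 $ l" 
          using arg_cong[OF ex[of "axis i 1"], of "\<lambda>x. x $ l"] by (rule sym)
        finally show ?thesis by (simp add: axis_def)
      qed
      then show ?thesis by (simp add: M_def mat_def vec_eq_iff)
    qed
    show "(M has_vector_derivative - (B ** M t)) (at t)" for t
    proof (intro has_vector_derivative_vec)
      fix l i
      have "((\<lambda>t. Re (\<Sum>j<?n. u j $ i * w j t $ l)) has_vector_derivative
          Re (\<Sum>j<?n. u j $ i * - (complexify B *v w j t) $ l)) (at t)"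
        by (rule has_vector_derivative_Re, rule has_vector_derivative_sum, rule has_vector_derivative_mult_right)
           (simp add: w)
      moreover have "Re (\<Sum>j<?n. u j $ i * - (complexify B *v w j t) $ l) = (- (B ** M t)) $ l $ i"
      proof -
        have "Re (\<Sum>j<?n. u j $ i * - (complexify B *v w j t) $ l) =
            - Re (\<Sum>q\<in>UNIV. \<Sum>j<?n. complex_of_real (B $ l $ q) * (u j $ i * w j t $ q))"
          by (subst sum.swap) (simp add: matrix_vector_mult_def complexify_def sum_distrib_left sum_negf mult_ac)
        also have "\<dots> = - (\<Sum>q\<in>UNIV. B $ l $ q * Re (\<Sum>j<?n. u j $ i * w j t $ q))"
        proof -
          define S where "S q = (\<Sum>j<?n. u j $ i * w j t $ q)" for q
          show ?thesis by (simp add: S_def[symmetric] sum_distrib_left[symmetric])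
        qed
        finally show ?thesis by (simp add: M_def matrix_matrix_mult_def)
      qed
      ultimately show "((\<lambda>t. M t $ l $ i) has_vector_derivative (- (B ** M t)) $ l $ i) (at t)"
        by (simp add: M_def)
    qed
  qed
  have "\<exists>K\<ge>0. \<forall>t\<ge>0. norm (w j t) \<le> K * flow_rate B t" if "j < ?n" for j
  proof -
    have a: "(m j, z j) \<in> set bs" "k j < m j" using mzk[OF that] by auto
    show ?thesis
      unfolding w_def flow_rate_def
    proof (rule chain_solution_bound[OF re[OF a(1)]])
      show "k j \<le> ?N - 1" if "Re (z j) = ?\<rho>"
        using mx[OF a(1) that] a(2) by linarith
    qed
  qed
  then obtain K where K0: "\<And>j. j < ?n \<Longrightarrow> K j \<ge> 0"
    and K: "\<And>j t. j < ?n \<Longrightarrow> 0 \<le> t \<Longrightarrow> norm (w j t) \<le> K j * flow_rate B t"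
    by metis
  define C where "C = (\<Sum>l\<in>(UNIV::'n set). \<Sum>i\<in>(UNIV::'n set). \<Sum>j<?n. cmod (u j $ i) * K j)"
  have "C \<ge> 0" unfolding C_def using K0 by (intro sum_nonneg) auto
  have "norm (M t *v x) \<le> (C + 1) * flow_rate B t * norm x" if t: "0 \<le> t" for t x
  proof -
    have fr: "0 \<le> flow_rate B t" using t by (simp add: flow_rate_def)
    have entry: "\<bar>M t $ l $ i\<bar> \<le> (\<Sum>j<?n. cmod (u j $ i) * K j) * flow_rate B t" for l i
    proof -
      have "\<bar>M t $ l $ i\<bar> \<le> cmod (\<Sum>j<?n. u j $ i * w j t $ l)"
        by (simp add: M_def abs_Re_le_cmod del: Re_sum)
      also have "\<dots> \<le> (\<Sum>j<?n. cmod (u j $ i) * cmod (w j t $ l))"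
        by (rule order_trans[OF norm_sum]) (simp add: norm_mult)
      also have "\<dots> \<le> (\<Sum>j<?n. cmod (u j $ i) * (K j * flow_rate B t))"
      proof (intro sum_mono mult_left_mono)
        fix j assume "j \<in> {..<?n}"
        then show "cmod (w j t $ l) \<le> K j * flow_rate B t"
          using order_trans[OF cmod_nth_le K[of j t]] t by simp
      qed auto
      also have "\<dots> = (\<Sum>j<?n. cmod (u j $ i) * K j) * flow_rate B t"
        by (subst sum_distrib_right) (simp add: mult_ac)
      finally show ?thesis .
    qed
    have "norm (M t *v x) \<le> (\<Sum>l\<in>UNIV. \<bar>(M t *v x) $ l\<bar>)" by (rule norm_le_l1_cart)
    also have "\<dots> \<le> (\<Sum>l\<in>UNIV. \<Sum>i\<in>UNIV. \<bar>M t $ l $ i\<bar> * \<bar>x $ i\<bar>)"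
      by (intro sum_mono) (simp add: matrix_vector_mult_def order_trans[OF sum_abs] abs_mult)
    also have "\<dots> \<le> (\<Sum>l\<in>(UNIV::'n set). \<Sum>i\<in>UNIV. ((\<Sum>j<?n. cmod (u j $ i) * K j) * flow_rate B t) * norm x)"
      using fr K0 by (intro sum_mono mult_mono entry component_le_norm_cart mult_nonneg_nonneg sum_nonneg abs_ge_zero) auto
    also have "\<dots> = C * flow_rate B t * norm x" by (simp only: C_def sum_distrib_right)
    also have "\<dots> \<le> (C + 1) * flow_rate B t * norm x" using fr by (simp add: mult_right_mono)
    finally show ?thesis .
  qed
  \<comment> \<open>The shift by 1 makes the constant positive.\<close>
  then show ?thesis using that[OF flow, of "C + 1"] \<open>C \<ge> 0\<close> by auto
qed

text \<open>The dual basis reads off the coefficients \<open>exp (- z t)\<close> and \<open>exp (- z t) (- t)\<^sup>k / k!\<close> of the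
  solution that starts at the end of a maximal chain.\<close>

lemma linear_flow_lower_bound:
  fixes B :: "real^'n::finite^'n"
  assumes M: "linear_flow B M"
  obtains c where "0 < c" "\<And>t. 0 \<le> t \<Longrightarrow> \<exists>x. x \<noteq> 0 \<and> c * flow_rate B t * norm x \<le> norm (M t *v x)"
proof -
  let ?n = "CARD('n)" and ?\<rho> = "least_real_part B" and ?k = "max_jordan_block B - 1"
  obtain bs z where bs: "jordan_nf (complex_mat B) bs"
    and z: "(max_jordan_block B, z) \<in> set bs" "Re z = ?\<rho>"
    using jordan_data by metis
  obtain v u :: "nat \<Rightarrow> complex^'n"
    where "\<And>j. j < ?n \<Longrightarrow> \<exists>m z k. (m, z) \<in> set bs \<and> k < m \<and> chain_vectors (complexify B) v k z j"
      and ch: "\<And>m z. (m, z) \<in> set bs \<Longrightarrow> \<exists>j<?n. chain_vectors (complexify B) v (m - 1) z j"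
      and dual: "\<And>i j. i < ?n \<Longrightarrow> j < ?n \<Longrightarrow> (\<Sum>l\<in>UNIV. u i $ l * v j $ l) = (if i = j then 1 else 0)"
      and "\<And>x. x = (\<Sum>j<?n. (\<Sum>l\<in>UNIV. u j $ l * x $ l) *s v j)"
    by (rule jordan_basis[OF bs]) blast
  obtain j where j: "j < ?n" and cv: "chain_vectors (complexify B) v ?k z j" using ch[OF z(1)] by blast
  have kj: "?k \<le> j" using cv by (simp add: chain_vectors_def)
  define w where "w = chain_solution v ?k z j"
  have w: "((\<lambda>t. w t $ l) has_vector_derivative - (complexify B *v w t) $ l) (at t)" for l t
    unfolding w_def by (rule chain_solution_derivative[OF cv])
  have coef: "(\<Sum>l\<in>UNIV. u (j - i) $ l * w t $ l) = exp (- z * of_real t) * ((- of_real t) ^ i / fact i)" if "i \<le> ?k" for i t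
  proof -
    have "(\<Sum>l\<in>UNIV. u (j - i) $ l * w t $ l) =
        exp (- z * of_real t) * (\<Sum>q\<le>?k. (- of_real t) ^ q / fact q * (\<Sum>l\<in>UNIV. u (j - i) $ l * v (j - q) $ l))"
      by (simp add: w_def chain_solution_nth sum_distrib_left mult_ac sum.swap[of _ UNIV])
    also have "(\<Sum>q\<le>?k. (- complex_of_real t) ^ q / fact q * (\<Sum>l\<in>UNIV. u (j - i) $ l * v (j - q) $ l)) =
        (\<Sum>q\<le>?k. if q = i then (- of_real t) ^ i / fact i else 0)"
    proof (intro sum.cong refl)
      fix q assume "q \<in> {..?k}"
      then have "j - i = j - q \<longleftrightarrow> q = i" using that kj by auto
      then show "(- complex_of_real t) ^ q / fact q * (\<Sum>l\<in>UNIV. u (j - i) $ l * v (j - q) $ l) =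
          (if q = i then (- of_real t) ^ i / fact i else 0)"
        using j by (simp add: dual)
    qed
    also have "\<dots> = (- of_real t) ^ i / fact i" using that by simp
    finally show ?thesis .
  qed
  \<comment> \<open>The two sums serve \<open>coef\<close> at \<open>i = 0\<close>, which gives the
    summand 1 of \<open>flow_rate\<close>, and at \<open>i = ?k\<close>, which gives the power of
    \<open>t\<close>.\<close>
  define U where "U = (\<Sum>l\<in>UNIV. cmod (u j $ l)) + fact ?k * (\<Sum>l\<in>UNIV. cmod (u (j - ?k) $ l)) + 1"
  have U: "U > 0" unfolding U_def by (intro add_nonneg_pos add_nonneg_nonneg sum_nonneg mult_nonneg_nonneg) auto
  have low: "flow_rate B t \<le> U * norm (w t)" if t: "0 \<le> t" for t
  proof -
    have "exp (- ?\<rho> * t) = cmod (\<Sum>l\<in>UNIV. u j $ l * w t $ l)"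
      using coef[of 0 t] z by simp
    also have "\<dots> \<le> (\<Sum>l\<in>UNIV. cmod (u j $ l)) * norm (w t)" by (rule sum_prod_le_norm)
    finally have 1: "exp (- ?\<rho> * t) \<le> (\<Sum>l\<in>UNIV. cmod (u j $ l)) * norm (w t)" .
    have "t ^ ?k * exp (- ?\<rho> * t) = fact ?k * cmod (\<Sum>l\<in>UNIV. u (j - ?k) $ l * w t $ l)"
      using t z by (subst coef) (auto simp: norm_mult norm_divide norm_power)
    also have "\<dots> \<le> fact ?k * ((\<Sum>l\<in>UNIV. cmod (u (j - ?k) $ l)) * norm (w t))"
      by (intro mult_left_mono sum_prod_le_norm) auto
    finally have 2: "t ^ ?k * exp (- ?\<rho> * t) \<le> fact ?k * ((\<Sum>l\<in>UNIV. cmod (u (j - ?k) $ l)) * norm (w t))" .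
    have "flow_rate B t = exp (- ?\<rho> * t) + t ^ ?k * exp (- ?\<rho> * t)"
      by (simp add: flow_rate_def algebra_simps)
    also have "\<dots> \<le> U * norm (w t)"
      using 1 2 norm_ge_zero[of "w t"] unfolding U_def distrib_right by linarith
    finally show ?thesis .
  qed
  define a where "a = norm (vec_Re (w 0)) + norm (vec_Im (w 0)) + 1"
  have a: "a > 0" unfolding a_def by (intro add_nonneg_pos) auto
  define c where "c = 1 / (U * a)"
  have c: "c > 0" using U a by (simp add: c_def)
  have "\<exists>x. x \<noteq> 0 \<and> c * flow_rate B t * norm x \<le> norm (M t *v x)" if t: "0 \<le> t" for t
  \<comment> \<open>The slow solution \<open>w\<close> is complex, and which of its real and
    imaginary parts is large may depend on \<open>t\<close>. If no real \<open>x\<close> were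
    suitable, both parts would be small, contradicting \<open>low\<close>; the summand 1 in
    \<open>a\<close> makes the contradiction strict.\<close>
  proof (rule ccontr)
    assume "\<not> ?thesis"
    then have le: "norm (M t *v x) \<le> c * flow_rate B t * norm x" for x
      by (cases "x = 0") (auto simp: not_le less_imp_le)
    have fr: "0 < flow_rate B t" using t by (simp add: flow_rate_def add_pos_nonneg)
    have "norm (w t) \<le> norm (M t *v vec_Re (w 0)) + norm (M t *v vec_Im (w 0))"
      using norm_le_vec_Re_Im[of "w t"] linear_flow_complex_solution[OF M w t] by simp
    also have "\<dots> \<le> c * flow_rate B t * (a - 1)"
      using add_mono[OF le le, of "vec_Re (w 0)" "vec_Im (w 0)"] by (simp add: a_def algebra_simps)
    also have "\<dots> < c * flow_rate B t * a" using c fr by simp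
    finally have "U * norm (w t) < U * (c * flow_rate B t * a)" using U by simp
    also have "\<dots> = flow_rate B t" using U a by (simp add: c_def)
    finally show False using low[OF t] by simp
  qed
  with c show ?thesis using that by blast
qed

section \<open>The Lyapunov equation and the stationary quadratic form\<close>

declare transpose_matrix_vector [simp del]

lemma inner_transpose: "(transpose A *v x) \<bullet> y = x \<bullet> (A *v (y::real^'n::finite))"
  by (metis dot_lmul_matrix inner_commute transpose_matrix_vector transpose_transpose)

lemma inner_symmetric: "transpose A = A \<Longrightarrow> x \<bullet> (A *v y) = y \<bullet> (A *v (x::real^'n::finite))"
  by (metis inner_transpose inner_commute)

text \<open>Moving from \<open>x\<close> by \<open>- e\<close> in the direction
  \<open>A *v x\<close> changes the form, which vanishes at \<open>x\<close>, to first order by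
  \<open>- 2 * e * a\<close>. Nonnegativity then forces \<open>a = 0\<close>.\<close>

lemma psd_kernel:
  fixes A :: "real^'n::finite^'n"
  assumes "transpose A = A" and psd: "\<And>x. 0 \<le> x \<bullet> (A *v x)" and "x \<bullet> (A *v x) = 0"
  shows "A *v x = 0"
proof -
  define y where "y = A *v x"
  define a where "a = y \<bullet> y"
  define b where "b = y \<bullet> (A *v y)"
  have "b \<ge> 0" "a \<ge> 0" using psd by (auto simp: a_def b_def)
  \<comment> \<open>The minimiser would be \<open>a / b\<close>; the summand 1 covers
    \<open>b = 0\<close>.\<close>
  define e where "e = a / (b + 1)"
  have "0 \<le> (x - e *\<^sub>R y) \<bullet> (A *v (x - e *\<^sub>R y))" by (rule psd)
  also have "\<dots> = e\<^sup>2 * b - 2 * e * a"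
    using assms(3) inner_symmetric[OF assms(1), of x y]
    by (simp add: matrix_vector_mult_diff_distrib matrix_vector_mult_scaleR inner_diff y_def[symmetric] a_def b_def
        power2_eq_square inner_commute algebra_simps)
  also have "\<dots> = - (a\<^sup>2 * (b + 2) / (b + 1)\<^sup>2)"
  proof -
    have "e * (b + 1) = a" using \<open>b \<ge> 0\<close> by (simp add: e_def)
    then have "e\<^sup>2 * b - 2 * e * a = - (e\<^sup>2 * (b + 2))" by (auto simp: power2_eq_square algebra_simps)
    then show ?thesis by (simp add: e_def power_divide)
  qed
  finally have "a\<^sup>2 * (b + 2) / (b + 1)\<^sup>2 \<le> 0" by simp
  then have "a\<^sup>2 * (b + 2) \<le> 0" using \<open>b \<ge> 0\<close> by (simp add: divide_le_0_iff)
  then have "a = 0" using \<open>b \<ge> 0\<close> by (simp add: mult_le_0_iff)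
  then show ?thesis by (simp add: a_def y_def)
qed

lemma flow_rate_tendsto_zero:
  assumes "least_real_part B > 0"
  shows "(flow_rate B \<longlongrightarrow> 0) at_top"
proof -
  have "((\<lambda>t. (1 + t ^ k) * exp (- r * t)) \<longlongrightarrow> 0) at_top" if "r > 0" for r :: real and k
    using that by real_asymp
  then show ?thesis using assms by (simp add: flow_rate_def[abs_def])
qed

text \<open>Abstracts from the Jordan form: the Lyapunov theory needs only the differential equation
  for \<open>t \<ge> 0\<close> and decay at infinity.\<close>

locale adjoint_flow =
  fixes B :: "real^'n::finite^'n" and E :: "real \<Rightarrow> real^'n^'n"
  assumes flow_0: "E 0 = mat 1"
    and flow_derivative: "0 \<le> t \<Longrightarrow>
      ((\<lambda>t. E t *v \<xi>) has_vector_derivative - (transpose B *v (E t *v \<xi>))) (at t)"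
    and flow_tendsto: "((\<lambda>t. E t *v \<xi>) \<longlongrightarrow> 0) at_top"
begin

lemma flow_form_derivative:
  assumes "0 \<le> t"
  shows "((\<lambda>t. (E t *v \<xi>) \<bullet> (X *v (E t *v \<eta>))) has_real_derivative
     - ((E t *v \<xi>) \<bullet> ((B ** X + X ** transpose B) *v (E t *v \<eta>)))) (at t)"
proof -
  have "((\<lambda>t. X *v (E t *v \<eta>)) has_vector_derivative X *v - (transpose B *v (E t *v \<eta>))) (at t)"
    by (rule bounded_linear.has_vector_derivative[OF matrix_vector_mul_bounded_linear flow_derivative[OF assms]])
  from has_derivative_inner[OF flow_derivative[OF assms, unfolded has_vector_derivative_def] this[unfolded has_vector_derivative_def]]
  show ?thesis
    unfolding has_field_derivative_def
  proof (rule has_derivative_eq_rhs, intro ext)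
    fix h :: real
    have "(E t *v \<xi>) \<bullet> h *\<^sub>R (X *v - (transpose B *v (E t *v \<eta>))) +
        h *\<^sub>R - (transpose B *v (E t *v \<xi>)) \<bullet> (X *v (E t *v \<eta>)) =
      - ((E t *v \<xi>) \<bullet> (X *v (transpose B *v (E t *v \<eta>))) + (E t *v \<xi>) \<bullet> (B *v (X *v (E t *v \<eta>)))) * h"
      by (simp add: inner_transpose linear_neg algebra_simps)
    then show "(E t *v \<xi>) \<bullet> h *\<^sub>R (X *v - (transpose B *v (E t *v \<eta>))) +
        h *\<^sub>R - (transpose B *v (E t *v \<xi>)) \<bullet> (X *v (E t *v \<eta>)) =
        - ((E t *v \<xi>) \<bullet> ((B ** X + X ** transpose B) *v (E t *v \<eta>))) * h"
      by (simp add: matrix_vector_mult_add_rdistrib inner_add_right flip: matrix_vector_mul_assoc)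
  qed
qed

lemma flow_form_tendsto: "((\<lambda>t. (E t *v \<xi>) \<bullet> (X *v (E t *v \<eta>))) \<longlongrightarrow> 0) at_top"
proof -
  have "((\<lambda>t. X *v (E t *v \<eta>)) \<longlongrightarrow> X *v 0) at_top"
    by (rule bounded_linear.tendsto[OF matrix_vector_mul_bounded_linear flow_tendsto])
  from tendsto_inner[OF flow_tendsto this] show ?thesis by simp
qed

text \<open>Along the flow the bilinear form of such an \<open>X\<close> is constant, yet it tends
  to 0.\<close>

lemma lyapunov_zero:
  assumes "B ** X + X ** transpose B = 0"
  shows "X = 0"
proof -
  have "\<xi> \<bullet> (X *v \<eta>) = 0" for \<xi> \<eta>
  proof -
    have "\<exists>c. \<forall>t\<in>{0..}. (E t *v \<xi>) \<bullet> (X *v (E t *v \<eta>)) = c"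
    proof (rule has_field_derivative_zero_constant)
      fix t :: real assume "t \<in> {0..}"
      then show "((\<lambda>t. (E t *v \<xi>) \<bullet> (X *v (E t *v \<eta>))) has_real_derivative 0) (at t within {0..})"
        using flow_form_derivative[of t \<xi> X \<eta>] assms by (simp add: has_field_derivative_at_within)
    qed simp
    then obtain c where c: "\<And>t. 0 \<le> t \<Longrightarrow> (E t *v \<xi>) \<bullet> (X *v (E t *v \<eta>)) = c" by auto
    have "((\<lambda>t. (E t *v \<xi>) \<bullet> (X *v (E t *v \<eta>))) \<longlongrightarrow> c) at_top"
      by (rule tendsto_eventually) (auto simp: c intro: eventually_at_top_linorderI[of 0])
    from tendsto_unique[OF _ this flow_form_tendsto] have "c = 0" by simp
    then show ?thesis using c[of 0] by (simp add: flow_0)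
  qed
  then have "X *v \<eta> = 0" for \<eta> by (metis inner_eq_zero_iff)
  then show ?thesis by (simp add: matrix_eq)
qed

text \<open>The Lyapunov map is an injective linear endomorphism of a finite-dimensional space,
  hence surjective, so no integral formula for \<open>S\<close> has to be set up. Symmetry follows
  from injectivity, because \<open>transpose S\<close> solves the same equation.\<close>

lemma lyapunov_solution:
  assumes "transpose D = D"
  obtains S where "transpose S = S" "B ** S + S ** transpose B = 2 *\<^sub>R D"
proof -
  let ?L = "\<lambda>X. B ** X + X ** transpose B"
  have lin: "linear ?L"
    by (rule linearI)
      (simp_all add: matrix_matrix_mult_def vec_eq_iff sum.distrib sum_distrib_left scaleR_sum_right algebra_simps)
  have "inj ?L" by (rule linear_injective_0[OF lin, THEN iffD2]) (blast intro: lyapunov_zero)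
  then have "surj ?L" by (rule linear_injective_imp_surjective[OF lin]) simp
  then obtain S where S: "?L S = 2 *\<^sub>R D" unfolding surj_def by metis
  have tr: "transpose (X + Y) = transpose X + transpose Y" for X Y :: "real^'n^'n"
    by (simp add: transpose_def vec_eq_iff)
  have trs: "transpose (c *\<^sub>R X) = c *\<^sub>R transpose X" for c and X :: "real^'n^'n"
    by (simp add: transpose_def vec_eq_iff)
  have "?L (transpose S) = transpose (?L S)"
    by (simp add: tr matrix_transpose_mul transpose_transpose add.commute)
  also have "\<dots> = ?L S" unfolding S using assms by (simp add: trs)
  finally have "transpose S = S" by (rule injD[OF \<open>inj ?L\<close>])
  then show ?thesis by (rule that[OF _ S])
qed

end

locale stationary_flow = adjoint_flow +
  fixes D S :: "real^'n^'n"
  assumes D_sym: "transpose D = D" and D_psd: "0 \<le> x \<bullet> (D *v x)"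
    and S_sym: "transpose S = S" and lyapunov: "B ** S + S ** transpose B = 2 *\<^sub>R D"
begin

definition q :: "real^'n \<Rightarrow> real" where "q \<xi> = (\<xi> \<bullet> (S *v \<xi>)) / 2"

text \<open>The Lyapunov equation is made for this: \<open>q\<close> dissipates exactly by the form
  of \<open>D\<close>, the same form that the second order part of the generator produces on a plane
  wave.\<close>

lemma q_flow_derivative:
  assumes "0 \<le> t"
  shows "((\<lambda>t. q (E t *v \<xi>)) has_real_derivative - ((E t *v \<xi>) \<bullet> (D *v (E t *v \<xi>)))) (at t)"
  using DERIV_cdivide[OF flow_form_derivative[OF assms, of \<xi> S \<xi>], of 2]
  by (simp add: q_def lyapunov flip: scaleR_matrix_vector_assoc)

lemma q_flow_antimono:
  assumes "0 \<le> s" "s \<le> t"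
  shows "q (E t *v \<xi>) \<le> q (E s *v \<xi>)"
proof (rule DERIV_nonpos_imp_nonincreasing[OF assms(2)])
  fix r assume "s \<le> r"
  then have "0 \<le> r" using assms(1) by simp
  from q_flow_derivative[OF this, of \<xi>] D_psd[of "E r *v \<xi>"]
  show "\<exists>y. ((\<lambda>t. q (E t *v \<xi>)) has_real_derivative y) (at r) \<and> y \<le> 0" by force
qed

lemma q_flow_le: "0 \<le> t \<Longrightarrow> q (E t *v \<xi>) \<le> q \<xi>"
  using q_flow_antimono[of 0 t \<xi>] by (simp add: flow_0)

lemma q_flow_tendsto: "((\<lambda>t. q (E t *v \<xi>)) \<longlongrightarrow> 0) at_top"
  unfolding q_def using tendsto_divide_zero[OF flow_form_tendsto] .

text \<open>\<open>S\<close> was obtained by surjectivity, which says nothing about its sign; the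
  sign comes from \<open>q\<close> decreasing to 0 along the flow.\<close>

lemma q_nonneg: "0 \<le> q \<xi>"
  by (rule tendsto_upperbound[OF q_flow_tendsto[of \<xi>]])
     (auto intro!: eventually_at_top_linorderI[of 0] q_flow_le)

lemma q_zero: "q 0 = 0" by (simp add: q_def)

text \<open>The kernel of \<open>S\<close> is contained in the kernel of \<open>D\<close> and invariant under \<open>transpose B\<close>.\<close>

lemma q_positive:
  assumes "\<not> (\<exists>V. subspace V \<and> V \<noteq> {0} \<and> V \<subseteq> {x. D *v x = 0} \<and> (\<lambda>v. transpose B *v v) ` V \<subseteq> V)"
    and "\<xi> \<noteq> 0"
  shows "0 < q \<xi>"
proof (rule ccontr)
  assume "\<not> 0 < q \<xi>"
  then have "q \<xi> = 0" using q_nonneg[of \<xi>] by simp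
  have psd: "0 \<le> x \<bullet> (S *v x)" for x using q_nonneg[of x] by (simp add: q_def)
  define V where "V = {x. S *v x = 0}"
  have "subspace V" 
    unfolding V_def by (rule linear_subspace_kernel) simp
  moreover have "\<xi> \<in> V"
    using psd_kernel[OF S_sym psd, of \<xi>] \<open>q \<xi> = 0\<close> by (simp add: V_def q_def)
  then have "V \<noteq> {0}" using \<open>\<xi> \<noteq> 0\<close> by auto
  moreover have V: "D *v x = 0 \<and> transpose B *v x \<in> V" if "x \<in> V" for x
  proof -
    have x: "S *v x = 0" using that by (simp add: V_def)
    have *: "B *v (S *v x) + S *v (transpose B *v x) = 2 *\<^sub>R (D *v x)"
      using arg_cong[OF lyapunov, of "\<lambda>A. A *v x"]
      by (simp add: matrix_vector_mult_add_rdistrib matrix_vector_mul_assoc scaleR_matrix_vector_assoc)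
    have "2 * (x \<bullet> (D *v x)) = x \<bullet> (S *v (transpose B *v x))"
      using arg_cong[OF *, of "\<lambda>y. x \<bullet> y"] x by (simp add: inner_add_right)
    also have "\<dots> = 0" using inner_symmetric[OF S_sym, of x "transpose B *v x"] x by simp
    finally have "D *v x = 0" using psd_kernel[OF D_sym D_psd, of x] by simp
    \<comment> \<open>With \<open>S *v x = 0\<close> and \<open>D *v x = 0\<close>, the Lyapunov
      equation leaves only \<open>S *v (transpose B *v x) = 0\<close>.\<close>
    then show ?thesis using * x by (simp add: V_def)
  qed
  ultimately show False using assms(1) by blast
qed

end

text \<open>A matrix and its transpose have the same operator norm; both halves of this duality
  argument are carried out by Cauchy-Schwarz.\<close>

lemma adjoint_flow_exists:
  fixes B :: "real^'n::finite^'n"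
  assumes "least_real_part B > 0"
  obtains E c C where "adjoint_flow B E" "0 < c" "0 < C"
    "\<And>t \<xi>. 0 \<le> t \<Longrightarrow> norm (E t *v \<xi>) \<le> C * flow_rate B t * norm \<xi>"
    "\<And>t. 0 \<le> t \<Longrightarrow> \<exists>\<xi>. \<xi> \<noteq> 0 \<and> c * flow_rate B t * norm \<xi> \<le> norm (E t *v \<xi>)"
proof -
  obtain M C where M: "linear_flow B M" and C: "0 < C"
    and up: "\<And>t x. 0 \<le> t \<Longrightarrow> norm (M t *v x) \<le> C * flow_rate B t * norm x"
    using linear_flow_exists[of B] by metis
  obtain c where c: "0 < c" and low: "\<And>t. 0 \<le> t \<Longrightarrow> \<exists>x. x \<noteq> 0 \<and> c * flow_rate B t * norm x \<le> norm (M t *v x)"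
    using linear_flow_lower_bound[OF M] by metis
  define E where "E t = transpose (M t)" for t
  have Ei: "(E t *v x) \<bullet> y = x \<bullet> (M t *v y)" for t x y by (simp add: E_def inner_transpose)
  have fr: "0 < flow_rate B t" if "0 \<le> t" for t using that by (simp add: flow_rate_def add_pos_nonneg)
  have upE: "norm (E t *v \<xi>) \<le> C * flow_rate B t * norm \<xi>" if t: "0 \<le> t" for t \<xi>
  proof (cases "E t *v \<xi> = 0")
    case True then show ?thesis using C fr[OF t] by simp
  next
    case False
    have "norm (E t *v \<xi>) * norm (E t *v \<xi>) = \<xi> \<bullet> (M t *v (E t *v \<xi>))"
      by (simp add: Ei[symmetric] dot_square_norm power2_eq_square)
    also have "\<dots> \<le> norm \<xi> * (C * flow_rate B t * norm (E t *v \<xi>))"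
      using order_trans[OF norm_cauchy_schwarz mult_left_mono[OF up[OF t]]] by auto
    finally show ?thesis using False by (simp add: mult_ac)
  qed
  have lowE: "\<exists>\<xi>. \<xi> \<noteq> 0 \<and> c * flow_rate B t * norm \<xi> \<le> norm (E t *v \<xi>)" if t: "0 \<le> t" for t
  proof -
    obtain x where x: "x \<noteq> 0" "c * flow_rate B t * norm x \<le> norm (M t *v x)" using low[OF t] by blast
    \<comment> \<open>If \<open>x\<close> is stretched by \<open>M t\<close>, then its image is
      stretched by the transpose at least as much.\<close>
    define \<xi> where "\<xi> = M t *v x"
    have "0 < c * flow_rate B t * norm x" using c fr[OF t] x(1) by simp
    then have "\<xi> \<noteq> 0" using x(2) by (auto simp: \<xi>_def)
    have "c * flow_rate B t * norm x * norm \<xi> \<le> norm \<xi> * norm \<xi>"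
      using x(2) by (intro mult_right_mono) (auto simp: \<xi>_def)
    also have "\<dots> = (E t *v \<xi>) \<bullet> x" by (simp add: Ei \<xi>_def dot_square_norm power2_eq_square)
    also have "\<dots> \<le> norm (E t *v \<xi>) * norm x" by (rule norm_cauchy_schwarz)
    finally have "(c * flow_rate B t * norm \<xi>) * norm x \<le> norm (E t *v \<xi>) * norm x" by (simp add: mult_ac)
    then have "c * flow_rate B t * norm \<xi> \<le> norm (E t *v \<xi>)" using x(1) by (simp add: mult_le_cancel_right)
    then show ?thesis using \<open>\<xi> \<noteq> 0\<close> by blast
  qed
  have "adjoint_flow B E"
  proof
    show "E 0 = mat 1" using M by (simp add: E_def linear_flow_def transpose_mat)
    fix \<xi> :: "real^'n"
    show "((\<lambda>t. E t *v \<xi>) has_vector_derivative - (transpose B *v (E t *v \<xi>))) (at t)" if t: "0 \<le> t" for t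
    proof -
      have tr: "bounded_linear (\<lambda>A::real^'n^'n. transpose A *v \<xi>)"
        by (rule linear_conv_bounded_linear[THEN iffD1], rule linearI)
          (simp_all add: transpose_def matrix_vector_mult_def vec_eq_iff sum.distrib sum_distrib_left algebra_simps)
      have "((\<lambda>t. E t *v \<xi>) has_vector_derivative transpose (- (B ** M t)) *v \<xi>) (at t)"
        unfolding E_def by (rule bounded_linear.has_vector_derivative[OF tr]) (use M in \<open>simp add: linear_flow_def\<close>)
      also have "transpose (- (B ** M t)) = - transpose (M t ** B)"
        using linear_flow_commute[OF M t] by (simp add: transpose_def vec_eq_iff)
      finally show ?thesis
        by (simp add: E_def matrix_transpose_mul matrix_vector_mult_minus_left matrix_vector_mul_assoc)
    qed
    show "((\<lambda>t. E t *v \<xi>) \<longlongrightarrow> 0) at_top"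
    proof (rule Lim_null_comparison)
      show "\<forall>\<^sub>F t in at_top. norm (E t *v \<xi>) \<le> C * flow_rate B t * norm \<xi>"
        using upE by (auto intro: eventually_at_top_linorderI[of 0])
      show "((\<lambda>t. C * flow_rate B t * norm \<xi>) \<longlongrightarrow> 0) at_top"
        using tendsto_mult_left_zero[OF tendsto_mult_right_zero[OF flow_rate_tendsto_zero[OF assms]]] .
    qed
  qed
  then show ?thesis using that c C upE lowE by blast
qed

section \<open>Test functions and the logarithmic cutoff\<close>

text \<open>Gradient and Hessian are explicit witnesses, so that products and compositions have
  computable derivatives and the generator becomes pointwise algebra in
  \<open>generator_at\<close>.\<close>

definition C2_fun ::
  "(real^'n::finite \<Rightarrow> real) \<Rightarrow> (real^'n \<Rightarrow> real^'n) \<Rightarrow> (real^'n \<Rightarrow> real^'n^'n) \<Rightarrow> bool" where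
  "C2_fun f g H \<longleftrightarrow>
     (\<forall>x. (f has_derivative (\<lambda>v. g x \<bullet> v)) (at x)) \<and>
     (\<forall>x. (g has_derivative (\<lambda>v. H x *v v)) (at x)) \<and> continuous_on UNIV H"

lemma C2_funD:
  assumes "C2_fun f g H"
  shows "(f has_derivative (\<lambda>v. g x \<bullet> v)) (at x)" "(g has_derivative (\<lambda>v. H x *v v)) (at x)" "continuous_on UNIV H"
  using assms by (auto simp: C2_fun_def)

lemma C2_fun_continuous:
  assumes "C2_fun f g H"
  shows "continuous_on UNIV f" "continuous_on UNIV g"
  by (intro continuous_at_imp_continuous_on ballI has_derivative_continuous[OF C2_funD(1)[OF assms]],
      intro continuous_at_imp_continuous_on ballI has_derivative_continuous[OF C2_funD(2)[OF assms]])

lemma C2_fun_partial: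
  assumes "C2_fun f g H"
  shows "partial_deriv i f = (\<lambda>x. g x $ i)" "partial_deriv j (\<lambda>x. g x $ i) = (\<lambda>x. H x $ i $ j)"
proof -
  show "partial_deriv i f = (\<lambda>x. g x $ i)"
    by (rule ext) (simp add: partial_deriv_def frechet_derivative_at[OF C2_funD(1)[OF assms], symmetric] inner_axis)
  have d: "((\<lambda>x. g x $ i) has_derivative (\<lambda>v. (H x *v v) $ i)) (at x)" for x
    by (rule bounded_linear.has_derivative[OF bounded_linear_vec_nth C2_funD(2)[OF assms]])
  show "partial_deriv j (\<lambda>x. g x $ i) = (\<lambda>x. H x $ i $ j)"
    by (rule ext) (simp add: partial_deriv_def frechet_derivative_at[OF d, symmetric] matrix_vector_mul_component inner_axis)
qed

definition form_trace :: "real^'n::finite^'n \<Rightarrow> real^'n^'n \<Rightarrow> real" where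
  "form_trace D H = (\<Sum>i\<in>UNIV. \<Sum>j\<in>UNIV. D $ i $ j * H $ j $ i)"

definition generator_at :: "real^'n::finite^'n \<Rightarrow> real^'n^'n \<Rightarrow> real^'n \<Rightarrow> real^'n \<Rightarrow> real^'n^'n \<Rightarrow> real" where
  "generator_at B D x g H = - ((B *v x) \<bullet> g) + form_trace D H"

lemma ou_generator_C2_fun:
  assumes "C2_fun f g H"
  shows "ou_generator B D f x = generator_at B D x (g x) (H x)"
proof -
  have grad: "grad f = g" by (intro ext) (simp add: grad_def C2_fun_partial[OF assms] vec_eq_iff)
  have "partial_deriv i (\<lambda>y. (D *v g y) $ i) x = (\<Sum>j\<in>UNIV. D $ i $ j * H x $ j $ i)" for i
  proof -
    have "((\<lambda>y. (D *v g y) $ i) has_derivative (\<lambda>v. (D *v (H x *v v)) $ i)) (at x)"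
      by (rule bounded_linear.has_derivative[OF bounded_linear_vec_nth]
          bounded_linear.has_derivative[OF matrix_vector_mul_bounded_linear] C2_funD(2)[OF assms])+
    then show ?thesis
      by (simp add: partial_deriv_def frechet_derivative_at[symmetric])
        (simp add: matrix_vector_mult_def axis_def if_distrib[of "(*) _"] cong: if_cong)
  qed
  then show ?thesis
    by (simp add: ou_generator_def generator_at_def divergence_def form_trace_def grad)
qed

lemma C2_fun_compact_support:
  assumes "C2_fun f g H" "bounded {x. f x \<noteq> 0}"
  shows "f \<in> C2_compact_support"
proof -
  have "(\<lambda>x. g x $ i) differentiable at x" for i x
    using bounded_linear.has_derivative[OF bounded_linear_vec_nth C2_funD(2)[OF assms(1)]]
    unfolding differentiable_def by blast
  moreover have "f differentiable at x" for x
    using C2_funD(1)[OF assms(1)] unfolding differentiable_def by blast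
  moreover have "continuous_on UNIV (\<lambda>x. H x $ i $ j)" for i j
    using C2_funD(3)[OF assms(1)] by (intro continuous_on_component) 
  ultimately show ?thesis
    using assms(2) by (simp add: C2_compact_support_def C2_fun_partial[OF assms(1)])
qed

definition outer :: "real^'n \<Rightarrow> real^'n \<Rightarrow> real^'n^'n" where
  "outer a b = (\<chi> i j. a $ i * b $ j)"

lemma outer_vector: "outer a b *v v = (b \<bullet> v) *\<^sub>R a" for a :: "real^'n::finite"
  by (simp add: outer_def matrix_vector_mult_def vec_eq_iff inner_vec_def sum_distrib_left mult_ac)

lemma continuous_on_outer:
  fixes f g :: "'a::t2_space \<Rightarrow> real^'n::finite"
  shows "continuous_on A f \<Longrightarrow> continuous_on A g \<Longrightarrow> continuous_on A (\<lambda>x. outer (f x) (g x))"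
  unfolding outer_def by (intro continuous_intros)

lemma C2_fun_mult:
  assumes f: "C2_fun f g H" and f': "C2_fun f' g' H'"
  shows "C2_fun (\<lambda>x. f x * f' x) (\<lambda>x. f x *\<^sub>R g' x + f' x *\<^sub>R g x)
    (\<lambda>x. f x *\<^sub>R H' x + f' x *\<^sub>R H x + outer (g' x) (g x) + outer (g x) (g' x))"
  unfolding C2_fun_def
proof (intro conjI allI)
  fix x
  show "((\<lambda>x. f x * f' x) has_derivative (\<lambda>v. (f x *\<^sub>R g' x + f' x *\<^sub>R g x) \<bullet> v)) (at x)"
    by (auto intro!: derivative_eq_intros C2_funD(1)[OF f] C2_funD(1)[OF f'] simp: inner_add_left)
  show "((\<lambda>x. f x *\<^sub>R g' x + f' x *\<^sub>R g x) has_derivative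
      (\<lambda>v. (f x *\<^sub>R H' x + f' x *\<^sub>R H x + outer (g' x) (g x) + outer (g x) (g' x)) *v v)) (at x)"
    by (auto intro!: derivative_eq_intros C2_funD(1,2)[OF f] C2_funD(1,2)[OF f']
        simp: matrix_vector_mult_add_rdistrib outer_vector scaleR_matrix_vector_assoc[symmetric])
qed (intro continuous_intros continuous_on_outer C2_fun_continuous[OF f] C2_fun_continuous[OF f'] C2_funD(3)[OF f] C2_funD(3)[OF f'])

lemma C2_fun_compose:
  assumes f: "C2_fun f g H"
    and k: "\<And>x. (k has_real_derivative k1 (f x)) (at (f x))"
    and k1: "\<And>x. (k1 has_real_derivative k2 (f x)) (at (f x))"
    and k2: "continuous_on UNIV (\<lambda>x. k2 (f x))"
  shows "C2_fun (\<lambda>x. k (f x)) (\<lambda>x. k1 (f x) *\<^sub>R g x) (\<lambda>x. k2 (f x) *\<^sub>R outer (g x) (g x) + k1 (f x) *\<^sub>R H x)"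
  unfolding C2_fun_def
proof (intro conjI allI)
  have D: "((\<lambda>x. k (f x)) has_derivative (\<lambda>v. k1 (f x) * (g x \<bullet> v))) (at x)" for x
    using DERIV_compose_FDERIV[OF k C2_funD(1)[OF f]] by (simp add: mult.commute)
  have D1: "((\<lambda>x. k1 (f x)) has_derivative (\<lambda>v. k2 (f x) * (g x \<bullet> v))) (at x)" for x
    using DERIV_compose_FDERIV[OF k1 C2_funD(1)[OF f]] by (simp add: mult.commute)
  fix x
  show "((\<lambda>x. k (f x)) has_derivative (\<lambda>v. (k1 (f x) *\<^sub>R g x) \<bullet> v)) (at x)" using D by simp
  show "((\<lambda>x. k1 (f x) *\<^sub>R g x) has_derivative
      (\<lambda>v. (k2 (f x) *\<^sub>R outer (g x) (g x) + k1 (f x) *\<^sub>R H x) *v v)) (at x)"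
    by (auto intro!: derivative_eq_intros D1 C2_funD(2)[OF f]
        simp: matrix_vector_mult_add_rdistrib outer_vector scaleR_matrix_vector_assoc[symmetric])
  have "continuous_on UNIV (\<lambda>x. k1 (f x))"
    by (intro continuous_at_imp_continuous_on ballI has_derivative_continuous[OF D1])
  then show "continuous_on UNIV (\<lambda>x. k2 (f x) *\<^sub>R outer (g x) (g x) + k1 (f x) *\<^sub>R H x)"
    by (intro continuous_intros continuous_on_outer C2_fun_continuous[OF f] C2_funD(3)[OF f] k2)
qed

lemma C2_fun_affine: "C2_fun (\<lambda>x. \<xi> \<bullet> x + \<theta>) (\<lambda>_. \<xi>) (\<lambda>_. 0)"
  unfolding C2_fun_def by (auto intro!: derivative_eq_intros)

lemma C2_fun_cos:
  "C2_fun (\<lambda>x. cos (\<xi> \<bullet> x + \<theta>)) (\<lambda>x. (- sin (\<xi> \<bullet> x + \<theta>)) *\<^sub>R \<xi>) (\<lambda>x. (- cos (\<xi> \<bullet> x + \<theta>)) *\<^sub>R outer \<xi> \<xi>)"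
proof -
  have "C2_fun (\<lambda>x. cos (\<xi> \<bullet> x + \<theta>)) (\<lambda>x. (- sin (\<xi> \<bullet> x + \<theta>)) *\<^sub>R \<xi>)
     (\<lambda>x. (- cos (\<xi> \<bullet> x + \<theta>)) *\<^sub>R outer \<xi> \<xi> + (- sin (\<xi> \<bullet> x + \<theta>)) *\<^sub>R 0)"
    by (rule C2_fun_compose[OF C2_fun_affine]) (auto intro!: derivative_eq_intros continuous_intros)
  then show ?thesis by simp
qed

lemma form_trace_add: "form_trace D (H + H') = form_trace D H + form_trace D H'"
  by (simp add: form_trace_def sum.distrib algebra_simps)

lemma form_trace_diff: "form_trace D (H - H') = form_trace D H - form_trace D H'"
  by (simp add: form_trace_def sum_subtractf algebra_simps)

lemma form_trace_scaleR: "form_trace D (c *\<^sub>R H) = c * form_trace D H"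
  by (simp add: form_trace_def sum_distrib_left mult_ac)

lemma form_trace_outer: "form_trace D (outer a b) = b \<bullet> (D *v a)"
  by (simp add: form_trace_def outer_def inner_vec_def matrix_vector_mult_def sum_distrib_left mult_ac)

text \<open>The Leibniz rule of a second order operator; the cross term is twice the carre du champ,
  and symmetry of \<open>D\<close> merges its two halves.\<close>

lemma generator_at_mult:
  assumes "transpose D = D"
  shows "generator_at B D x (a *\<^sub>R g' + b *\<^sub>R g) (a *\<^sub>R H' + b *\<^sub>R H + outer g' g + outer g g') =
    a * generator_at B D x g' H' + b * generator_at B D x g H + 2 * (g \<bullet> (D *v g'))"
  using inner_symmetric[OF assms, of g g']
  by (simp add: generator_at_def form_trace_add form_trace_scaleR form_trace_outer inner_add_right algebra_simps)

text \<open>Used at \<open>n = 3\<close> and then at \<open>n = 2\<close>, so that the cubed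
  positive part in \<open>cutoff\<close> is of class C2. At 0 the difference quotient is at most
  \<open>\<bar>h\<bar> ^ (n - 1)\<close>.\<close>

lemma pos_part_power_derivative:
  assumes "2 \<le> n"
  shows "((\<lambda>u::real. max 0 u ^ n) has_real_derivative n * max 0 u ^ (n - 1)) (at u)"
proof (cases u "0::real" rule: linorder_cases)
  case less
  have "((\<lambda>u::real. 0) has_real_derivative n * max 0 u ^ (n - 1)) (at u)"
    using less assms by (simp add: max_def power_0_left)
  then show ?thesis
    by (rule has_field_derivative_transform_within_open[where S = "{..<0}"]) (use less assms in \<open>auto simp: max_def\<close>)
next
  case greater
  have "((\<lambda>u::real. u ^ n) has_real_derivative n * max 0 u ^ (n - 1)) (at u)"
    using greater by (auto intro!: derivative_eq_intros simp: max_def)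
  then show ?thesis
    by (rule has_field_derivative_transform_within_open[where S = "{0<..}"]) (use greater in \<open>auto simp: max_def\<close>)
next
  case equal
  have "((\<lambda>h::real. max 0 h ^ n / h) \<longlongrightarrow> 0) (at 0)"
  proof (rule Lim_null_comparison)
    have "\<bar>max 0 h ^ n / h\<bar> \<le> \<bar>h\<bar> ^ (n - 1)" for h :: real
      using assms by (cases n) (auto simp: max_def power_abs)
    then show "\<forall>\<^sub>F h in at 0. norm (max 0 h ^ n / h) \<le> \<bar>h\<bar> ^ (n - 1)" by simp
    have "((\<lambda>h::real. \<bar>h\<bar> ^ (n - 1)) \<longlongrightarrow> \<bar>0\<bar> ^ (n - 1)) (at 0)" by (intro tendsto_intros)
    moreover have "\<bar>0::real\<bar> ^ (n - 1) = 0" using assms by (simp add: power_0_left)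
    ultimately show "((\<lambda>h::real. \<bar>h\<bar> ^ (n - 1)) \<longlongrightarrow> 0) (at 0)" by (simp only:)
  qed
  then show ?thesis using equal assms by (simp add: DERIV_def power_0_left)
qed

text \<open>\<open>R\<close> lives on the logarithmic scale: the support has radius of order
  \<open>exp (R / 2)\<close>. The third power makes the truncation twice continuously
  differentiable.\<close>

definition cutoff :: "real \<Rightarrow> real^'n::finite \<Rightarrow> real" where
  "cutoff R x = max 0 (1 - ln (1 + x \<bullet> x) / R) ^ 3"

lemma cutoff_bounds:
  assumes "0 < R" shows "0 \<le> cutoff R x" "cutoff R x \<le> 1"
  using assms by (auto simp: cutoff_def intro!: power_le_one)

lemma cutoff_tendsto: "((\<lambda>R. cutoff R x) \<longlongrightarrow> 1) at_top"
proof -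
  have "((\<lambda>R. max 0 (1 - ln (1 + x \<bullet> x) / R) ^ 3) \<longlongrightarrow> max 0 (1 - 0) ^ 3) at_top"
    by (intro tendsto_intros tendsto_divide_0[OF tendsto_const] filterlim_at_top_imp_at_infinity filterlim_ident)
  then show ?thesis by (simp add: cutoff_def)
qed

lemma cutoff_support:
  assumes "0 < R" shows "bounded {x::real^'n::finite. cutoff R x \<noteq> 0}"
proof (rule boundedI)
  fix x :: "real^'n" assume "x \<in> {x. cutoff R x \<noteq> 0}"
  then have "0 < 1 - ln (1 + x \<bullet> x) / R" by (auto simp: cutoff_def max_def less_le split: if_splits)
  then have "ln (1 + x \<bullet> x) < R" using assms by (simp add: divide_less_eq)
  then have "exp (ln (1 + x \<bullet> x)) < exp R" by simp
  then have "1 + x \<bullet> x < exp R" by (simp add: add_pos_nonneg)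
  then have "(norm x)\<^sup>2 \<le> exp R" by (simp add: power2_norm_eq_inner)
  then show "norm x \<le> sqrt (exp R)" by (rule real_le_rsqrt)
qed

text \<open>The logarithm makes the drift \<open>- (B x) \<bullet> grad\<close> of the cutoff of order \<open>1 / R\<close> uniformly
  on the whole space, although the coefficient \<open>B x\<close> is unbounded.\<close>

lemma cutoff_generator:
  fixes B D :: "real^'n::finite^'n"
  obtains K where "0 \<le> K" "\<And>R. 1 \<le> R \<Longrightarrow> \<exists>g H. C2_fun (cutoff R) g H \<and>
    (\<forall>x. norm (g x) \<le> K / R \<and> \<bar>generator_at B D x (g x) (H x)\<bar> \<le> K / R)"
proof -
  obtain KB where KB: "0 < KB" "\<And>x. norm (B *v x) \<le> norm x * KB"
    using bounded_linear.pos_bounded[OF matrix_vector_mul_bounded_linear[of B]] by blast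
  obtain KD where KD: "0 < KD" "\<And>x. norm (D *v x) \<le> norm x * KD"
    using bounded_linear.pos_bounded[OF matrix_vector_mul_bounded_linear[of D]] by blast
  define T where "T = \<bar>form_trace D (mat 1)\<bar>"
  define gw :: "real^'n \<Rightarrow> real^'n" where "gw x = (1 / (1 + x \<bullet> x)) *\<^sub>R (2 *\<^sub>R x)" for x
  define Hw :: "real^'n \<Rightarrow> real^'n^'n" where
    "Hw x = (- (1 / (1 + x \<bullet> x)\<^sup>2)) *\<^sub>R outer (2 *\<^sub>R x) (2 *\<^sub>R x) + (1 / (1 + x \<bullet> x)) *\<^sub>R (2 *\<^sub>R mat 1)" for x
  have pos: "0 < 1 + x \<bullet> x" for x :: "real^'n" by (simp add: add_pos_nonneg)
  have sq: "C2_fun (\<lambda>x::real^'n. 1 + x \<bullet> x) (\<lambda>x. 2 *\<^sub>R x) (\<lambda>x. 2 *\<^sub>R mat 1)"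
    unfolding C2_fun_def
    by (auto intro!: derivative_eq_intros simp: inner_commute scaleR_matrix_vector_assoc[symmetric])
  have w: "C2_fun (\<lambda>x. ln (1 + x \<bullet> x)) gw Hw"
    unfolding gw_def Hw_def
    by (rule C2_fun_compose[OF sq])
       (use pos in \<open>auto intro!: derivative_eq_intros continuous_intros simp: less_imp_neq[symmetric] power2_eq_square\<close>)
  \<comment> \<open>The gradient of the logarithm decays like \<open>1 / norm x\<close>, which
    balances the linear growth of the drift \<open>B *v x\<close>.\<close>
  have gw1: "norm (gw x) \<le> 1" and gw2: "norm x * norm (gw x) \<le> 2" for x
  proof -
    have n: "norm (gw x) = 2 * norm x / (1 + (norm x)\<^sup>2)"
      using pos[of x] by (simp add: gw_def power2_norm_eq_inner)
    have "2 * norm x \<le> 1 + (norm x)\<^sup>2" using sum_squares_bound[of 1 "norm x"] by simp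
    then show "norm (gw x) \<le> 1" unfolding n by (simp add: divide_le_eq add_pos_nonneg)
    show "norm x * norm (gw x) \<le> 2" unfolding n
      by (simp add: divide_le_eq add_pos_nonneg power2_eq_square)
  qed
  have qf: "\<bar>y \<bullet> (D *v y)\<bar> \<le> KD * (norm y)\<^sup>2" for y
    using order_trans[OF Cauchy_Schwarz_ineq2[of y "D *v y"] mult_left_mono[OF KD(2)[of y] norm_ge_zero[of y]]]
    by (simp add: power2_eq_square mult_ac)
  have quad: "\<bar>gw x \<bullet> (D *v gw x)\<bar> \<le> KD" for x
  proof -
    have "KD * (norm (gw x))\<^sup>2 \<le> KD * 1"
      using gw1[of x] KD(1) by (intro mult_left_mono power_le_one) auto
    then show ?thesis using qf[of "gw x"] by simp
  qed
  have trH: "\<bar>form_trace D (Hw x)\<bar> \<le> KD + 2 * T" for x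
  proof -
    have "form_trace D (Hw x) = - (gw x \<bullet> (D *v gw x)) + 2 / (1 + x \<bullet> x) * form_trace D (mat 1)"
      using pos[of x]
      by (simp add: Hw_def gw_def form_trace_diff form_trace_scaleR form_trace_outer matrix_vector_mult_scaleR power2_eq_square)
    moreover have "\<bar>gw x \<bullet> (D *v gw x)\<bar> \<le> KD"
      by (rule quad)
    moreover have "\<bar>2 / (1 + x \<bullet> x) * form_trace D (mat 1)\<bar> \<le> 2 * T"
    proof -
      have "\<bar>2 / (1 + x \<bullet> x)\<bar> \<le> 2" using pos[of x] by (simp add: divide_le_eq)
      then have "\<bar>2 / (1 + x \<bullet> x)\<bar> * T \<le> 2 * T" by (rule mult_right_mono) (simp add: T_def)
      then show ?thesis by (simp add: abs_mult T_def)
    qed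
    ultimately show ?thesis by linarith
  qed
  \<comment> \<open>Collects \<open>3 * (2 * KB) + 6 * KD + 3 * (KD + 2 * T)\<close> from the final
    estimate of the generator; the last 3 is for the gradient.\<close>
  define K where "K = 6 * KB + 9 * KD + 6 * T + 3"
  have "K \<ge> 0" using KB KD by (simp add: K_def T_def)
  have "\<exists>g H. C2_fun (cutoff R) g H \<and>
    (\<forall>x. norm (g x) \<le> K / R \<and> \<bar>generator_at B D x (g x) (H x)\<bar> \<le> K / R)" if R: "1 \<le> R" for R
  proof -
    define m where "m x = max 0 (1 - ln (1 + x \<bullet> x) / R)" for x :: "real^'n"
    have m: "0 \<le> m x" "m x \<le> 1" for x using R by (auto simp: m_def)
    \<comment> \<open>\<open>a\<close> and \<open>b\<close> are the first and second derivatives of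
      the truncated cube in the variable \<open>ln (1 + x \<bullet> x)\<close>. The factor
      \<open>1 / R\<^sup>2\<close> in \<open>b\<close> is weakened to \<open>1 / R\<close>, using
      \<open>1 \<le> R\<close>.\<close>
    define a where "a x = - (3 / R) * (m x)\<^sup>2" for x
    define b where "b x = 6 / R\<^sup>2 * m x" for x
    have a: "\<bar>a x\<bar> \<le> 3 / R" for x using m[of x] R by (simp add: a_def abs_mult power_le_one divide_le_cancel mult_left_le)
    have b: "\<bar>b x\<bar> \<le> 6 / R" for x
    proof -
      have "\<bar>b x\<bar> \<le> 6 / R\<^sup>2 * 1" unfolding b_def using m[of x] by (simp add: abs_mult divide_right_mono)
      also have "\<dots> \<le> 6 / R" using R by (simp add: field_simps power2_eq_square)
      finally show ?thesis .
    qed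
    have d0: "((\<lambda>u. 1 - u / R) has_real_derivative - (1 / R)) (at u)" for u
      using R by (auto intro!: derivative_eq_intros)
    have d1: "((\<lambda>u. max 0 (1 - u / R) ^ 3) has_real_derivative (- (3 / R) * max 0 (1 - u / R) ^ 2)) (at u)" for u
      using DERIV_chain2[where f = "\<lambda>u. max 0 u ^ 3" and g = "\<lambda>u. 1 - u / R" and x = u and s = UNIV and Db = "- (1 / R)",
            OF pos_part_power_derivative[of 3 "1 - u / R"], OF _ d0] R by simp
    have d2: "((\<lambda>u. - (3 / R) * max 0 (1 - u / R) ^ 2) has_real_derivative (6 / R\<^sup>2 * max 0 (1 - u / R))) (at u)" for u
    proof -
      have "((\<lambda>u. max 0 (1 - u / R) ^ 2) has_real_derivative (2 * max 0 (1 - u / R)) * - (1 / R)) (at u)"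
        using DERIV_chain2[where f = "\<lambda>u. max 0 u ^ 2" and g = "\<lambda>u. 1 - u / R" and x = u and s = UNIV and Db = "- (1 / R)",
            OF pos_part_power_derivative[of 2 "1 - u / R"], OF _ d0] R by simp
      from DERIV_cmult[OF this, of "- (3 / R)"] show ?thesis using R by (simp add: power2_eq_square field_simps)
    qed
    have C2: "C2_fun (cutoff R) (\<lambda>x. a x *\<^sub>R gw x) (\<lambda>x. b x *\<^sub>R outer (gw x) (gw x) + a x *\<^sub>R Hw x)"
      unfolding cutoff_def a_def b_def m_def
    proof (rule C2_fun_compose[OF w d1 d2])
      have "R \<noteq> 0" using R by simp
      then show "continuous_on UNIV (\<lambda>x::real^'n. 6 / R\<^sup>2 * max 0 (1 - ln (1 + x \<bullet> x) / R))"
        by (intro continuous_on_mult continuous_on_const continuous_on_max continuous_on_diff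
            continuous_on_divide C2_fun_continuous(1)[OF w]) auto
    qed
    have "norm (a x *\<^sub>R gw x) \<le> K / R" for x
    proof -
      have "norm (a x *\<^sub>R gw x) \<le> 3 / R * 1"
        unfolding norm_scaleR using a gw1 R by (intro mult_mono) auto
      also have "\<dots> \<le> K / R" using R KB KD by (simp add: K_def T_def divide_right_mono)
      finally show ?thesis .
    qed
    moreover have "\<bar>generator_at B D x (a x *\<^sub>R gw x) (b x *\<^sub>R outer (gw x) (gw x) + a x *\<^sub>R Hw x)\<bar> \<le> K / R" for x
    proof -
      have 1: "\<bar>(B *v x) \<bullet> gw x\<bar> \<le> 2 * KB"
      proof -
        have "\<bar>(B *v x) \<bullet> gw x\<bar> \<le> (norm x * KB) * norm (gw x)"
          using order_trans[OF Cauchy_Schwarz_ineq2 mult_right_mono[OF KB(2)]] by auto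
        also have "\<dots> \<le> KB * 2" using mult_left_mono[OF gw2[of x], of KB] KB(1) by (simp add: mult_ac)
        finally show ?thesis by simp
      qed
      have 2: "\<bar>gw x \<bullet> (D *v gw x)\<bar> \<le> KD"
        by (rule quad)
      have "generator_at B D x (a x *\<^sub>R gw x) (b x *\<^sub>R outer (gw x) (gw x) + a x *\<^sub>R Hw x) =
          - a x * ((B *v x) \<bullet> gw x) + b x * (gw x \<bullet> (D *v gw x)) + a x * form_trace D (Hw x)"
        by (simp add: generator_at_def form_trace_add form_trace_scaleR form_trace_outer)
      also have "\<bar>\<dots>\<bar> \<le> \<bar>a x\<bar> * \<bar>(B *v x) \<bullet> gw x\<bar> + \<bar>b x\<bar> * \<bar>gw x \<bullet> (D *v gw x)\<bar> + \<bar>a x\<bar> * \<bar>form_trace D (Hw x)\<bar>"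
        by (simp add: abs_mult[symmetric])
      also have "\<dots> \<le> 3 / R * (2 * KB) + 6 / R * KD + 3 / R * (KD + 2 * T)"
        using a b 1 2 trH R by (intro add_mono mult_mono) auto
      also have "\<dots> \<le> K / R" using R by (simp add: K_def field_simps)
      finally show ?thesis .
    qed
    ultimately show ?thesis using C2 by blast
  qed
  then show ?thesis using that \<open>K \<ge> 0\<close> by blast
qed

section \<open>Markov semigroups with a given generator\<close>

text \<open>A generator yields only right derivatives, so the usual mean value theorem does not
  apply. Here the supremum of the points where the bound with slope \<open>M + e\<close> still holds
  cannot lie before \<open>b\<close>, because the right derivative carries the bound a little
  further.\<close>

lemma right_derivative_bound:
  fixes f :: "real \<Rightarrow> real"
  assumes "a \<le> b" and cont: "continuous_on {a..b} f"
    and der: "\<And>s. a \<le> s \<Longrightarrow> s < b \<Longrightarrow> \<exists>D. (f has_real_derivative D) (at s within {s..}) \<and> D \<le> M"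
  shows "f b - f a \<le> M * (b - a)"
proof (rule ccontr)
  define d where "d = f b - f a - M * (b - a)"
  assume "\<not> ?thesis"
  then have d: "0 < d" by (simp add: d_def)
  then have ab: "a < b" using \<open>a \<le> b\<close> by (cases "a = b") (auto simp: d_def)
  \<comment> \<open>The extra slope consumes half of the excess \<open>d\<close>, so
    \<open>g b\<close> remains positive.\<close>
  define e where "e = d / 2 / (b - a)"
  have e: "0 < e" using d ab by (simp add: e_def)
  have eb: "e * (b - a) = d / 2"
    by (rule nonzero_eq_divide_eq[THEN iffD1]) (use ab in \<open>simp_all add: e_def\<close>)
  define g where "g s = f s - f a - (M + e) * (s - a)" for s
  define S where "S = {s \<in> {a..b}. g s \<le> 0}"
  have "continuous_on {a..b} g" unfolding g_def by (intro continuous_intros cont)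
  then have "closed S" unfolding S_def
    by (intro continuous_closed_preimage[of _ _ "{..0}", unfolded vimage_def Int_def, simplified] continuous_on_closed_Collect_le) auto
  moreover have S: "a \<in> S" "bdd_above S" using ab by (auto simp: S_def g_def intro: bdd_aboveI[of _ b])
  ultimately have c: "Sup S \<in> S" using closed_contains_Sup[of S] by auto
  define c where "c = Sup S"
  have "g b > 0" using d eb by (simp add: g_def d_def algebra_simps)
  then have cb: "a \<le> c" "c < b" "g c \<le> 0" using c by (auto simp: S_def c_def less_le)
  obtain D where D: "(f has_real_derivative D) (at c within {c..})" "D \<le> M" using der[OF cb(1,2)] by blast
  have "(g has_real_derivative D - (M + e)) (at c within {c..})"
    unfolding g_def by (auto intro!: derivative_eq_intros D(1))
  from has_real_derivative_neg_dec_right[OF this] D(2) e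
  obtain r where r: "r > 0" "\<And>h. h > 0 \<Longrightarrow> c + h \<in> {c..} \<Longrightarrow> h < r \<Longrightarrow> g (c + h) < g c" by auto
  define h where "h = min (r / 2) (b - c)"
  have "0 < h" "h < r" "c + h \<le> b" using r(1) cb by (auto simp: h_def min_def)
  then have "c + h \<in> S" using r(2)[of h] cb by (auto simp: S_def)
  then have "c + h \<le> c" unfolding c_def using S(2) by (rule cSup_upper)
  then show False using \<open>0 < h\<close> by simp
qed

lemma right_derivative_abs_bound:
  fixes f :: "real \<Rightarrow> real"
  assumes "a \<le> b" and cont: "continuous_on {a..b} f"
    and der: "\<And>s. a \<le> s \<Longrightarrow> s < b \<Longrightarrow> \<exists>D. (f has_real_derivative D) (at s within {s..}) \<and> \<bar>D\<bar> \<le> M"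
  shows "\<bar>f b - f a\<bar> \<le> M * (b - a)"
proof -
  have "f b - f a \<le> M * (b - a)"
    by (rule right_derivative_bound[OF assms(1,2)]) (use der in fastforce)
  moreover have "- f b - - f a \<le> M * (b - a)"
  proof (rule right_derivative_bound[OF assms(1)])
    show "continuous_on {a..b} (\<lambda>x. - f x)" by (intro continuous_intros cont)
    fix s assume "a \<le> s" "s < b"
    from der[OF this] obtain D where "(f has_real_derivative D) (at s within {s..})" "\<bar>D\<bar> \<le> M" by blast
    then show "\<exists>D. ((\<lambda>x. - f x) has_real_derivative D) (at s within {s..}) \<and> D \<le> M"
      by (intro exI[of _ "- D"]) (auto intro: DERIV_minus)
  qed
  ultimately show ?thesis by linarith
qed

lemma abs_sin_diff_le: "\<bar>sin a - sin b\<bar> \<le> \<bar>a - b :: real\<bar>"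
  using field_differentiable_bound[of UNIV sin cos 1 a b] by (auto intro: DERIV_sin)

lemma abs_cos_diff_le: "\<bar>cos a - cos b\<bar> \<le> \<bar>a - b :: real\<bar>"
  using field_differentiable_bound[of UNIV cos "\<lambda>x. - sin x" 1 a b] by (auto intro: DERIV_cos)

text \<open>The mean value inequality for \<open>cos u + u * sin b\<close>, whose derivative is at
  most \<open>\<bar>a - b\<bar>\<close> in absolute value between \<open>a\<close> and
  \<open>b\<close>.\<close>

lemma abs_cos_taylor: "\<bar>cos a - cos b + (a - b) * sin b\<bar> \<le> (a - b)\<^sup>2" for a b :: real
proof -
  let ?f = "\<lambda>u. cos u + u * sin b"
  let ?S = "closed_segment a b"
  have "norm (?f a - ?f b) \<le> \<bar>a - b\<bar> * norm (a - b)"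
  proof (rule field_differentiable_bound)
    show "(?f has_real_derivative (- sin z + sin b)) (at z within ?S)" for z
      by (auto intro!: derivative_eq_intros)
    fix z assume "z \<in> ?S"
    then have "\<bar>b - z\<bar> \<le> \<bar>a - b\<bar>" by (auto simp: closed_segment_eq_real_ivl split: if_splits)
    then show "norm (- sin z + sin b) \<le> \<bar>a - b\<bar>" using abs_sin_diff_le[of b z] by simp
  qed auto
  then show ?thesis by (simp add: algebra_simps power2_eq_square flip: abs_mult)
qed

lemma (in prob_space) bounded_integral:
  fixes f :: "'a \<Rightarrow> real"
  assumes "f \<in> borel_measurable M" "\<And>x. \<bar>f x\<bar> \<le> b"
  shows "integrable M f" "\<bar>\<integral>x. f x \<partial>M\<bar> \<le> b"
proof -
  show int: "integrable M f" using assms by (intro integrable_const_bound[of _ b]) auto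
  have "\<bar>\<integral>x. f x \<partial>M\<bar> \<le> (\<integral>x. \<bar>f x\<bar> \<partial>M)" by (rule integral_abs_bound)
  also have "\<dots> \<le> (\<integral>x. b \<partial>M)" using int assms by (intro integral_mono integrable_abs) auto
  finally show "\<bar>\<integral>x. f x \<partial>M\<bar> \<le> b" by (simp add: prob_space)
qed

section \<open>Markov kernels as operators, and the forward equation\<close>

locale markov =
  fixes P :: "real \<Rightarrow> real^'n::finite \<Rightarrow> (real^'n) measure"
  assumes semigroup: "markov_semigroup P"
begin

lemma kernel_prob: "0 \<le> t \<Longrightarrow> P t \<in> borel \<rightarrow>\<^sub>M prob_algebra borel"
  using semigroup by (auto simp: markov_semigroup_def)

lemma kernel_measurable[measurable]: "0 \<le> t \<Longrightarrow> P t \<in> borel \<rightarrow>\<^sub>M subprob_algebra borel"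
  using kernel_prob by (rule measurable_prob_algebraD)

lemma kernel_space: "0 \<le> t \<Longrightarrow> P t x \<in> space (prob_algebra borel)"
  using measurable_space[OF kernel_prob, of t x] by simp

lemma prob_kernel: "0 \<le> t \<Longrightarrow> prob_space (P t x)"
  and sets_kernel: "0 \<le> t \<Longrightarrow> sets (P t x) = sets borel"
  using kernel_space[of t x] by (auto simp: space_prob_algebra)

lemma measurable_kernel: "0 \<le> t \<Longrightarrow> measurable (P t x) N = measurable borel N"
  by (rule measurable_cong_sets) (auto simp: sets_kernel)

lemma semigroup_op_measurable:
  assumes "0 \<le> t" and [measurable]: "f \<in> borel_measurable borel"
  shows "semigroup_op P t f \<in> borel_measurable borel"
proof -
  have "(\<lambda>M. integral\<^sup>L M f) \<in> borel_measurable (subprob_algebra borel)"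
    by (rule integral_measurable_subprob_algebra) fact
  from measurable_compose[OF kernel_measurable[OF assms(1)] this]
  show ?thesis by (simp add: semigroup_op_def[abs_def])
qed

lemma kernel_bounded_integral:
  fixes f :: "real^'n \<Rightarrow> real"
  assumes "0 \<le> t" "f \<in> borel_measurable borel" "\<And>x. \<bar>f x\<bar> \<le> b"
  shows "integrable (P t x) f" "\<bar>\<integral>y. f y \<partial>P t x\<bar> \<le> b"
  using prob_space.bounded_integral[OF prob_kernel[OF assms(1)], of f x b] assms(2,3)
  by (auto simp: measurable_kernel[OF assms(1)])

lemma integral_semigroup:
  assumes "0 \<le> s" "0 \<le> t" "f \<in> borel_measurable borel" "\<And>x. \<bar>f x\<bar> \<le> b"
  shows "(\<integral>y. f y \<partial>P (s + t) x) = (\<integral>y. semigroup_op P t f y \<partial>P s x)"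
proof -
  interpret s: prob_space "P s x" by (rule prob_kernel[OF assms(1)])
  have "P (s + t) x = P s x \<bind> P t" using semigroup assms by (auto simp: markov_semigroup_def)
  moreover have "integral\<^sup>L (P s x \<bind> P t) f = (\<integral>y. integral\<^sup>L (P t y) f \<partial>P s x)"
  proof (rule integral_bind[where K = borel and B = b and B' = 1])
    show "P t \<in> P s x \<rightarrow>\<^sub>M subprob_algebra borel"
      using kernel_measurable[OF assms(2)] by (simp add: measurable_kernel[OF assms(1)])
    show "AE y in P s x. emeasure (P t y) (space (P t y)) \<le> ennreal 1"
      using prob_space.emeasure_space_1[OF prob_kernel[OF assms(2)]] by simp
  qed (use assms in \<open>auto intro: s.finite_measure_axioms\<close>)
  ultimately show ?thesis by (simp add: semigroup_op_def)
qed

end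

locale generated_markov = markov +
  fixes L :: "(real^'n::finite \<Rightarrow> real) \<Rightarrow> real^'n \<Rightarrow> real"
  assumes generator: "has_generator P L"
begin

lemma semigroup_difference_quotient:
  assumes "f \<in> C2_compact_support" "0 < e"
  shows "\<forall>\<^sub>F h in at_right 0. 0 < h \<and> (\<forall>x. \<bar>(semigroup_op P h f x - f x) / h - L f x\<bar> < e)"
  using generator assms unfolding has_generator_def uniform_limit_iff dist_real_def
  by (intro eventually_conj eventually_at_right_less) auto

text \<open>Convergence is uniform, so \<open>L f\<close> lies within 1 of a single difference
  quotient, which is bounded because \<open>f\<close> is.\<close>

lemma generator_bounded:
  assumes "f \<in> C2_compact_support" and f: "f \<in> borel_measurable borel" "\<And>x. \<bar>f x\<bar> \<le> b"
  obtains C where "\<And>x. \<bar>L f x\<bar> \<le> C"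
proof -
  from eventually_happens'[OF _ semigroup_difference_quotient[OF assms(1), of 1]] obtain h where h: "0 < h"
    "\<And>x. \<bar>(semigroup_op P h f x - f x) / h - L f x\<bar> < 1" by auto
  have "\<bar>L f x\<bar> \<le> 2 * b / h + 1" for x
  proof -
    have "\<bar>semigroup_op P h f x - f x\<bar> \<le> 2 * b"
      using kernel_bounded_integral(2)[OF less_imp_le[OF h(1)] f, of x] f(2)[of x]
      unfolding semigroup_op_def by linarith
    then have "\<bar>(semigroup_op P h f x - f x) / h\<bar> \<le> 2 * b / h" using h(1) by (simp add: divide_right_mono)
    then show ?thesis using h(2)[of x] by linarith
  qed
  then show ?thesis by (rule that)
qed

lemma semigroup_increment_bound:
  assumes "f \<in> C2_compact_support" and f: "f \<in> borel_measurable borel" "\<And>x. \<bar>f x\<bar> \<le> b"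
  obtains C where "\<forall>\<^sub>F h in at_right 0. \<forall>x. \<bar>semigroup_op P h f x - f x\<bar> \<le> C * h"
proof -
  obtain C where C: "\<And>x. \<bar>L f x\<bar> \<le> C" by (rule generator_bounded[OF assms]) blast+
  have "\<forall>\<^sub>F h in at_right 0. \<forall>x. \<bar>semigroup_op P h f x - f x\<bar> \<le> (C + 1) * h"
  proof (rule eventually_mono[OF semigroup_difference_quotient[OF assms(1), of 1]])
    fix h :: real assume "0 < h \<and> (\<forall>x. \<bar>(semigroup_op P h f x - f x) / h - L f x\<bar> < 1)"
    then have h: "\<forall>x. \<bar>(semigroup_op P h f x - f x) / h - L f x\<bar> < 1" "0 < h" by auto
    show "\<forall>x. \<bar>semigroup_op P h f x - f x\<bar> \<le> (C + 1) * h"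
    proof
      fix x
      have "\<bar>(semigroup_op P h f x - f x) / h\<bar> \<le> C + 1" using h(1)[rule_format, of x] C[of x] by linarith
      then show "\<bar>semigroup_op P h f x - f x\<bar> \<le> (C + 1) * h" using h(2) by (simp add: abs_divide divide_le_eq)
    qed
  qed simp
  then show ?thesis by (rule that)
qed

lemma integral_increment:
  assumes "0 \<le> s" "0 \<le> h" "f \<in> borel_measurable borel" "\<And>x. \<bar>f x\<bar> \<le> b"
  shows "(\<integral>y. f y \<partial>P (s + h) x) - (\<integral>y. f y \<partial>P s x) = (\<integral>y. semigroup_op P h f y - f y \<partial>P s x)"
proof -
  have "\<bar>semigroup_op P h f y\<bar> \<le> b" for y
    unfolding semigroup_op_def by (rule kernel_bounded_integral(2)[OF assms(2-4)])
  then have "integrable (P s x) (semigroup_op P h f)"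
    by (rule kernel_bounded_integral(1)[OF assms(1) semigroup_op_measurable[OF assms(2,3)]])
  then show ?thesis
    using integral_semigroup[OF assms] kernel_bounded_integral(1)[OF assms(1,3,4)] by simp
qed

text \<open>The forward equation from the right: by the semigroup law the difference quotient of the
  integral is the integral of the quotient at time 0, and that quotient converges uniformly in the
  starting point.\<close>

lemma integral_right_derivative:
  assumes C2: "f \<in> C2_compact_support" and f: "f \<in> borel_measurable borel" "\<And>x. \<bar>f x\<bar> \<le> b"
    and Lf: "L f \<in> borel_measurable borel" and "0 \<le> s"
  shows "((\<lambda>h. ((\<integral>y. f y \<partial>P (s + h) x) - (\<integral>y. f y \<partial>P s x)) / h) \<longlongrightarrow> (\<integral>y. L f y \<partial>P s x)) (at_right 0)"
proof (rule tendstoI)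
  fix e :: real assume "0 < e"
  obtain C where C: "\<And>x. \<bar>L f x\<bar> \<le> C" by (rule generator_bounded[OF C2 f]) blast+
  have iL: "integrable (P s x) (L f)" by (rule kernel_bounded_integral(1)[OF \<open>0 \<le> s\<close> Lf C])
  show "\<forall>\<^sub>F h in at_right 0. dist (((\<integral>y. f y \<partial>P (s + h) x) - (\<integral>y. f y \<partial>P s x)) / h) (\<integral>y. L f y \<partial>P s x) < e"
  proof (rule eventually_mono[OF semigroup_difference_quotient[OF C2, of "e / 2"]])
    fix h :: real assume "0 < h \<and> (\<forall>x. \<bar>(semigroup_op P h f x - f x) / h - L f x\<bar> < e / 2)"
    then have h: "\<forall>x. \<bar>(semigroup_op P h f x - f x) / h - L f x\<bar> < e / 2" "0 < h" by auto
    let ?d = "\<lambda>y. (semigroup_op P h f y - f y) / h"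
    have m: "?d \<in> borel_measurable borel" using f semigroup_op_measurable[of h f] h(2) by simp
    have "\<bar>?d y\<bar> \<le> C + e" for y using h(1)[rule_format, of y] C[of y] \<open>0 < e\<close> by linarith
    then have id: "integrable (P s x) ?d" by (rule kernel_bounded_integral(1)[OF \<open>0 \<le> s\<close> m])
    have "((\<integral>y. f y \<partial>P (s + h) x) - (\<integral>y. f y \<partial>P s x)) / h - (\<integral>y. L f y \<partial>P s x) = (\<integral>y. ?d y - L f y \<partial>P s x)"
      using id iL h(2) by (simp add: integral_increment[OF \<open>0 \<le> s\<close> _ f] Bochner_Integration.integral_diff)
    also have "\<bar>\<dots>\<bar> \<le> e / 2"
      by (rule kernel_bounded_integral(2)[OF \<open>0 \<le> s\<close>]) (use m Lf h(1) in \<open>auto simp: less_imp_le\<close>)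
    finally show "dist (((\<integral>y. f y \<partial>P (s + h) x) - (\<integral>y. f y \<partial>P s x)) / h) (\<integral>y. L f y \<partial>P s x) < e"
      using \<open>0 < e\<close> by (simp add: dist_real_def)
  qed (use \<open>0 < e\<close> in simp)
qed

text \<open>A Lipschitz bound on short intervals, uniform in the base time; it also gives continuity
  from the left, on which right derivatives are silent.\<close>

lemma integral_continuous:
  assumes C2: "f \<in> C2_compact_support" and f: "f \<in> borel_measurable borel" "\<And>x. \<bar>f x\<bar> \<le> b"
  shows "continuous_on {0..} (\<lambda>s. \<integral>y. f y \<partial>P s x)"
proof -
  obtain C where "\<forall>\<^sub>F h in at_right 0. \<forall>x. \<bar>semigroup_op P h f x - f x\<bar> \<le> C * h"
    by (rule semigroup_increment_bound[OF C2 f]) blast+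
  then obtain d where d: "0 < d" "\<And>h x. 0 < h \<Longrightarrow> h < d \<Longrightarrow> \<bar>semigroup_op P h f x - f x\<bar> \<le> C * h"
    unfolding eventually_at_right_field by auto
  have lip: "\<bar>(\<integral>y. f y \<partial>P r x) - (\<integral>y. f y \<partial>P s x)\<bar> \<le> C * (r - s)" if "0 \<le> s" "s < r" "r - s < d" for r s
  proof -
    have "(\<integral>y. f y \<partial>P r x) - (\<integral>y. f y \<partial>P s x) = (\<integral>y. semigroup_op P (r - s) f y - f y \<partial>P s x)"
      using integral_increment[OF that(1) _ f, of "r - s" x] that by simp
    then show ?thesis
      using kernel_bounded_integral(2)[OF that(1), of "\<lambda>y. semigroup_op P (r - s) f y - f y" "C * (r - s)" x]
        d(2)[of "r - s"] that f semigroup_op_measurable[of "r - s" f] by simp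
  qed
  have C: "0 \<le> C"
  proof -
    have "0 \<le> C * (d / 2)" using d(1) order_trans[OF abs_ge_zero d(2)[of "d / 2" 0]] by simp
    then show ?thesis using d(1) by (simp add: zero_le_mult_iff)
  qed
  show ?thesis
    unfolding continuous_on_iff
  proof (intro ballI allI impI)
    fix s e :: real assume "s \<in> {0..}" "0 < e"
    define r where "r = min d (e / (C + 1))"
    have "0 < r" using d(1) \<open>0 < e\<close> C by (simp add: r_def)
    have small: "C * u < e" if "0 \<le> u" "u < r" for u
    proof -
      have "C * u \<le> (C + 1) * u" using that by (simp add: algebra_simps)
      also have "\<dots> < e" using that C by (simp add: r_def field_simps)
      finally show ?thesis .
    qed
    have "dist (\<integral>y. f y \<partial>P s' x) (\<integral>y. f y \<partial>P s x) < e" if "s' \<in> {0..}" "dist s' s < r" for s'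
    proof (cases s' s rule: linorder_cases)
      case less
      then show ?thesis using lip[of s' s] small[of "s - s'"] that by (auto simp: dist_real_def r_def abs_minus_commute)
    next
      case greater
      then show ?thesis using lip[of s s'] small[of "s' - s"] that \<open>s \<in> {0..}\<close> by (auto simp: dist_real_def r_def)
    qed (use \<open>0 < e\<close> in auto)
    then show "\<exists>d>0. \<forall>s'\<in>{0..}. dist s' s < d \<longrightarrow> dist (\<integral>y. f y \<partial>P s' x) (\<integral>y. f y \<partial>P s x) < e"
      using \<open>0 < r\<close> by blast
  qed
qed

end

section \<open>Plane waves under the Ornstein-Uhlenbeck semigroup\<close>

lemma generator_at_continuous:
  fixes B D :: "real^'n::finite^'n"
  assumes "C2_fun f g H"
  shows "continuous_on UNIV (\<lambda>x. generator_at B D x (g x) (H x))"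
  unfolding generator_at_def form_trace_def
  by (intro continuous_intros continuous_on_component C2_fun_continuous[OF assms] C2_funD(3)[OF assms]
      linear_continuous_on[OF matrix_vector_mul_bounded_linear])

lemma C2_fun_bounded:
  fixes f :: "real^'n::finite \<Rightarrow> real"
  assumes "C2_fun f g H" "bounded {x. f x \<noteq> 0}"
  obtains b where "\<And>x. \<bar>f x\<bar> \<le> b"
proof -
  have "compact (closure {x. f x \<noteq> 0})" using assms(2) by simp
  moreover have "continuous_on (closure {x. f x \<noteq> 0}) f"
    using C2_fun_continuous(1)[OF assms(1)] continuous_on_subset by blast
  ultimately have "bounded (f ` closure {x. f x \<noteq> 0})"
    using compact_continuous_image compact_imp_bounded by blast
  then obtain b where b: "\<And>x. x \<in> closure {x. f x \<noteq> 0} \<Longrightarrow> \<bar>f x\<bar> \<le> b"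
    by (auto simp: bounded_iff)
  have "\<bar>f x\<bar> \<le> max b 0" for x
  proof (cases "f x = 0")
    case False
    then have "x \<in> closure {x. f x \<noteq> 0}" using closure_subset[of "{x. f x \<noteq> 0}"] by auto
    then have "\<bar>f x\<bar> \<le> b" by (rule b)
    then show ?thesis by linarith
  qed auto
  then show ?thesis by (rule that)
qed

lemma generator_at_cos:
  "generator_at B D y ((- sin u) *\<^sub>R e) ((- cos u) *\<^sub>R outer e e) =
     sin u * ((B *v y) \<bullet> e) - cos u * (e \<bullet> (D *v e))"
  unfolding generator_at_def form_trace_scaleR form_trace_outer by simp

lemma matrix_vector_mult_minus_right: "A *v (- x) = - (A *v (x::real^'n::finite))"
  by (simp add: matrix_vector_mult_def vec_eq_iff sum_negf)

lemma has_vector_derivative_quotient: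
  assumes "(f has_vector_derivative v) (at s)"
  shows "((\<lambda>h. (f (s + h) - f s) /\<^sub>R h) \<longlongrightarrow> v) (at 0)"
proof -
  have "((\<lambda>h. norm (f (s + h) - f s - h *\<^sub>R v) / norm h) \<longlongrightarrow> 0) (at 0)"
    using assms unfolding has_vector_derivative_def has_derivative_at by blast
  then have "((\<lambda>h. norm ((f (s + h) - f s) /\<^sub>R h - v)) \<longlongrightarrow> 0) (at 0)"
  proof (rule Lim_transform_eventually)
    show "\<forall>\<^sub>F h in at 0. norm (f (s + h) - f s - h *\<^sub>R v) / norm h = norm ((f (s + h) - f s) /\<^sub>R h - v)"
      unfolding eventually_at_filter
    proof (intro always_eventually allI impI)
      fix h :: real assume "h \<noteq> 0"
      then have "(f (s + h) - f s) /\<^sub>R h - v = (f (s + h) - f s - h *\<^sub>R v) /\<^sub>R h"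
        by (simp add: scaleR_diff_right)
      then show "norm (f (s + h) - f s - h *\<^sub>R v) / norm h = norm ((f (s + h) - f s) /\<^sub>R h - v)"
        by (simp add: divide_inverse)
    qed
  qed
  then show ?thesis by (rule LIM_zero_cancel[OF tendsto_norm_zero_cancel])
qed

lemma C2_fun_borel: "C2_fun f g H \<Longrightarrow> f \<in> borel_measurable borel"
  using C2_fun_continuous(1) by (rule borel_measurable_continuous_onI)

locale ou_process = generated_markov P "ou_generator B D" + stationary_flow B E D S
  for P :: "real \<Rightarrow> real^'n::finite \<Rightarrow> (real^'n) measure" and B D S :: "real^'n^'n" and E
begin

context
  fixes R t \<theta> :: real and \<xi> x :: "real^'n"
  assumes R: "1 \<le> R" and t: "0 \<le> t"
begin

text \<open>The frequency runs backwards in time, from \<open>E t *v \<xi>\<close> at 0 to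
  \<open>\<xi>\<close> at \<open>t\<close>. Thus \<open>mean\<close> interpolates between the value
  of the transported wave at \<open>x\<close> and the integral of the given wave under
  \<open>P t x\<close>, both cut off.\<close>

definition \<eta> :: "real \<Rightarrow> real^'n" where "\<eta> s = E (t - s) *v \<xi>"

definition wave :: "real \<Rightarrow> real^'n \<Rightarrow> real" where
  "wave s y = cutoff R y * cos (\<eta> s \<bullet> y + \<theta>)"

definition wave_dt :: "real \<Rightarrow> real^'n \<Rightarrow> real" where
  "wave_dt s y = - (cutoff R y * ((transpose B *v \<eta> s) \<bullet> y) * sin (\<eta> s \<bullet> y + \<theta>))"

definition mean :: "real \<Rightarrow> real" where "mean s = (\<integral>y. wave s y \<partial>P s x)"

lemma \<eta>_derivative:
  assumes "s \<le> t" shows "(\<eta> has_vector_derivative transpose B *v \<eta> s) (at s)"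
proof -
  have "((\<lambda>r. E r *v \<xi>) \<circ> (\<lambda>s. t - s) has_vector_derivative (- 1) *\<^sub>R - (transpose B *v (E (t - s) *v \<xi>))) (at s)"
    by (rule vector_diff_chain_at) (use assms in \<open>auto intro!: derivative_eq_intros flow_derivative\<close>)
  then show ?thesis by (simp add: o_def \<eta>_def[abs_def])
qed

lemma q_\<eta>_derivative:
  assumes "s \<le> t" shows "((\<lambda>s. q (\<eta> s)) has_real_derivative \<eta> s \<bullet> (D *v \<eta> s)) (at s)"
proof -
  have "((\<lambda>s. q (E (t - s) *v \<xi>)) has_real_derivative - (E (t - s) *v \<xi>) \<bullet> (D *v (E (t - s) *v \<xi>)) * - 1) (at s)"
    by (rule DERIV_chain2[of "\<lambda>r. q (E r *v \<xi>)" _ "\<lambda>s. t - s"])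
      (use assms q_flow_derivative[of "t - s" \<xi>] in \<open>auto intro!: derivative_eq_intros\<close>)
  then show ?thesis by (simp add: \<eta>_def)
qed

lemma wave_C2:
  assumes "C2_fun (cutoff R) g H"
  shows "C2_fun (wave s) (\<lambda>y. cutoff R y *\<^sub>R ((- sin (\<eta> s \<bullet> y + \<theta>)) *\<^sub>R \<eta> s) + cos (\<eta> s \<bullet> y + \<theta>) *\<^sub>R g y)
    (\<lambda>y. cutoff R y *\<^sub>R ((- cos (\<eta> s \<bullet> y + \<theta>)) *\<^sub>R outer (\<eta> s) (\<eta> s)) + cos (\<eta> s \<bullet> y + \<theta>) *\<^sub>R H y
       + outer ((- sin (\<eta> s \<bullet> y + \<theta>)) *\<^sub>R \<eta> s) (g y) + outer (g y) ((- sin (\<eta> s \<bullet> y + \<theta>)) *\<^sub>R \<eta> s))"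
  unfolding wave_def[abs_def] by (rule C2_fun_mult[OF assms C2_fun_cos])

text \<open>The drift of the plane wave is exactly opposite to the motion of its frequency, so the
  two terms linear in \<open>y\<close> cancel. There remain a multiple of the wave itself and terms
  with derivatives of the cutoff.\<close>

lemma wave_generator:
  assumes "C2_fun (cutoff R) g H"
  shows "ou_generator B D (wave s) y + wave_dt s y = - (\<eta> s \<bullet> (D *v \<eta> s)) * wave s y +
    (cos (\<eta> s \<bullet> y + \<theta>) * generator_at B D y (g y) (H y) - 2 * sin (\<eta> s \<bullet> y + \<theta>) * (g y \<bullet> (D *v \<eta> s)))"
proof -
  have "(B *v y) \<bullet> \<eta> s = (transpose B *v \<eta> s) \<bullet> y"
    using inner_transpose[of B "\<eta> s" y] by (simp add: inner_commute)
  then show ?thesis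
    unfolding ou_generator_C2_fun[OF wave_C2[OF assms]] generator_at_mult[OF D_sym] generator_at_cos
    by (simp add: wave_def wave_dt_def matrix_vector_mult_scaleR matrix_vector_mult_minus_right algebra_simps)
qed

lemma wave_C2_compact: "wave s \<in> C2_compact_support"
  and wave_bounded: "\<bar>wave s y\<bar> \<le> 1"
  and wave_borel: "wave s \<in> borel_measurable borel"
  and wave_dt_C2_compact: "wave_dt s \<in> C2_compact_support"
  and wave_dt_bounded: "\<exists>b. \<forall>y. \<bar>wave_dt s y\<bar> \<le> b"
  and wave_dt_borel: "wave_dt s \<in> borel_measurable borel"
  and wave_generator_borel: "ou_generator B D (wave s) \<in> borel_measurable borel"
  and wave_dt_generator_borel: "ou_generator B D (wave_dt s) \<in> borel_measurable borel"
proof -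
  obtain g H where c: "C2_fun (cutoff R :: real^'n \<Rightarrow> real) g H"
    using R by (rule_tac cutoff_generator[of B D]) blast
  have supp: "bounded {x::real^'n. cutoff R x \<noteq> 0}" using R by (intro cutoff_support) simp
  note w = wave_C2[OF c, of s]
  have ws: "bounded {x. wave s x \<noteq> 0}" by (rule bounded_subset[OF supp]) (auto simp: wave_def)
  show "wave s \<in> C2_compact_support" by (rule C2_fun_compact_support[OF w ws])
  show "wave s \<in> borel_measurable borel" by (rule C2_fun_borel[OF w])
  show "\<bar>wave s y\<bar> \<le> 1"
    using mult_mono[of "\<bar>cutoff R y\<bar>" 1 "\<bar>cos (\<eta> s \<bullet> y + \<theta>)\<bar>" 1] cutoff_bounds[of R y] R
    by (simp add: wave_def abs_mult)
  show "ou_generator B D (wave s) \<in> borel_measurable borel"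
    using generator_at_continuous[OF w, of B D] ou_generator_C2_fun[OF w, of B D, abs_def]
    by (simp add: borel_measurable_continuous_onI)
  \<comment> \<open>A phase shift by \<open>pi / 2\<close> turns \<open>- sin\<close> into
    \<open>cos\<close>, so \<open>wave_dt\<close> is again a product of functions with known
    derivatives.\<close>
  define v where "v = transpose B *v \<eta> s"
  have eq: "wave_dt s = (\<lambda>y. (cutoff R y * (v \<bullet> y + 0)) * cos (\<eta> s \<bullet> y + (\<theta> + pi / 2)))"
    by (rule ext) (simp add: wave_dt_def v_def cos_add add.assoc[symmetric])
  note d = C2_fun_mult[OF C2_fun_mult[OF c C2_fun_affine[of v 0]] C2_fun_cos[of "\<eta> s" "\<theta> + pi / 2"], folded eq]
  have ds: "bounded {x. wave_dt s x \<noteq> 0}" by (rule bounded_subset[OF supp]) (auto simp: wave_dt_def)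
  show "wave_dt s \<in> C2_compact_support" by (rule C2_fun_compact_support[OF d ds])
  show "wave_dt s \<in> borel_measurable borel" by (rule C2_fun_borel[OF d])
  show "\<exists>b. \<forall>y. \<bar>wave_dt s y\<bar> \<le> b" using C2_fun_bounded[OF d ds] by metis
  show "ou_generator B D (wave_dt s) \<in> borel_measurable borel"
    using generator_at_continuous[OF d, of B D] ou_generator_C2_fun[OF d, of B D, abs_def]
    by (simp add: borel_measurable_continuous_onI)
qed

lemma cutoff_radius:
  obtains r where "0 \<le> r" "\<And>y::real^'n. cutoff R y \<noteq> 0 \<Longrightarrow> norm y \<le> r"
proof -
  have "bounded {x::real^'n. cutoff R x \<noteq> 0}" using R by (intro cutoff_support) simp
  then obtain r where "\<And>y::real^'n. cutoff R y \<noteq> 0 \<Longrightarrow> norm y \<le> r" by (auto simp: bounded_iff)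
  then show ?thesis using that[of "max r 0"] by fastforce
qed

lemma wave_increment:
  assumes r: "0 \<le> r" "\<And>y::real^'n. cutoff R y \<noteq> 0 \<Longrightarrow> norm y \<le> r"
  shows "\<bar>wave s' y - wave s y\<bar> \<le> r * norm (\<eta> s' - \<eta> s)"
proof (cases "cutoff R y = 0")
  case True then show ?thesis using r by (simp add: wave_def)
next
  case False
  have "\<bar>wave s' y - wave s y\<bar> = cutoff R y * \<bar>cos (\<eta> s' \<bullet> y + \<theta>) - cos (\<eta> s \<bullet> y + \<theta>)\<bar>"
    using cutoff_bounds[of R y] R by (simp add: wave_def abs_mult flip: right_diff_distrib)
  also have "\<dots> \<le> 1 * \<bar>(\<eta> s' \<bullet> y + \<theta>) - (\<eta> s \<bullet> y + \<theta>)\<bar>"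
    using cutoff_bounds[of R y] R by (intro mult_mono abs_cos_diff_le) auto
  also have "\<dots> = \<bar>(\<eta> s' - \<eta> s) \<bullet> y\<bar>" by (simp add: inner_diff_left)
  also have "\<dots> \<le> norm (\<eta> s' - \<eta> s) * r"
    using order_trans[OF Cauchy_Schwarz_ineq2 mult_left_mono[OF r(2)[OF False]]] by auto
  finally show ?thesis by (simp add: mult.commute)
qed

text \<open>The bound does not depend on \<open>y\<close>, since it will be integrated against
  \<open>P (s + h) x\<close>, a measure that varies with \<open>h\<close>. Only \<open>y\<close> in
  the support of the cutoff matter, whence the radius \<open>r\<close>.\<close>

lemma wave_taylor:
  assumes r: "0 \<le> r" "\<And>y::real^'n. cutoff R y \<noteq> 0 \<Longrightarrow> norm y \<le> r" and "0 < h"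
  shows "\<bar>(wave (s + h) y - wave s y) / h - wave_dt s y\<bar> \<le>
    r * norm ((\<eta> (s + h) - \<eta> s) /\<^sub>R h - transpose B *v \<eta> s) + r\<^sup>2 * (norm (\<eta> (s + h) - \<eta> s) * norm ((\<eta> (s + h) - \<eta> s) /\<^sub>R h))"
proof (cases "cutoff R y = 0")
  case True then show ?thesis using r by (simp add: wave_def wave_dt_def)
next
  case False
  define a b v where "a = \<eta> (s + h) \<bullet> y + \<theta>" and "b = \<eta> s \<bullet> y + \<theta>" and "v = transpose B *v \<eta> s"
  have y: "norm y \<le> r" by (rule r(2)[OF False])
  have ab: "a - b = (\<eta> (s + h) - \<eta> s) \<bullet> y" by (simp add: a_def b_def inner_diff_left)
  have "wave (s + h) y = cutoff R y * cos a" "wave s y = cutoff R y * cos b"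
    "wave_dt s y = - (cutoff R y * (v \<bullet> y) * sin b)"
    by (simp_all add: wave_def wave_dt_def a_def b_def v_def)
  then have "(wave (s + h) y - wave s y) / h - wave_dt s y =
      cutoff R y * ((cos a - cos b + (a - b) * sin b) / h - ((a - b) / h - v \<bullet> y) * sin b)"
    using \<open>0 < h\<close> by (simp add: field_simps)
  also have "\<bar>\<dots>\<bar> \<le> 1 * (\<bar>cos a - cos b + (a - b) * sin b\<bar> / h + \<bar>(a - b) / h - v \<bullet> y\<bar> * 1)"
    unfolding abs_mult
  proof (intro mult_mono order_trans[OF abs_triangle_ineq4] add_mono)
    show "\<bar>((a - b) / h - v \<bullet> y) * sin b\<bar> \<le> \<bar>(a - b) / h - v \<bullet> y\<bar> * 1"
      unfolding abs_mult by (intro mult_left_mono) auto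
  qed (use cutoff_bounds[of R y] R \<open>0 < h\<close> in auto)
  also have "\<bar>cos a - cos b + (a - b) * sin b\<bar> / h \<le> (a - b)\<^sup>2 / h"
    using \<open>0 < h\<close> abs_cos_taylor by (intro divide_right_mono) auto
  also have "(a - b)\<^sup>2 / h \<le> r\<^sup>2 * (norm (\<eta> (s + h) - \<eta> s) * norm ((\<eta> (s + h) - \<eta> s) /\<^sub>R h))"
  proof -
    have "\<bar>a - b\<bar> \<le> norm (\<eta> (s + h) - \<eta> s) * r"
      unfolding ab using order_trans[OF Cauchy_Schwarz_ineq2 mult_left_mono[OF y]] by auto
    then have "(a - b)\<^sup>2 \<le> (norm (\<eta> (s + h) - \<eta> s) * r)\<^sup>2" by (rule abs_le_square_iff[THEN iffD1, OF order_trans]) auto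
    then have "(a - b)\<^sup>2 / h \<le> (norm (\<eta> (s + h) - \<eta> s) * r)\<^sup>2 / h"
      using \<open>0 < h\<close> by (simp add: divide_right_mono)
    also have "\<dots> = r\<^sup>2 * (norm (\<eta> (s + h) - \<eta> s) * norm ((\<eta> (s + h) - \<eta> s) /\<^sub>R h))"
      unfolding norm_scaleR using \<open>0 < h\<close> by (simp add: power2_eq_square divide_inverse)
    finally show ?thesis .
  qed
  also have "(a - b) / h - v \<bullet> y = ((\<eta> (s + h) - \<eta> s) /\<^sub>R h - v) \<bullet> y"
    by (simp add: ab inner_diff_left divide_inverse algebra_simps)
  also have "\<bar>\<dots>\<bar> \<le> norm ((\<eta> (s + h) - \<eta> s) /\<^sub>R h - v) * r"
    using order_trans[OF Cauchy_Schwarz_ineq2 mult_left_mono[OF y]] by auto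
  finally show ?thesis by (simp add: v_def algebra_simps)
qed

text \<open>Both the function and the measure depend on time. The quotient splits into the Taylor
  error \<open>A\<close>, the integral \<open>Bt\<close> of \<open>wave_dt s\<close> under the
  moving measure, and the quotient \<open>C\<close> of the fixed function
  \<open>wave s\<close>.\<close>

lemma mean_right_derivative:
  assumes s: "0 \<le> s" "s < t"
  shows "(mean has_real_derivative (\<integral>y. ou_generator B D (wave s) y + wave_dt s y \<partial>P s x)) (at s within {s..})"
proof -
  obtain r where r: "0 \<le> r" "\<And>y::real^'n. cutoff R y \<noteq> 0 \<Longrightarrow> norm y \<le> r" by (rule cutoff_radius) blast
  obtain b where b: "\<And>y. \<bar>wave_dt s y\<bar> \<le> b" using wave_dt_bounded by blast
  define err where "err h = r * norm ((\<eta> (s + h) - \<eta> s) /\<^sub>R h - transpose B *v \<eta> s) +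
    r\<^sup>2 * (norm (\<eta> (s + h) - \<eta> s) * norm ((\<eta> (s + h) - \<eta> s) /\<^sub>R h))" for h
  have lim: "((\<lambda>h. (\<eta> (s + h) - \<eta> s) /\<^sub>R h) \<longlongrightarrow> transpose B *v \<eta> s) (at_right 0)"
    by (rule tendsto_within_subset[OF has_vector_derivative_quotient[OF \<eta>_derivative]]) (use s in auto)
  have lim0: "((\<lambda>h. \<eta> (s + h) - \<eta> s) \<longlongrightarrow> 0) (at_right 0)"
  proof -
    have "((\<lambda>h. h *\<^sub>R ((\<eta> (s + h) - \<eta> s) /\<^sub>R h)) \<longlongrightarrow> 0 *\<^sub>R (transpose B *v \<eta> s)) (at_right 0)"
      by (intro tendsto_intros lim)
    then have "((\<lambda>h. h *\<^sub>R ((\<eta> (s + h) - \<eta> s) /\<^sub>R h)) \<longlongrightarrow> 0) (at_right 0)" by simp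
    then show ?thesis
      by (rule Lim_transform_eventually) (auto simp: eventually_at_right_less intro: eventually_mono[OF eventually_at_right_less])
  qed
  have "(err \<longlongrightarrow> r * norm (transpose B *v \<eta> s - transpose B *v \<eta> s) + r\<^sup>2 * (norm (0::real^'n) * norm (transpose B *v \<eta> s))) (at_right 0)"
    unfolding err_def by (intro tendsto_intros lim lim0)
  then have err0: "(err \<longlongrightarrow> 0) (at_right 0)" by simp
  have A: "((\<lambda>h. \<integral>y. (wave (s + h) y - wave s y) / h - wave_dt s y \<partial>P (s + h) x) \<longlongrightarrow> 0) (at_right 0)"
  proof (rule Lim_null_comparison[OF _ err0], rule eventually_mono[OF eventually_at_right_less])
    fix h :: real assume h: "0 < h"
    show "norm (\<integral>y. (wave (s + h) y - wave s y) / h - wave_dt s y \<partial>P (s + h) x) \<le> err h"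
      unfolding real_norm_def
      by (rule kernel_bounded_integral(2)) (use s h wave_borel wave_dt_borel wave_taylor[OF r h] in \<open>auto simp: err_def\<close>)
  qed
  \<comment> \<open>Right continuity is obtained by multiplying a convergent difference quotient by
    \<open>h\<close>; for this \<open>wave_dt s\<close> itself has to be a test function.\<close>
  have "((\<lambda>h. h * (((\<integral>y. wave_dt s y \<partial>P (s + h) x) - (\<integral>y. wave_dt s y \<partial>P s x)) / h) + (\<integral>y. wave_dt s y \<partial>P s x))
      \<longlongrightarrow> 0 * (\<integral>y. ou_generator B D (wave_dt s) y \<partial>P s x) + (\<integral>y. wave_dt s y \<partial>P s x)) (at_right 0)"
    by (intro tendsto_intros integral_right_derivative[OF wave_dt_C2_compact wave_dt_borel b wave_dt_generator_borel s(1)])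
  then have "((\<lambda>h. h * (((\<integral>y. wave_dt s y \<partial>P (s + h) x) - (\<integral>y. wave_dt s y \<partial>P s x)) / h) + (\<integral>y. wave_dt s y \<partial>P s x))
      \<longlongrightarrow> (\<integral>y. wave_dt s y \<partial>P s x)) (at_right 0)" by simp
  then have Bt: "((\<lambda>h. \<integral>y. wave_dt s y \<partial>P (s + h) x) \<longlongrightarrow> (\<integral>y. wave_dt s y \<partial>P s x)) (at_right 0)"
    by (rule Lim_transform_eventually) (auto intro: eventually_mono[OF eventually_at_right_less])
  have C: "((\<lambda>h. ((\<integral>y. wave s y \<partial>P (s + h) x) - (\<integral>y. wave s y \<partial>P s x)) / h)
      \<longlongrightarrow> (\<integral>y. ou_generator B D (wave s) y \<partial>P s x)) (at_right 0)"
    by (rule integral_right_derivative[OF wave_C2_compact wave_borel wave_bounded wave_generator_borel s(1)])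
  have int: "integrable (P s x) (ou_generator B D (wave s))" "integrable (P s x) (wave_dt s)"
  proof -
    obtain c where "\<And>y. \<bar>ou_generator B D (wave s) y\<bar> \<le> c"
      using generator_bounded[OF wave_C2_compact wave_borel wave_bounded] by metis
    then show "integrable (P s x) (ou_generator B D (wave s))"
      by (rule kernel_bounded_integral(1)[OF s(1) wave_generator_borel])
    show "integrable (P s x) (wave_dt s)" by (rule kernel_bounded_integral(1)[OF s(1) wave_dt_borel b])
  qed
  have "((\<lambda>h. (mean (s + h) - mean s) / h) \<longlongrightarrow>
      0 + (\<integral>y. wave_dt s y \<partial>P s x) + (\<integral>y. ou_generator B D (wave s) y \<partial>P s x)) (at_right 0)"
  proof (rule Lim_transform_eventually[OF tendsto_add[OF tendsto_add[OF A Bt] C]], rule eventually_mono[OF eventually_at_right_less])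
    fix h :: real assume h: "0 < h"
    then have sh: "0 \<le> s + h" using s by simp
    have i: "integrable (P (s + h) x) (wave r)" "integrable (P (s + h) x) (wave_dt s)" for r
      using kernel_bounded_integral(1)[OF sh wave_borel wave_bounded] kernel_bounded_integral(1)[OF sh wave_dt_borel b] by auto
    show "(\<integral>y. (wave (s + h) y - wave s y) / h - wave_dt s y \<partial>P (s + h) x) + (\<integral>y. wave_dt s y \<partial>P (s + h) x) +
        ((\<integral>y. wave s y \<partial>P (s + h) x) - (\<integral>y. wave s y \<partial>P s x)) / h = (mean (s + h) - mean s) / h"
      using i by (simp add: mean_def diff_divide_distrib)
  qed
  then show ?thesis
    using int unfolding has_field_derivative_iff at_within_Ici_at_right
    by (subst filterlim_at_right_to_0) (simp add: add.commute)
qed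

text \<open>Needed because \<open>right_derivative_abs_bound\<close> asks for two-sided continuity
  on the closed interval.\<close>

lemma mean_continuous: "continuous_on {0..t} mean"
  unfolding continuous_on
proof
  fix s assume s: "s \<in> {0..t}"
  obtain r where r: "0 \<le> r" "\<And>y::real^'n. cutoff R y \<noteq> 0 \<Longrightarrow> norm y \<le> r" by (rule cutoff_radius) blast
  have "isCont \<eta> s" using \<eta>_derivative[of s] s by (auto dest: has_vector_derivative_continuous)
  then have "(\<eta> \<longlongrightarrow> \<eta> s) (at s within {0..t})"
    unfolding isCont_def by (rule tendsto_within_subset) simp
  then have "((\<lambda>s'. r * norm (\<eta> s' - \<eta> s)) \<longlongrightarrow> r * norm (\<eta> s - \<eta> s)) (at s within {0..t})"
    by (intro tendsto_intros)
  then have lim: "((\<lambda>s'. r * norm (\<eta> s' - \<eta> s)) \<longlongrightarrow> 0) (at s within {0..t})" by simp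
  have "((\<lambda>s'. \<integral>y. wave s' y - wave s y \<partial>P s' x) \<longlongrightarrow> 0) (at s within {0..t})"
  proof (rule Lim_null_comparison[OF _ lim])
    show "\<forall>\<^sub>F s' in at s within {0..t}. norm (\<integral>y. wave s' y - wave s y \<partial>P s' x) \<le> r * norm (\<eta> s' - \<eta> s)"
      unfolding eventually_at_filter real_norm_def
      by (intro always_eventually allI impI kernel_bounded_integral(2))
        (auto intro!: borel_measurable_diff wave_borel wave_increment[OF r])
  qed
  moreover have "((\<lambda>s'. \<integral>y. wave s y \<partial>P s' x) \<longlongrightarrow> (\<integral>y. wave s y \<partial>P s x)) (at s within {0..t})"
    using continuous_on_subset[OF integral_continuous[OF wave_C2_compact[of s] wave_borel wave_bounded], of "{0..t}" x] s
    by (auto simp: continuous_on)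
  ultimately have "((\<lambda>s'. (\<integral>y. wave s' y - wave s y \<partial>P s' x) + (\<integral>y. wave s y \<partial>P s' x)) \<longlongrightarrow> 0 + mean s) (at s within {0..t})"
    unfolding mean_def by (rule tendsto_add)
  then have "((\<lambda>s'. (\<integral>y. wave s' y - wave s y \<partial>P s' x) + (\<integral>y. wave s y \<partial>P s' x)) \<longlongrightarrow> mean s) (at s within {0..t})" by simp
  then show "(mean \<longlongrightarrow> mean s) (at s within {0..t})"
  proof (rule Lim_transform_eventually)
    show "\<forall>\<^sub>F s' in at s within {0..t}. (\<integral>y. wave s' y - wave s y \<partial>P s' x) + (\<integral>y. wave s y \<partial>P s' x) = mean s'"
      unfolding eventually_at_filter
    proof (intro always_eventually allI impI)
      fix s' assume "s' \<in> {0..t}"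
      then have "0 \<le> s'" by simp
      then have "integrable (P s' x) (wave r)" for r by (rule kernel_bounded_integral(1)[OF _ wave_borel wave_bounded])
      then show "(\<integral>y. wave s' y - wave s y \<partial>P s' x) + (\<integral>y. wave s y \<partial>P s' x) = mean s'" by (simp add: mean_def)
    qed
  qed
qed

text \<open>The weight \<open>exp (q (\<eta> s))\<close> compensates the decay of the plane wave exactly, so that only the
  error caused by the cutoff remains.\<close>

lemma weighted_mean_bound:
  assumes c: "C2_fun (cutoff R) g H"
    and K: "\<And>y. norm (g y) \<le> K / R" "\<And>y. \<bar>generator_at B D y (g y) (H y)\<bar> \<le> K / R"
    and \<Lambda>: "\<And>s. s \<in> {0..t} \<Longrightarrow> norm (D *v \<eta> s) \<le> \<Lambda>"
  shows "\<bar>exp (q (\<eta> t)) * mean t - exp (q (\<eta> 0)) * mean 0\<bar> \<le> exp (q \<xi>) * (K / R * (1 + 2 * \<Lambda>)) * (t - 0)"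
proof (rule right_derivative_abs_bound[OF t])
  have "continuous_on {0..t} (\<lambda>s. q (\<eta> s))"
    by (intro continuous_at_imp_continuous_on ballI DERIV_isCont[OF q_\<eta>_derivative]) simp
  then show "continuous_on {0..t} (\<lambda>s. exp (q (\<eta> s)) * mean s)"
    by (intro continuous_intros mean_continuous)
  fix s assume s: "0 \<le> s" "s < t"
  define k where "k = \<eta> s \<bullet> (D *v \<eta> s)"
  define f where "f y = ou_generator B D (wave s) y + wave_dt s y" for y
  have fm: "f \<in> borel_measurable borel"
    unfolding f_def using wave_generator_borel wave_dt_borel by measurable
  \<comment> \<open>By \<open>wave_generator\<close>, adding \<open>k * wave s y\<close> leaves just
    the terms that contain derivatives of the cutoff, all of order \<open>1 / R\<close>.\<close>
  have err: "\<bar>k * wave s y + f y\<bar> \<le> K / R * (1 + 2 * \<Lambda>)" for y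
  proof -
    have "k * wave s y + f y = cos (\<eta> s \<bullet> y + \<theta>) * generator_at B D y (g y) (H y) - 2 * sin (\<eta> s \<bullet> y + \<theta>) * (g y \<bullet> (D *v \<eta> s))"
      unfolding f_def wave_generator[OF c] k_def by simp
    also have "\<bar>\<dots>\<bar> \<le> 1 * (K / R) + 2 * (1 * (K / R * \<Lambda>))"
    proof (rule order_trans[OF abs_triangle_ineq4 add_mono])
      show "\<bar>cos (\<eta> s \<bullet> y + \<theta>) * generator_at B D y (g y) (H y)\<bar> \<le> 1 * (K / R)"
        unfolding abs_mult by (rule mult_mono) (use K in auto)
      have "\<bar>g y \<bullet> (D *v \<eta> s)\<bar> \<le> K / R * \<Lambda>"
        by (rule order_trans[OF Cauchy_Schwarz_ineq2 mult_mono])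
          (use K(1) \<Lambda>[of s] s order_trans[OF norm_ge_zero K(1)] in auto)
      then have "\<bar>sin (\<eta> s \<bullet> y + \<theta>)\<bar> * \<bar>g y \<bullet> (D *v \<eta> s)\<bar> \<le> 1 * (K / R * \<Lambda>)"
        by (intro mult_mono) auto
      then show "\<bar>2 * sin (\<eta> s \<bullet> y + \<theta>) * (g y \<bullet> (D *v \<eta> s))\<bar> \<le> 2 * (1 * (K / R * \<Lambda>))"
        by (simp add: abs_mult)
    qed
    finally show ?thesis by (simp add: algebra_simps)
  qed
  have i1: "integrable (P s x) (\<lambda>y. k * wave s y + f y)"
    by (rule kernel_bounded_integral(1)[OF s(1) _ err]) (use fm wave_borel in measurable)
  have i2: "integrable (P s x) (wave s)" by (rule kernel_bounded_integral(1)[OF s(1) wave_borel wave_bounded])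
  have "(\<integral>y. f y \<partial>P s x) = (\<integral>y. (k * wave s y + f y) - k * wave s y \<partial>P s x)" by simp
  also have "\<dots> = (\<integral>y. k * wave s y + f y \<partial>P s x) - k * mean s"
    using i1 i2 unfolding mean_def by (subst Bochner_Integration.integral_diff) auto
  finally have f: "(\<integral>y. f y \<partial>P s x) = (\<integral>y. k * wave s y + f y \<partial>P s x) - k * mean s" .
  have "((\<lambda>s. exp (q (\<eta> s)) * mean s) has_real_derivative
      exp (q (\<eta> s)) * k * mean s + (\<integral>y. f y \<partial>P s x) * exp (q (\<eta> s))) (at s within {s..})"
  proof (rule DERIV_mult)
    show "((\<lambda>s. exp (q (\<eta> s))) has_real_derivative exp (q (\<eta> s)) * k) (at s within {s..})"
      unfolding k_def by (rule has_field_derivative_at_within, rule DERIV_chain2[OF DERIV_exp q_\<eta>_derivative]) (use s in simp)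
    show "(mean has_real_derivative (\<integral>y. f y \<partial>P s x)) (at s within {s..})"
      unfolding f_def by (rule mean_right_derivative[OF s])
  qed
  also have "exp (q (\<eta> s)) * k * mean s + (\<integral>y. f y \<partial>P s x) * exp (q (\<eta> s)) =
      exp (q (\<eta> s)) * (\<integral>y. k * wave s y + f y \<partial>P s x)"
    unfolding f by (simp add: algebra_simps)
  finally have d: "((\<lambda>s. exp (q (\<eta> s)) * mean s) has_real_derivative
      exp (q (\<eta> s)) * (\<integral>y. k * wave s y + f y \<partial>P s x)) (at s within {s..})" .
  have "\<bar>exp (q (\<eta> s)) * (\<integral>y. k * wave s y + f y \<partial>P s x)\<bar> \<le> exp (q \<xi>) * (K / R * (1 + 2 * \<Lambda>))"
    unfolding abs_mult
  proof (rule mult_mono)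
    show "\<bar>exp (q (\<eta> s))\<bar> \<le> exp (q \<xi>)" using q_flow_le[of "t - s" \<xi>] s by (simp add: \<eta>_def)
    show "\<bar>\<integral>y. k * wave s y + f y \<partial>P s x\<bar> \<le> K / R * (1 + 2 * \<Lambda>)"
      by (rule kernel_bounded_integral(2)[OF s(1) _ err]) (use fm wave_borel in measurable)
  qed auto
  with d show "\<exists>Da. ((\<lambda>s. exp (q (\<eta> s)) * mean s) has_real_derivative Da) (at s within {s..}) \<and>
      \<bar>Da\<bar> \<le> exp (q \<xi>) * (K / R * (1 + 2 * \<Lambda>))" by blast
qed

end

text \<open>The limit \<open>R \<longrightarrow> \<infinity>\<close> in
  \<open>weighted_mean_bound\<close>: the error vanishes for fixed \<open>t\<close>, and dominated
  convergence removes the cutoff. At time 0 the kernel is a Dirac mass, which evaluates the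
  transported wave at \<open>x\<close>.\<close>

lemma semigroup_plane_wave:
  assumes t: "0 \<le> t"
  shows "semigroup_op P t (\<lambda>y. cos (\<xi> \<bullet> y + \<theta>)) x =
    exp (- (q \<xi> - q (E t *v \<xi>))) * cos ((E t *v \<xi>) \<bullet> x + \<theta>)"
proof -
  obtain K where K: "0 \<le> K" "\<And>R. 1 \<le> R \<Longrightarrow> \<exists>g H. C2_fun (cutoff R :: real^'n \<Rightarrow> real) g H \<and>
    (\<forall>x. norm (g x) \<le> K / R \<and> \<bar>generator_at B D x (g x) (H x)\<bar> \<le> K / R)"
    by (rule cutoff_generator[of B D]) blast
  have "continuous_on {0..t} (\<lambda>s. D *v \<eta> t \<xi> s)"
    by (intro linear_continuous_on_compose[OF _ matrix_vector_mul_linear] continuous_at_imp_continuous_on ballI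
        has_vector_derivative_continuous[OF \<eta>_derivative[OF order_refl t]]) simp
  then have "bounded ((\<lambda>s. D *v \<eta> t \<xi> s) ` {0..t})"
    by (intro compact_imp_bounded compact_continuous_image) auto
  then obtain \<Lambda> where \<Lambda>: "\<And>s. s \<in> {0..t} \<Longrightarrow> norm (D *v \<eta> t \<xi> s) \<le> \<Lambda>"
    unfolding bounded_iff by blast
  interpret p: prob_space "P t x" by (rule prob_kernel[OF t])
  let ?I = "\<lambda>R. \<integral>y. cutoff R y * cos (\<xi> \<bullet> y + \<theta>) \<partial>P t x"
  let ?J = "\<lambda>R. cutoff R x * cos ((E t *v \<xi>) \<bullet> x + \<theta>)"
  have bound: "\<bar>exp (q \<xi>) * ?I R - exp (q (E t *v \<xi>)) * ?J R\<bar> \<le> exp (q \<xi>) * (K / R * (1 + 2 * \<Lambda>)) * t" if R: "1 \<le> R" for R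
  proof -
    obtain g H where "C2_fun (cutoff R :: real^'n \<Rightarrow> real) g H"
      "\<And>x. norm (g x) \<le> K / R" "\<And>x. \<bar>generator_at B D x (g x) (H x)\<bar> \<le> K / R"
      using K(2)[OF R] by blast
    from weighted_mean_bound[OF R t this \<Lambda>]
    have "\<bar>exp (q (\<eta> t \<xi> t)) * mean R t \<theta> \<xi> x t - exp (q (\<eta> t \<xi> 0)) * mean R t \<theta> \<xi> x 0\<bar>
        \<le> exp (q \<xi>) * (K / R * (1 + 2 * \<Lambda>)) * t" by simp
    moreover have "mean R t \<theta> \<xi> x 0 = ?J R"
    proof -
      have "P 0 x = return borel x" using semigroup by (simp add: markov_semigroup_def)
      then have "mean R t \<theta> \<xi> x 0 = (\<integral>y. wave R t \<theta> \<xi> 0 y \<partial>return borel x)"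
        by (simp add: mean_def[OF R t])
      also have "\<dots> = wave R t \<theta> \<xi> 0 x"
        by (rule integral_return) (use wave_borel[OF R t] in auto)
      finally show ?thesis by (simp add: wave_def[OF R t] \<eta>_def[OF R t])
    qed
    moreover have "mean R t \<theta> \<xi> x t = ?I R"
      by (simp add: mean_def[OF R t] wave_def[OF R t] \<eta>_def[OF R t] flow_0)
    ultimately show ?thesis by (simp add: \<eta>_def[OF R t] flow_0)
  qed
  have tI: "(?I \<longlongrightarrow> (\<integral>y. cos (\<xi> \<bullet> y + \<theta>) \<partial>P t x)) at_top"
  proof (rule integral_dominated_convergence_at_top[where w = "\<lambda>_. 1"])
    show "(\<lambda>y. cos (\<xi> \<bullet> y + \<theta>)) \<in> borel_measurable (P t x)"
      unfolding measurable_kernel[OF t] by measurable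
    show "(\<lambda>y. cutoff R y * cos (\<xi> \<bullet> y + \<theta>)) \<in> borel_measurable (P t x)" for R
      unfolding measurable_kernel[OF t] cutoff_def by measurable
    show "AE y in P t x. ((\<lambda>R. cutoff R y * cos (\<xi> \<bullet> y + \<theta>)) \<longlongrightarrow> cos (\<xi> \<bullet> y + \<theta>)) at_top"
    proof (rule AE_I2)
      fix y
      show "((\<lambda>R. cutoff R y * cos (\<xi> \<bullet> y + \<theta>)) \<longlongrightarrow> cos (\<xi> \<bullet> y + \<theta>)) at_top"
        using tendsto_mult[OF cutoff_tendsto[of y] tendsto_const[of "cos (\<xi> \<bullet> y + \<theta>)"]] by simp
    qed
    show "\<forall>\<^sub>F R in at_top. AE y in P t x. norm (cutoff R y * cos (\<xi> \<bullet> y + \<theta>)) \<le> 1"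
    proof (rule eventually_at_top_linorderI[of 1])
      fix R :: real assume "1 \<le> R"
      then have "norm (cutoff R y * cos (\<xi> \<bullet> y + \<theta>)) \<le> 1" for y :: "real^'n"
        using mult_mono[of "\<bar>cutoff R y\<bar>" 1 "\<bar>cos (\<xi> \<bullet> y + \<theta>)\<bar>" 1] cutoff_bounds[of R y] by (simp add: abs_mult)
      then show "AE y in P t x. norm (cutoff R y * cos (\<xi> \<bullet> y + \<theta>)) \<le> 1" by simp
    qed
  qed simp
  have tJ: "(?J \<longlongrightarrow> cos ((E t *v \<xi>) \<bullet> x + \<theta>)) at_top"
    using tendsto_mult[OF cutoff_tendsto tendsto_const] by simp
  have "((\<lambda>R. exp (q \<xi>) * (K / R * (1 + 2 * \<Lambda>)) * t) \<longlongrightarrow> exp (q \<xi>) * (0 * (1 + 2 * \<Lambda>)) * t) at_top"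
    by (intro tendsto_intros tendsto_divide_0[OF tendsto_const] filterlim_at_top_imp_at_infinity filterlim_ident)
  then have "((\<lambda>R. exp (q \<xi>) * (K / R * (1 + 2 * \<Lambda>)) * t) \<longlongrightarrow> 0) at_top" by simp
  from Lim_null_comparison[OF eventually_at_top_linorderI[of 1] this, of "\<lambda>R. exp (q \<xi>) * ?I R - exp (q (E t *v \<xi>)) * ?J R"] bound
  have 0: "((\<lambda>R. exp (q \<xi>) * ?I R - exp (q (E t *v \<xi>)) * ?J R) \<longlongrightarrow> 0) at_top" by simp
  have "exp (q \<xi>) * (\<integral>y. cos (\<xi> \<bullet> y + \<theta>) \<partial>P t x) - exp (q (E t *v \<xi>)) * cos ((E t *v \<xi>) \<bullet> x + \<theta>) = 0"
    by (rule tendsto_unique[OF _ tendsto_diff[OF tendsto_mult[OF tendsto_const tI] tendsto_mult[OF tendsto_const tJ]] 0]) simp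
  then show ?thesis
    by (simp add: semigroup_op_def exp_diff exp_minus field_simps)
qed

text \<open>Invariance permits letting \<open>t\<close> tend to infinity, where the frequency
  contracts to 0 and the wave becomes the constant \<open>cos \<theta>\<close>.\<close>

lemma invariant_plane_wave:
  assumes inv: "invariant_measure P \<mu>"
  shows "(\<integral>y. cos (\<xi> \<bullet> y + \<theta>) \<partial>\<mu>) = exp (- q \<xi>) * cos \<theta>"
proof -
  have \<mu>: "\<mu> \<in> space (prob_algebra borel)" and bind: "\<And>t. 0 \<le> t \<Longrightarrow> \<mu> \<bind> P t = \<mu>"
    using inv by (auto simp: invariant_measure_def)
  interpret \<mu>: prob_space \<mu> using \<mu> by (simp add: space_prob_algebra)
  have sets: "sets \<mu> = sets borel" using \<mu> by (simp add: space_prob_algebra)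
  then have meas: "measurable \<mu> N = measurable borel N" for N :: "'z measure" by (rule measurable_cong_sets) simp
  let ?F = "\<lambda>\<zeta>. \<integral>y. cos (\<zeta> \<bullet> y + \<theta>) \<partial>\<mu>"
  have step: "?F \<xi> = exp (- (q \<xi> - q (E t *v \<xi>))) * ?F (E t *v \<xi>)" if t: "0 \<le> t" for t
  proof -
    have "?F \<xi> = (\<integral>y. cos (\<xi> \<bullet> y + \<theta>) \<partial>(\<mu> \<bind> P t))" by (simp add: bind[OF t])
    also have "\<dots> = (\<integral>x. semigroup_op P t (\<lambda>y. cos (\<xi> \<bullet> y + \<theta>)) x \<partial>\<mu>)"
      unfolding semigroup_op_def
    proof (rule integral_bind[where K = borel and B = 1 and B' = 1])
      show "P t \<in> \<mu> \<rightarrow>\<^sub>M subprob_algebra borel" using kernel_measurable[OF t] by (simp add: meas)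
      show "AE y in \<mu>. emeasure (P t y) (space (P t y)) \<le> ennreal 1"
        using prob_space.emeasure_space_1[OF prob_kernel[OF t]] by simp
    qed (auto intro: \<mu>.finite_measure_axioms)
    finally show ?thesis by (simp add: semigroup_plane_wave[OF t])
  qed
  have "((\<lambda>t. ?F (E t *v \<xi>)) \<longlongrightarrow> ?F 0) at_top"
  proof (rule integral_dominated_convergence_at_top[where w = "\<lambda>_. 1"])
    show "AE y in \<mu>. ((\<lambda>t. cos ((E t *v \<xi>) \<bullet> y + \<theta>)) \<longlongrightarrow> cos (0 \<bullet> y + \<theta>)) at_top"
      by (intro AE_I2 tendsto_intros flow_tendsto)
  qed (auto simp: meas)
  then have "((\<lambda>t. ?F (E t *v \<xi>)) \<longlongrightarrow> cos \<theta>) at_top" by (simp add: \<mu>.prob_space)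
  then have "((\<lambda>t. exp (- (q \<xi> - q (E t *v \<xi>))) * ?F (E t *v \<xi>)) \<longlongrightarrow> exp (- (q \<xi> - 0)) * cos \<theta>) at_top"
    by (intro tendsto_intros q_flow_tendsto)
  moreover have "((\<lambda>t. exp (- (q \<xi> - q (E t *v \<xi>))) * ?F (E t *v \<xi>)) \<longlongrightarrow> ?F \<xi>) at_top"
    by (rule tendsto_eventually, rule eventually_at_top_linorderI[of 0], rule step[symmetric])
  ultimately have "exp (- (q \<xi> - 0)) * cos \<theta> = ?F \<xi>" by (intro tendsto_unique[of at_top]) auto
  then show ?thesis by simp
qed

end

section \<open>Density of trigonometric sums\<close>

text \<open>With lists, concatenation is addition and frequencies may repeat.\<close>

definition trig_sum :: "(real \<times> (real^'n) \<times> real) list \<Rightarrow> real^'n::finite \<Rightarrow> real" where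
  "trig_sum l x = (\<Sum>(a, \<xi>, \<theta>)\<leftarrow>l. a * cos (\<xi> \<bullet> x + \<theta>))"

lemma trig_sum_simps [simp]:
  "trig_sum [] x = 0"
  "trig_sum ((a, \<xi>, \<theta>) # l) x = a * cos (\<xi> \<bullet> x + \<theta>) + trig_sum l x"
  "trig_sum (l @ l') x = trig_sum l x + trig_sum l' x"
  by (simp_all add: trig_sum_def)

lemma trig_sum_borel [measurable]: "trig_sum l \<in> borel_measurable borel"
  by (induction l) (auto simp: trig_sum_def[abs_def] split_def)

lemma trig_sum_bounded: "\<exists>b. \<forall>x. \<bar>trig_sum l x\<bar> \<le> b"
proof (induction l)
  case (Cons c l)
  obtain a \<xi> \<theta> where c: "c = (a, \<xi>, \<theta>)" by (cases c)
  obtain b where b: "\<And>x. \<bar>trig_sum l x\<bar> \<le> b" using Cons by blast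
  have "\<bar>trig_sum (c # l) x\<bar> \<le> \<bar>a\<bar> + b" for x
  proof -
    have "\<bar>a * cos (\<xi> \<bullet> x + \<theta>)\<bar> \<le> \<bar>a\<bar> * 1" unfolding abs_mult by (intro mult_left_mono) auto
    then show ?thesis using b[of x] by (simp add: c)
  qed
  then show ?case by blast
qed auto

text \<open>By the product-to-sum formula; the phases make sines and cosines one family, so that the
  class is an algebra.\<close>

lemma trig_sum_mult: "\<exists>l''. \<forall>x. trig_sum l'' x = trig_sum l x * trig_sum l' x"
proof (induction l)
  case Nil
  show ?case by (rule exI[of _ "[]"]) simp
next
  case (Cons c l)
  obtain a \<xi> \<theta> where c: "c = (a, \<xi>, \<theta>)" by (cases c)
  obtain l1 where l1: "\<And>x. trig_sum l1 x = trig_sum l x * trig_sum l' x" using Cons by blast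
  have "\<exists>l2. \<forall>x. trig_sum l2 x = a * cos (\<xi> \<bullet> x + \<theta>) * trig_sum l' x"
  proof (induction l')
    case Nil
    show ?case by (rule exI[of _ "[]"]) simp
  next
    case (Cons d l')
    obtain b \<zeta> \<phi> where d: "d = (b, \<zeta>, \<phi>)" by (cases d)
    obtain l2 where l2: "\<And>x. trig_sum l2 x = a * cos (\<xi> \<bullet> x + \<theta>) * trig_sum l' x" using Cons by blast
    have "trig_sum ((a * b / 2, \<xi> - \<zeta>, \<theta> - \<phi>) # (a * b / 2, \<xi> + \<zeta>, \<theta> + \<phi>) # l2) x =
        a * cos (\<xi> \<bullet> x + \<theta>) * trig_sum (d # l') x" for x
    proof -
      define u v where "u = \<xi> \<bullet> x + \<theta>" and "v = \<zeta> \<bullet> x + \<phi>"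
      have uv: "(\<xi> - \<zeta>) \<bullet> x + (\<theta> - \<phi>) = u - v" "(\<xi> + \<zeta>) \<bullet> x + (\<theta> + \<phi>) = u + v"
        by (simp_all add: u_def v_def inner_diff_left inner_add_left)
      have "a * cos u * (b * cos v) = a * b * (cos u * cos v)" by simp
      also have "\<dots> = a * b / 2 * cos (u - v) + a * b / 2 * cos (u + v)"
        unfolding cos_times_cos by (simp add: algebra_simps)
      finally show ?thesis by (simp add: d l2 distrib_left uv u_def[symmetric] v_def[symmetric])
    qed
    then show ?case by blast
  qed
  then obtain l2 where "\<And>x. trig_sum l2 x = a * cos (\<xi> \<bullet> x + \<theta>) * trig_sum l' x" by blast
  then have "trig_sum (l2 @ l1) x = trig_sum (c # l) x * trig_sum l' x" for x
    by (simp add: c l1 distrib_right)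
  then show ?case by blast
qed

lemma square_add_le: "(a + b)\<^sup>2 \<le> 2 * a\<^sup>2 + 2 * (b::real)\<^sup>2"
  using sum_squares_bound[of a b] by (simp add: power2_sum)

lemma nn_integral_square_add:
  assumes [measurable]: "f \<in> borel_measurable M" "g \<in> borel_measurable M"
  shows "(\<integral>\<^sup>+x. ennreal ((f x + g x)\<^sup>2) \<partial>M) \<le> 2 * (\<integral>\<^sup>+x. ennreal ((f x)\<^sup>2) \<partial>M) + 2 * (\<integral>\<^sup>+x. ennreal ((g x)\<^sup>2) \<partial>M)"
proof -
  have "(\<integral>\<^sup>+x. ennreal ((f x + g x)\<^sup>2) \<partial>M) \<le> (\<integral>\<^sup>+x. 2 * ennreal ((f x)\<^sup>2) + 2 * ennreal ((g x)\<^sup>2) \<partial>M)"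
  proof (intro nn_integral_mono)
    fix x
    have "ennreal ((f x + g x)\<^sup>2) \<le> ennreal (2 * (f x)\<^sup>2 + 2 * (g x)\<^sup>2)"
      by (intro ennreal_leI square_add_le)
    then show "ennreal ((f x + g x)\<^sup>2) \<le> 2 * ennreal ((f x)\<^sup>2) + 2 * ennreal ((g x)\<^sup>2)"
      by (simp add: ennreal_plus ennreal_mult)
  qed
  then show ?thesis by (simp add: nn_integral_add nn_integral_cmult)
qed

section \<open>The L2 closure of the trigonometric sums\<close>

locale borel_prob = prob_space \<mu> for \<mu> :: "(real^'n::finite) measure" +
  assumes sets_borel: "sets \<mu> = sets borel"
begin

lemma measurable_borel: "measurable \<mu> N = measurable borel N"
  by (rule measurable_cong_sets) (auto simp: sets_borel)

definition sq :: "(real^'n \<Rightarrow> real) \<Rightarrow> ennreal" where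
  "sq f = (\<integral>\<^sup>+x. ennreal ((f x)\<^sup>2) \<partial>\<mu>)"

lemma sq_add:
  assumes "f \<in> borel_measurable borel" "g \<in> borel_measurable borel"
  shows "sq (\<lambda>x. f x + g x) \<le> 2 * sq f + 2 * sq g"
  unfolding sq_def by (rule nn_integral_square_add) (use assms in \<open>auto simp: measurable_borel\<close>)

lemma sq_mult_bounded:
  assumes [measurable]: "f \<in> borel_measurable borel" and g: "\<And>x. \<bar>g x\<bar> \<le> b"
  shows "sq (\<lambda>x. g x * f x) \<le> ennreal (b\<^sup>2) * sq f"
proof -
  have [measurable]: "f \<in> borel_measurable \<mu>" by (simp add: measurable_borel)
  have "sq (\<lambda>x. g x * f x) \<le> (\<integral>\<^sup>+x. ennreal (b\<^sup>2) * ennreal ((f x)\<^sup>2) \<partial>\<mu>)"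
    unfolding sq_def
  proof (intro nn_integral_mono)
    fix x
    have "(g x)\<^sup>2 \<le> b\<^sup>2" using g[of x] by (intro abs_le_square_iff[THEN iffD1]) linarith
    then have "(g x * f x)\<^sup>2 \<le> b\<^sup>2 * (f x)\<^sup>2" by (simp add: power_mult_distrib mult_right_mono)
    then show "ennreal ((g x * f x)\<^sup>2) \<le> ennreal (b\<^sup>2) * ennreal ((f x)\<^sup>2)"
      by (simp add: ennreal_mult[symmetric])
  qed
  then show ?thesis by (simp add: sq_def nn_integral_cmult)
qed

definition approx :: "(real^'n \<Rightarrow> real) \<Rightarrow> bool" where
  "approx f \<longleftrightarrow> f \<in> borel_measurable borel \<and> (\<forall>e>0. \<exists>l. sq (\<lambda>x. f x - trig_sum l x) < ennreal e)"

lemma approx_borel: "approx f \<Longrightarrow> f \<in> borel_measurable borel"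
  by (simp add: approx_def)

lemma ennreal_four_split: "a < ennreal (e / 4) \<Longrightarrow> b < ennreal (e / 4) \<Longrightarrow> 0 < e \<Longrightarrow> 2 * a + 2 * b < ennreal e"
proof -
  assume "a < ennreal (e / 4)" "b < ennreal (e / 4)" "0 < e"
  then obtain a' b' where "a = ennreal a'" "0 \<le> a'" "b = ennreal b'" "0 \<le> b'"
    by (metis enn2real_nonneg ennreal_enn2real ennreal_less_top less_trans)
  then show ?thesis using \<open>a < _\<close> \<open>b < _\<close>
    by (simp add: ennreal_less_iff flip: ennreal_plus ennreal_mult ennreal_numeral)
qed

lemma approx_closed:
  assumes "f \<in> borel_measurable borel"
    and "\<And>e. 0 < e \<Longrightarrow> \<exists>g. approx g \<and> sq (\<lambda>x. f x - g x) < ennreal e"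
  shows "approx f"
  unfolding approx_def
proof (intro conjI allI impI assms(1))
  fix e :: real assume e: "0 < e"
  obtain g where g: "approx g" "sq (\<lambda>x. f x - g x) < ennreal (e / 4)" using assms(2)[of "e / 4"] e by auto
  obtain l where l: "sq (\<lambda>x. g x - trig_sum l x) < ennreal (e / 4)"
    using g(1) e unfolding approx_def by (metis divide_pos_pos zero_less_numeral)
  have "sq (\<lambda>x. (f x - g x) + (g x - trig_sum l x)) \<le> 2 * sq (\<lambda>x. f x - g x) + 2 * sq (\<lambda>x. g x - trig_sum l x)"
    by (rule sq_add) (use assms(1) approx_borel[OF g(1)] in auto)
  also have "\<dots> < ennreal e" by (rule ennreal_four_split[OF g(2) l e])
  finally show "\<exists>l. sq (\<lambda>x. f x - trig_sum l x) < ennreal e" by auto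
qed

lemma approx_trig: "approx (trig_sum l)"
  unfolding approx_def by (auto simp: sq_def intro: exI[of _ l])

lemma approx_add:
  assumes "approx f" "approx g" shows "approx (\<lambda>x. f x + g x)"
  unfolding approx_def
proof (intro conjI allI impI)
  show "(\<lambda>x. f x + g x) \<in> borel_measurable borel" using assms[THEN approx_borel] by measurable
  fix e :: real assume e: "0 < e"
  then have e4: "0 < e / 4" by simp
  obtain l l' where l: "sq (\<lambda>x. f x - trig_sum l x) < ennreal (e / 4)" "sq (\<lambda>x. g x - trig_sum l' x) < ennreal (e / 4)"
    using assms e4 unfolding approx_def by metis
  have "sq (\<lambda>x. (f x - trig_sum l x) + (g x - trig_sum l' x)) \<le> 2 * sq (\<lambda>x. f x - trig_sum l x) + 2 * sq (\<lambda>x. g x - trig_sum l' x)"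
    by (rule sq_add) (use assms[THEN approx_borel] in auto)
  also have "\<dots> < ennreal e" by (rule ennreal_four_split[OF l e])
  finally show "\<exists>l. sq (\<lambda>x. f x + g x - trig_sum l x) < ennreal e"
    by (intro exI[of _ "l @ l'"]) (simp add: algebra_simps)
qed

lemma small_multiple:
  assumes "0 < e" obtains d where "0 < d" "\<And>a. a < ennreal d \<Longrightarrow> ennreal (b\<^sup>2) * a < ennreal e"
proof
  show "0 < e / (b\<^sup>2 + 1)" using assms by (simp add: add_nonneg_pos)
  fix a assume a: "a < ennreal (e / (b\<^sup>2 + 1))"
  then obtain a' where a': "a = ennreal a'" "0 \<le> a'"
    by (metis enn2real_nonneg ennreal_enn2real ennreal_less_top less_trans)
  have "0 < b\<^sup>2 + 1" by (simp add: add_nonneg_pos)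
  then have "(b\<^sup>2 + 1) * a' < e" using a a' by (simp add: ennreal_less_iff less_divide_eq mult.commute)
  then have "b\<^sup>2 * a' < e" using a'(2) by (simp add: algebra_simps)
  then show "ennreal (b\<^sup>2) * a < ennreal e" using a' by (simp add: ennreal_less_iff flip: ennreal_mult)
qed

text \<open>Approximants of a bounded function need not be uniformly bounded, so a product cannot be
  approximated in both factors at once. Here one factor is already a trigonometric sum, hence
  bounded; \<open>approx_mult\<close> then replaces the other factor.\<close>

lemma approx_trig_mult:
  assumes f: "approx f" shows "approx (\<lambda>x. trig_sum l x * f x)"
proof (rule approx_closed)
  show "(\<lambda>x. trig_sum l x * f x) \<in> borel_measurable borel" using approx_borel[OF f] by measurable
  fix e :: real assume "0 < e"
  obtain b where b: "\<And>x. \<bar>trig_sum l x\<bar> \<le> b" using trig_sum_bounded[of l] by auto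
  obtain d where d: "0 < d" "\<And>a. a < ennreal d \<Longrightarrow> ennreal (b\<^sup>2) * a < ennreal e"
    by (rule small_multiple[OF \<open>0 < e\<close>]) blast
  obtain l' where l': "sq (\<lambda>x. f x - trig_sum l' x) < ennreal d" using f d(1) by (auto simp: approx_def)
  obtain l'' where l'': "\<And>x. trig_sum l'' x = trig_sum l x * trig_sum l' x" using trig_sum_mult by blast
  have "sq (\<lambda>x. trig_sum l x * (f x - trig_sum l' x)) \<le> ennreal (b\<^sup>2) * sq (\<lambda>x. f x - trig_sum l' x)"
    by (rule sq_mult_bounded[OF _ b]) (use approx_borel[OF f] in measurable)
  also have "\<dots> < ennreal e" by (rule d(2)[OF l'])
  finally show "\<exists>g. approx g \<and> sq (\<lambda>x. trig_sum l x * f x - g x) < ennreal e"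
    by (intro exI[of _ "trig_sum l''"]) (simp add: approx_trig l'' right_diff_distrib)
qed

lemma approx_mult:
  assumes f: "approx f" "\<And>x. \<bar>f x\<bar> \<le> b" and g: "approx g"
  shows "approx (\<lambda>x. f x * g x)"
proof (rule approx_closed)
  show "(\<lambda>x. f x * g x) \<in> borel_measurable borel" using approx_borel[OF f(1)] approx_borel[OF g] by measurable
  fix e :: real assume "0 < e"
  obtain d where d: "0 < d" "\<And>a. a < ennreal d \<Longrightarrow> ennreal (b\<^sup>2) * a < ennreal e"
    by (rule small_multiple[OF \<open>0 < e\<close>]) blast
  obtain l where l: "sq (\<lambda>x. g x - trig_sum l x) < ennreal d" using g d(1) by (auto simp: approx_def)
  have "sq (\<lambda>x. f x * (g x - trig_sum l x)) \<le> ennreal (b\<^sup>2) * sq (\<lambda>x. g x - trig_sum l x)"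
    by (rule sq_mult_bounded[OF _ f(2)]) (use approx_borel[OF g] in measurable)
  also have "\<dots> < ennreal e" by (rule d(2)[OF l])
  finally show "\<exists>h. approx h \<and> sq (\<lambda>x. f x * g x - h x) < ennreal e"
    by (intro exI[of _ "\<lambda>x. trig_sum l x * f x"]) (simp add: approx_trig_mult[OF f(1)], simp add: algebra_simps)
qed

lemma approx_const: "approx (\<lambda>_. c)"
  using approx_trig[of "[(c, 0, 0)]"] by (simp add: trig_sum_def[abs_def])

lemma approx_cmult: "approx f \<Longrightarrow> approx (\<lambda>x. c * f x)"
  using approx_mult[OF approx_const[of c], of "\<bar>c\<bar>" f] by simp

lemma sq_tendsto_zero:
  assumes u: "\<And>i. u i \<in> borel_measurable borel" and w: "w \<in> borel_measurable borel"
    and fin: "(\<integral>\<^sup>+x. w x \<partial>\<mu>) < \<infinity>" and dom: "\<And>i x. ennreal ((u i x)\<^sup>2) \<le> w x"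
    and lim: "\<And>x. (\<lambda>i. u i x) \<longlonglongrightarrow> 0"
  shows "(\<lambda>i. sq (u i)) \<longlonglongrightarrow> 0"
proof -
  have "(\<lambda>i. \<integral>\<^sup>+x. ennreal ((u i x)\<^sup>2) \<partial>\<mu>) \<longlonglongrightarrow> (\<integral>\<^sup>+x. ennreal 0 \<partial>\<mu>)"
  proof (rule nn_integral_dominated_convergence[where w = w])
    have "(\<lambda>i. ennreal ((u i x)\<^sup>2)) \<longlonglongrightarrow> ennreal (0\<^sup>2)" for x
      by (intro tendsto_ennrealI tendsto_power lim)
    then show "AE x in \<mu>. (\<lambda>i. ennreal ((u i x)\<^sup>2)) \<longlonglongrightarrow> ennreal 0" by simp
  qed (use u w fin dom in \<open>auto simp: measurable_borel\<close>)
  then show ?thesis by (simp add: sq_def)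
qed

lemma approx_limit_dominated:
  assumes g: "\<And>i. approx (g i)" and f: "f \<in> borel_measurable borel"
    and w: "w \<in> borel_measurable borel" "(\<integral>\<^sup>+x. w x \<partial>\<mu>) < \<infinity>" "\<And>i x. ennreal ((f x - g i x)\<^sup>2) \<le> w x"
    and lim: "\<And>x. (\<lambda>i. g i x) \<longlonglongrightarrow> f x"
  shows "approx f"
proof (rule approx_closed[OF f])
  fix e :: real assume "0 < e"
  have "(\<lambda>i. f x - g i x) \<longlonglongrightarrow> 0" for x
    using tendsto_diff[OF tendsto_const lim] by (metis diff_self)
  then have "(\<lambda>i. sq (\<lambda>x. f x - g i x)) \<longlonglongrightarrow> 0"
    by (intro sq_tendsto_zero[OF _ w]) (use f approx_borel[OF g] in measurable)
  then have "\<forall>\<^sub>F i in sequentially. sq (\<lambda>x. f x - g i x) < ennreal e"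
    using \<open>0 < e\<close> by (intro order_tendstoD(2)) auto
  then obtain i where "sq (\<lambda>x. f x - g i x) < ennreal e" using eventually_happens' sequentially_bot by blast
  then show "\<exists>h. approx h \<and> sq (\<lambda>x. f x - h x) < ennreal e" using g by blast
qed

lemma approx_limit:
  assumes g: "\<And>i. approx (g i)" and b: "\<And>i x. \<bar>g i x\<bar> \<le> b"
    and lim: "\<And>x. (\<lambda>i. g i x) \<longlonglongrightarrow> f x"
  shows "approx f"
proof (rule approx_limit_dominated[OF g _ _ _ _ lim, where w = "\<lambda>_. ennreal ((2 * b)\<^sup>2)"])
  show "f \<in> borel_measurable borel"
    by (rule borel_measurable_LIMSEQ_metric[OF approx_borel[OF g] lim])
  have fb: "\<bar>f x\<bar> \<le> b" for x
    by (rule LIMSEQ_le_const2[OF tendsto_rabs[OF lim]]) (use b in auto)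
  show "ennreal ((f x - g i x)\<^sup>2) \<le> ennreal ((2 * b)\<^sup>2)" for i x
    using b[of i x] fb[of x] by (intro ennreal_leI abs_le_square_iff[THEN iffD1]) linarith
qed (auto simp: emeasure_space_1)

text \<open>Polynomials in \<open>f\<close> stay in the class by \<open>approx_mult\<close>, and on
  the compact range of \<open>f\<close> the Weierstrass theorem approximates \<open>\<phi>\<close>
  uniformly.\<close>

lemma approx_continuous_compose:
  fixes \<phi> :: "real \<Rightarrow> real"
  assumes f: "approx f" "\<And>x. \<bar>f x\<bar> \<le> b" and \<phi>: "continuous_on UNIV \<phi>"
  shows "approx (\<lambda>x. \<phi> (f x))"
proof (rule approx_closed)
  show "(\<lambda>x. \<phi> (f x)) \<in> borel_measurable borel"
    by (rule measurable_compose[OF approx_borel[OF f(1)] borel_measurable_continuous_onI[OF \<phi>]])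
  fix e :: real assume e: "0 < e"
  have poly: "approx (\<lambda>x. p (f x))" if "real_polynomial_function p" for p :: "real \<Rightarrow> real"
  proof -
    have bd: "\<exists>c. \<forall>x. \<bar>r (f x)\<bar> \<le> c" if r: "real_polynomial_function r" for r :: "real \<Rightarrow> real"
    proof -
      have "compact (r ` {- b..b})"
        by (intro compact_continuous_image continuous_on_polymonial_function) (use r real_polynomial_function_eq in auto)
      then have "bounded (r ` {- b..b})" by (rule compact_imp_bounded)
      then obtain c where "\<forall>y\<in>{- b..b}. \<bar>r y\<bar> \<le> c" by (auto simp: bounded_iff)
      moreover have "f x \<in> {- b..b}" for x using f(2)[of x] by auto
      ultimately show ?thesis by blast
    qed
    show ?thesis using that
    proof induction
      case (linear p)
      interpret bounded_linear p by (rule linear)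
      have "p y = p 1 * y" for y using scaleR[of y 1] by simp
      then have "(\<lambda>x. p (f x)) = (\<lambda>x. p 1 * f x)" by blast
      then show ?case using approx_cmult[OF f(1)] by simp
    next
      case (mult p r)
      then show ?case using bd[of p] approx_mult[of "\<lambda>x. p (f x)"] by blast
    qed (auto intro: approx_const approx_add)
  qed
  define d where "d = sqrt (e / 2)"
  have d: "0 < d" "d\<^sup>2 = e / 2" using e by (auto simp: d_def)
  obtain p where p: "real_polynomial_function p" "\<And>y. y \<in> {- b..b} \<Longrightarrow> \<bar>\<phi> y - p y\<bar> < d"
    using Stone_Weierstrass_real_polynomial_function[of "{- b..b}" \<phi> d] continuous_on_subset[OF \<phi>] d(1) by auto
  have "sq (\<lambda>x. \<phi> (f x) - p (f x)) \<le> (\<integral>\<^sup>+x. ennreal (d\<^sup>2) \<partial>\<mu>)"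
    unfolding sq_def
  proof (intro nn_integral_mono ennreal_leI abs_le_square_iff[THEN iffD1])
    fix x
    have "f x \<in> {- b..b}" using f(2)[of x] by auto
    then show "\<bar>\<phi> (f x) - p (f x)\<bar> \<le> \<bar>d\<bar>" using p(2)[of "f x"] d(1) by simp
  qed
  also have "\<dots> < ennreal e" using e by (simp add: emeasure_space_1 d(2) ennreal_less_iff)
  finally show "\<exists>g. approx g \<and> sq (\<lambda>x. \<phi> (f x) - g x) < ennreal e" using poly[OF p(1)] by blast
qed

text \<open>Since \<open>k sin (x / k)\<close> tends to \<open>x\<close>, functions of one coordinate are limits of functions of
  trigonometric sums.\<close>

lemma approx_component_compose:
  fixes \<phi> :: "real \<Rightarrow> real"
  assumes \<phi>: "continuous_on UNIV \<phi>" "\<And>y. \<bar>\<phi> y\<bar> \<le> b"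
  shows "approx (\<lambda>x. \<phi> (x $ i))"
proof (rule approx_limit)
  define s where "s k x = real (Suc k) * sin (x $ i / real (Suc k))" for k and x :: "real^'n"
  show "approx (\<lambda>x. \<phi> (s k x))" for k
  proof (rule approx_continuous_compose[OF _ _ \<phi>(1)])
    have "s k = trig_sum [(real (Suc k), axis i (1 / real (Suc k)), - pi / 2)]"
    proof
      fix x
      have "cos (u + - pi / 2) = sin u" for u :: real by (simp add: cos_diff)
      then show "s k x = trig_sum [(real (Suc k), axis i (1 / real (Suc k)), - pi / 2)] x"
        by (simp only: trig_sum_simps s_def inner_axis' inner_real_def) simp
    qed
    then show "approx (s k)" using approx_trig by simp
    have "\<bar>s k x\<bar> \<le> real (Suc k) * 1" for x
      unfolding s_def abs_mult by (intro mult_mono) auto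
    then show "\<bar>s k x\<bar> \<le> real (Suc k)" for x by simp
  qed
  show "\<bar>\<phi> (s k x)\<bar> \<le> b" for k x by (rule \<phi>(2))
  fix x
  have "(\<lambda>k. s k x) \<longlonglongrightarrow> x $ i"
  proof -
    have "((\<lambda>u. u * sin (x $ i / u)) \<longlongrightarrow> x $ i) at_top" by real_asymp
    from filterlim_compose[OF this filterlim_compose[OF filterlim_real_sequentially filterlim_Suc]]
    show ?thesis unfolding s_def .
  qed
  then show "(\<lambda>k. \<phi> (s k x)) \<longlonglongrightarrow> \<phi> (x $ i)"
    by (rule isCont_tendsto_compose[rotated]) (use \<phi>(1) in \<open>simp add: continuous_on_eq_continuous_at\<close>)
qed

lemma approx_half_space: "approx (indicator {x. x $ i \<le> a})"
proof (rule approx_limit)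
  \<comment> \<open>A continuous ramp of slope \<open>- m\<close>, equal to 1 up to \<open>a\<close>
    and decreasing pointwise to the indicator.\<close>
  define \<phi> where "\<phi> m u = max 0 (min 1 (1 - real m * (u - a)))" for m u
  show "approx (\<lambda>x. \<phi> m (x $ i))" for m
    by (rule approx_component_compose[where b = 1]) (auto simp: \<phi>_def intro!: continuous_intros)
  show "\<bar>\<phi> m (x $ i)\<bar> \<le> 1" for m and x :: "real^'n" by (auto simp: \<phi>_def)
  fix x :: "real^'n"
  show "(\<lambda>m. \<phi> m (x $ i)) \<longlonglongrightarrow> indicator {x. x $ i \<le> a} x"
  proof (cases "x $ i \<le> a")
    case True
    then have "\<phi> m (x $ i) = 1" for m by (auto simp: \<phi>_def mult_nonneg_nonpos)
    then show ?thesis using True by simp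
  next
    case False
    then obtain n where n: "1 < real n * (x $ i - a)" using reals_Archimedean3[of "x $ i - a"] by auto
    have "\<phi> m (x $ i) = 0" if "n \<le> m" for m
    proof -
      have "real n * (x $ i - a) \<le> real m * (x $ i - a)" using that False by (intro mult_right_mono) auto
      then show ?thesis using n by (simp add: \<phi>_def)
    qed
    then have "(\<lambda>m. \<phi> m (x $ i)) \<longlonglongrightarrow> 0"
      by (intro tendsto_eventually) (auto simp: eventually_sequentially)
    then show ?thesis using False by simp
  qed
qed

text \<open>The pi-lambda theorem with the orthants \<open>{..a}\<close> as generator; their
  indicators are finite products of indicators of half-spaces.\<close>

lemma approx_indicator:
  assumes "A \<in> sets borel" shows "approx (indicator A)"
proof -
  let ?G = "range (\<lambda>a::real^'n. {..a})"
  have box: "approx (indicator {..a})" for a :: "real^'n"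
  proof -
    have "approx (\<lambda>x. \<Prod>i\<in>F. indicator {x. x $ i \<le> a $ i} x)" if "finite F" for F
      using that
    proof (induction F rule: finite_induct)
      case (insert i F)
      then show ?case
        using approx_mult[OF approx_half_space[of i "a $ i"], of 1] by (simp add: indicator_def)
    qed (simp add: approx_const)
    from this[OF finite, of UNIV]
    have "approx (\<lambda>x. \<Prod>i\<in>UNIV. indicator {x. x $ i \<le> a $ i} x)" .
    also have "(\<lambda>x. \<Prod>i\<in>UNIV. indicator {x. x $ i \<le> a $ i} x :: real) = indicator {..a}"
    proof
      fix x :: "real^'n"
      show "(\<Prod>i\<in>UNIV. indicator {x. x $ i \<le> a $ i} x) = (indicator {..a} x :: real)"
        by (cases "x \<le> a") (auto simp: less_eq_vec_def indicator_def prod_zero_iff)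
    qed
    finally show ?thesis .
  qed
  have "A \<in> sigma_sets UNIV ?G" using assms by (simp add: borel_eq_atMost)
  then show ?thesis
  proof (rule sigma_sets_induct_disjoint[rotated 2])
    show "Int_stable ?G"
    proof (rule Int_stableI_image)
      fix a b :: "real^'n"
      have "{..a} \<inter> {..b} = {..inf a b}" by auto
      then show "\<exists>c\<in>UNIV. {..a} \<inter> {..b} = {..c}" by blast
    qed
    show "approx (indicator A)" if "A \<in> ?G" for A using that box by auto
    have "indicator {} = (\<lambda>_::real^'n. 0::real)" by auto
    then show "approx (indicator {})" by (simp only: approx_const)
    show "approx (indicator (UNIV - A))" if "approx (indicator A)" for A
    proof -
      have "indicator (UNIV - A) = (\<lambda>x. 1 + (- 1) * indicator A x :: real)" by (auto simp: indicator_def)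
      then show ?thesis by (simp only: approx_add[OF approx_const approx_cmult[OF that]])
    qed
    fix F :: "nat \<Rightarrow> (real^'n) set"
    assume F: "disjoint_family F" "\<And>i. approx (indicator (F i))"
    show "approx (indicator (\<Union>i. F i))"
    proof (rule approx_limit[where b = 1])
      have eq: "(\<Sum>i<n. indicator (F i) x) = (indicator (\<Union>i<n. F i) x :: real)" for n x
        using F(1) by (subst indicator_UN_disjoint) (auto simp: disjoint_family_on_def)
      show "approx (indicator (\<Union>i<n. F i))" for n
      proof -
        have "approx (\<lambda>x. \<Sum>i<n. indicator (F i) x)"
        proof (induction n)
          case 0 then show ?case by (simp add: approx_const)
        next
          case (Suc n) then show ?case using approx_add[OF _ F(2)] by simp
        qed
        then show ?thesis by (simp add: eq)
      qed
      show "\<bar>indicator (\<Union>i<n. F i) x :: real\<bar> \<le> 1" for n x by (simp add: indicator_def)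
      show "(\<lambda>n. indicator (\<Union>i<n. F i) x) \<longlonglongrightarrow> (indicator (\<Union>i. F i) x :: real)" for x
        by (rule LIMSEQ_indicator_UN)
    qed
  qed auto
qed

text \<open>Each step of the induction has to inherit \<open>sq u < \<infinity>\<close>: summands
  and monotone approximants are nonnegative and lie below the whole function, which also dominates
  the limit.\<close>

lemma approx_nonneg:
  assumes "u \<in> borel_measurable borel" "\<And>x. 0 \<le> u x" "sq u < \<infinity>"
  shows "approx u"
  using assms
proof (induction u rule: borel_measurable_induct_real)
  case (set A)
  then show ?case by (simp add: approx_indicator)
next
  case (mult u c)
  show ?case
  proof (cases "c = 0")
    case True then show ?thesis by (simp add: approx_const)
  next
    case False
    have [measurable]: "u \<in> borel_measurable borel" by fact
    \<comment> \<open>The hypothesis concerns \<open>c * u\<close>; dividing by \<open>c\<close>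
      transfers finiteness to \<open>u\<close>.\<close>
    have "sq (\<lambda>x. (1 / c) * (c * u x)) \<le> ennreal ((1 / \<bar>c\<bar>)\<^sup>2) * sq (\<lambda>x. c * u x)"
      by (rule sq_mult_bounded) auto
    also have "\<dots> < \<infinity>" using mult.prems by (simp add: ennreal_mult_less_top)
    finally have "sq u < \<infinity>" using False by simp
    then show ?thesis using mult.IH by (intro approx_cmult)
  qed
next
  case (add u v)
  have "sq u \<le> sq (\<lambda>x. v x + u x)" "sq v \<le> sq (\<lambda>x. v x + u x)"
    unfolding sq_def using add.hyps by (auto intro!: nn_integral_mono ennreal_leI power_mono)
  then have "sq u < \<infinity>" "sq v < \<infinity>" using add.prems by auto
  then show ?case using add.IH by (intro approx_add)
next
  case (seq U)
  have le: "U i x \<le> u x" for i x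
    using seq.hyps by (intro LIMSEQ_le_const[OF seq.hyps(4)]) (auto simp: incseq_def le_fun_def intro!: exI[of _ i])
  have "sq (U i) \<le> sq u" for i
    unfolding sq_def using le seq.hyps by (auto intro!: nn_integral_mono ennreal_leI power_mono)
  then have "approx (U i)" for i using seq.IH seq.prems by (meson le_less_trans)
  then show ?case
  proof (rule approx_limit_dominated[where w = "\<lambda>x. ennreal ((u x)\<^sup>2)"])
    show um: "u \<in> borel_measurable borel"
      by (rule borel_measurable_LIMSEQ_metric[OF seq.hyps(1)]) (use seq.hyps(4) in simp)
    then show "(\<lambda>x. ennreal ((u x)\<^sup>2)) \<in> borel_measurable borel" by measurable
    show "(\<integral>\<^sup>+x. ennreal ((u x)\<^sup>2) \<partial>\<mu>) < \<infinity>" using seq.prems by (simp add: sq_def)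
    show "ennreal ((u x - U i x)\<^sup>2) \<le> ennreal ((u x)\<^sup>2)" for i x
      using le[of i x] seq.hyps(2)[of i x] by (intro ennreal_leI power_mono) auto
  qed (use seq.hyps(4) in simp)
qed

lemma trig_sum_dense:
  assumes [measurable]: "f \<in> borel_measurable borel" and "sq f < \<infinity>"
  shows "approx f"
proof -
  have "sq (\<lambda>x. max 0 (f x)) \<le> sq f" "sq (\<lambda>x. max 0 (- f x)) \<le> sq f"
    unfolding sq_def by (auto intro!: nn_integral_mono ennreal_leI simp: max_def)
  then have "approx (\<lambda>x. max 0 (f x))" "approx (\<lambda>x. max 0 (- f x))"
    using assms(2) by (auto intro!: approx_nonneg)
  then have "approx (\<lambda>x. max 0 (f x) + (- 1) * max 0 (- f x))" by (intro approx_add approx_cmult)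
  moreover have "(\<lambda>x. max 0 (f x) + (- 1) * max 0 (- f x)) = f" by (auto simp: max_def)
  ultimately show ?thesis by simp
qed

end

section \<open>Positive semidefinite kernels\<close>

text \<open>Subtracting the rank one form of \<open>S x / sqrt (x \<bullet> S x)\<close> keeps \<open>S\<close> positive semidefinite and
  enlarges its kernel.\<close>

lemma psd_rank_one_decomposition:
  fixes S :: "real^'n::finite^'n"
  assumes "transpose S = S" "\<And>x. 0 \<le> x \<bullet> (S *v x)"
  shows "\<exists>W. \<forall>x y. x \<bullet> (S *v y) = (\<Sum>w\<leftarrow>W. (w \<bullet> x) * (w \<bullet> y))"
  using assms
\<comment> \<open>Induction on the rank of \<open>S\<close>.\<close>
proof (induction "CARD('n) - dim {x. S *v x = 0}" arbitrary: S rule: less_induct)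
  case less
  note sym = inner_symmetric[OF less.prems(1)]
  show ?case
  proof (cases "\<forall>x. x \<bullet> (S *v x) = 0")
    case True
    then have "S *v x = 0" for x using psd_kernel[OF less.prems] by blast
    then show ?thesis by (intro exI[of _ "[]"]) simp
  next
    case False
    then obtain x where x: "0 < x \<bullet> (S *v x)" using less.prems(2) by (metis less_le)
    define c where "c = x \<bullet> (S *v x)"
    define w where "w = (1 / sqrt c) *\<^sub>R (S *v x)"
    define S' where "S' = S - outer w w"
    have w: "w \<bullet> y = (x \<bullet> (S *v y)) / sqrt c" for y
      using sym[of x y] by (simp add: w_def inner_commute)
    have S'v: "S' *v y = S *v y - (w \<bullet> y) *\<^sub>R w" for y
      by (simp add: S'_def matrix_vector_mult_diff_rdistrib outer_vector)
    have S': "y \<bullet> (S' *v z) = y \<bullet> (S *v z) - (w \<bullet> y) * (w \<bullet> z)" for y z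
      by (simp add: S'v inner_diff_right inner_commute)
    have c: "0 < c" using x by (simp add: c_def)
    have 1: "transpose S' = S'"
      using less.prems(1) by (simp add: S'_def outer_def transpose_def vec_eq_iff mult.commute)
    have 2: "0 \<le> y \<bullet> (S' *v y)" for y
    proof -
      define b where "b = x \<bullet> (S *v y)"
      \<comment> \<open>Completing the square: \<open>b / c\<close> minimises the form of
        \<open>S\<close> on the line through \<open>y\<close> in direction \<open>x\<close>, and the
        minimum is the form of \<open>S'\<close> at \<open>y\<close>.\<close>
      have "0 \<le> (y - (b / c) *\<^sub>R x) \<bullet> (S *v (y - (b / c) *\<^sub>R x))" by (rule less.prems(2))
      also have "\<dots> = y \<bullet> (S *v y) - 2 * (b / c) * b + (b / c)\<^sup>2 * c"
        using sym[of x y] by (simp add: matrix_vector_mult_diff_distrib matrix_vector_mult_scaleR inner_diff b_def c_def power2_eq_square algebra_simps)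
      also have "\<dots> = y \<bullet> (S *v y) - b\<^sup>2 / c" using c by (simp add: power2_eq_square field_simps)
      also have "\<dots> = y \<bullet> (S' *v y)" using c by (simp add: S' w b_def power2_eq_square)
      finally show ?thesis .
    qed
    have sub: "{y. S *v y = 0} \<subseteq> {y. S' *v y = 0}" by (auto simp: S'v w)
    have "S' *v x = 0"
    proof -
      have "w \<bullet> x = sqrt c" using c by (simp add: w c_def[symmetric] real_div_sqrt)
      then show ?thesis using c by (simp add: S'v) (simp add: w_def)
    qed
    moreover have "S *v x \<noteq> 0" using x by auto
    ultimately have "{y. S *v y = 0} \<subset> {y. S' *v y = 0}" using sub by blast
    moreover have "subspace {y. S *v y = 0}" "subspace {y. S' *v y = 0}"
      by (rule linear_subspace_kernel, simp)+
    ultimately have lt: "dim {y. S *v y = 0} < dim {y. S' *v y = 0}"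
      using dim_psubset[of "{y. S *v y = 0}" "{y. S' *v y = 0}"] by (simp add: span_eq_iff[THEN iffD2])
    have "dim {y. S' *v y = 0} \<le> CARD('n)" using dim_subset_UNIV[of "{y. S' *v y = 0}"] by simp
    then have "CARD('n) - dim {y. S' *v y = 0} < CARD('n) - dim {y. S *v y = 0}" using lt by linarith
    from less.hyps[OF this 1 2] obtain W where W: "\<And>x y. x \<bullet> (S' *v y) = (\<Sum>w\<leftarrow>W. (w \<bullet> x) * (w \<bullet> y))" by blast
    have "y \<bullet> (S *v z) = (\<Sum>w\<leftarrow>(w # W). (w \<bullet> y) * (w \<bullet> z))" for y z
      using W[of y z] by (simp add: S')
    then show ?thesis by blast
  qed
qed

definition psd_kernel_on :: "'i set \<Rightarrow> ('i \<Rightarrow> 'i \<Rightarrow> real) \<Rightarrow> bool" where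
  "psd_kernel_on J K \<longleftrightarrow> (\<forall>b. 0 \<le> (\<Sum>j\<in>J. \<Sum>k\<in>J. b j * b k * K j k))"

lemma psd_kernel_add:
  "psd_kernel_on J K \<Longrightarrow> psd_kernel_on J L \<Longrightarrow> psd_kernel_on J (\<lambda>j k. K j k + L j k)"
  by (simp add: psd_kernel_on_def distrib_left sum.distrib)

text \<open>The Gram matrix is a sum of rank one kernels, and multiplying \<open>K\<close> by one of
  them merely rescales the coefficients \<open>b\<close>.\<close>

lemma psd_kernel_gram_mult:
  fixes S :: "real^'n::finite^'n"
  assumes S: "transpose S = S" "\<And>x. 0 \<le> x \<bullet> (S *v x)" and K: "psd_kernel_on J K"
  shows "psd_kernel_on J (\<lambda>j k. (x j \<bullet> (S *v x k)) * K j k)"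
  unfolding psd_kernel_on_def
proof
  fix b :: "'a \<Rightarrow> real"
  obtain W where W: "\<And>x y. x \<bullet> (S *v y) = (\<Sum>w\<leftarrow>W. (w \<bullet> x) * (w \<bullet> y))"
    using psd_rank_one_decomposition[OF S] by blast
  have "(\<Sum>j\<in>J. \<Sum>k\<in>J. b j * b k * ((x j \<bullet> (S *v x k)) * K j k)) =
      (\<Sum>w\<leftarrow>W. \<Sum>j\<in>J. \<Sum>k\<in>J. (b j * (w \<bullet> x j)) * (b k * (w \<bullet> x k)) * K j k)"
    unfolding W
  proof (induction W)
    case (Cons w W)
    then show ?case by (simp add: distrib_left distrib_right sum.distrib mult_ac)
  qed simp
  also have "0 \<le> \<dots>"
    using K by (intro sum_list_nonneg) (auto simp: psd_kernel_on_def)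
  finally show "0 \<le> (\<Sum>j\<in>J. \<Sum>k\<in>J. b j * b k * ((x j \<bullet> (S *v x k)) * K j k))" .
qed

text \<open>The Schur product theorem, applied to
  \<open>r G\<^sup>n\<^sup>+\<^sup>1 - H\<^sup>n\<^sup>+\<^sup>1 = G (r G\<^sup>n - H\<^sup>n) + (G - H) H\<^sup>n\<close> entrywise.\<close>

lemma psd_kernel_power_diff:
  fixes S :: "real^'n::finite^'n"
  assumes S: "transpose S = S" "\<And>x. 0 \<le> x \<bullet> (S *v x)"
    and 1: "psd_kernel_on J (\<lambda>j k. r * (x j \<bullet> (S *v x k)) - y j \<bullet> (S *v y k))"
    and 2: "psd_kernel_on J (\<lambda>j k. x j \<bullet> (S *v x k) - y j \<bullet> (S *v y k))"
    and "0 < n"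
  shows "psd_kernel_on J (\<lambda>j k. r * (x j \<bullet> (S *v x k)) ^ n - (y j \<bullet> (S *v y k)) ^ n)"
proof -
  let ?G = "\<lambda>j k. x j \<bullet> (S *v x k)" and ?H = "\<lambda>j k. y j \<bullet> (S *v y k)"
  \<comment> \<open>\<open>?H\<close> is a Gram matrix too, so the Schur product theorem also allows
    multiplication by it.\<close>
  have H: "psd_kernel_on J (\<lambda>j k. ?H j k ^ m * (?G j k - ?H j k))" for m
  proof (induction m)
    case (Suc m)
    from psd_kernel_gram_mult[OF S this, of y] show ?case by (simp add: mult.assoc)
  qed (use 2 in simp)
  have Suc: "psd_kernel_on J (\<lambda>j k. r * ?G j k ^ Suc m - ?H j k ^ Suc m)" for m
  proof (induction m)
    case (Suc m)
    have "r * g ^ Suc (Suc m) - h ^ Suc (Suc m) = g * (r * g ^ Suc m - h ^ Suc m) + h ^ Suc m * (g - h)" for g h :: real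
      by (simp add: algebra_simps)
    from psd_kernel_add[OF psd_kernel_gram_mult[OF S Suc, of x] H[of "Suc m"], folded this]
    show ?case .
  qed (use 1 in simp)
  show ?thesis using Suc[of "n - 1"] \<open>0 < n\<close> by simp
qed

text \<open>The constant coefficient must vanish: at \<open>n = 0\<close> the kernel would be the
  constant \<open>r - 1\<close>, negative for \<open>r < 1\<close>.\<close>

lemma psd_kernel_series:
  fixes G H :: "'i \<Rightarrow> 'i \<Rightarrow> real"
  assumes F: "\<And>x. (\<lambda>n. c n * x ^ n) sums F x" and c: "c 0 = 0" "\<And>n. 0 \<le> c n"
    and psd: "\<And>n. 0 < n \<Longrightarrow> psd_kernel_on J (\<lambda>j k. r * G j k ^ n - H j k ^ n)"
  shows "psd_kernel_on J (\<lambda>j k. r * F (G j k) - F (H j k))"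
  unfolding psd_kernel_on_def
proof
  fix b :: "'i \<Rightarrow> real"
  have sums: "(\<lambda>n. \<Sum>j\<in>J. \<Sum>k\<in>J. b j * b k * (r * (c n * G j k ^ n) - c n * H j k ^ n)) sums
      (\<Sum>j\<in>J. \<Sum>k\<in>J. b j * b k * (r * F (G j k) - F (H j k)))"
    by (intro sums_sum sums_mult sums_diff F)
  have nonneg: "0 \<le> (\<Sum>j\<in>J. \<Sum>k\<in>J. b j * b k * (r * (c n * G j k ^ n) - c n * H j k ^ n))" for n
  proof (cases "n = 0")
    case False
    have "(\<Sum>j\<in>J. \<Sum>k\<in>J. b j * b k * (r * (c n * G j k ^ n) - c n * H j k ^ n)) =
        c n * (\<Sum>j\<in>J. \<Sum>k\<in>J. b j * b k * (r * G j k ^ n - H j k ^ n))"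
      unfolding sum_distrib_left by (intro sum.cong refl) (simp add: algebra_simps)
    then show ?thesis using psd[of n] False c(2)[of n] by (simp add: psd_kernel_on_def)
  qed (simp add: c)
  show "0 \<le> (\<Sum>j\<in>J. \<Sum>k\<in>J. b j * b k * (r * F (G j k) - F (H j k)))"
    by (rule sums_le[OF nonneg sums_zero sums])
qed

lemma cosh_minus_one_sums: "(\<lambda>n. (if n = 0 \<or> odd n then 0 else 1 / fact n) * x ^ n) sums (cosh x - 1)" for x :: real
proof -
  have "(\<lambda>n. (if even n then x ^ n /\<^sub>R fact n else 0) - (if n = 0 then 1 else 0)) sums (cosh x - 1)"
    by (intro sums_diff cosh_converges sums_single)
  then show ?thesis by (rule sums_cong[THEN iffD1, rotated]) (auto simp: divide_inverse)
qed

lemma sinh_sums: "(\<lambda>n. (if even n then 0 else 1 / fact n) * x ^ n) sums sinh x" for x :: real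
  using sinh_converges[of x] by (rule sums_cong[THEN iffD1, rotated]) (auto simp: divide_inverse)

section \<open>Contraction of the variance of trigonometric sums\<close>

context stationary_flow
begin

definition form :: "real^'n \<Rightarrow> real^'n \<Rightarrow> real" where "form \<xi> \<zeta> = \<xi> \<bullet> (S *v \<zeta>)"

lemma S_psd: "0 \<le> x \<bullet> (S *v x)"
  using q_nonneg[of x] by (simp add: q_def)

lemma q_add: "q (\<xi> + \<zeta>) = q \<xi> + q \<zeta> + form \<xi> \<zeta>"
  and q_diff: "q (\<xi> - \<zeta>) = q \<xi> + q \<zeta> - form \<xi> \<zeta>"
  using inner_symmetric[OF S_sym, of \<xi> \<zeta>]
  by (simp_all add: q_def form_def matrix_vector_right_distrib matrix_vector_mult_diff_distrib inner_add inner_diff field_simps)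

lemma q_scaleR: "q (c *\<^sub>R \<xi>) = c\<^sup>2 * q \<xi>"
  by (simp add: q_def matrix_vector_mult_scaleR power2_eq_square)

text \<open>By linearity the double sum collapses to one vector: it equals
  \<open>2 * (r * q z - q (A *v z))\<close> with
  \<open>z = (\<Sum>j\<in>J. b j *\<^sub>R x j)\<close>.\<close>

lemma psd_kernel_contraction:
  assumes "\<And>\<xi>. q (A *v \<xi>) \<le> r * q \<xi>"
  shows "psd_kernel_on J (\<lambda>j k. r * (x j \<bullet> (S *v x k)) - (A *v x j) \<bullet> (S *v (A *v x k)))"
  unfolding psd_kernel_on_def
proof
  fix b
  define z where "z = (\<Sum>j\<in>J. b j *\<^sub>R x j)"
  have q: "(\<Sum>j\<in>J. \<Sum>k\<in>J. b j * b k * (y j \<bullet> (S *v y k))) = 2 * q (\<Sum>j\<in>J. b j *\<^sub>R y j)" for y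
  proof -
    define w where "w = (\<Sum>j\<in>J. b j *\<^sub>R y j)"
    have "2 * q w = w \<bullet> (S *v w)" by (simp add: q_def)
    also have "\<dots> = (\<Sum>j\<in>J. b j * (y j \<bullet> (S *v w)))" by (subst (1) w_def) (simp add: inner_sum_left)
    also have "\<dots> = (\<Sum>j\<in>J. \<Sum>k\<in>J. b j * b k * (y j \<bullet> (S *v y k)))"
      by (simp add: w_def matrix_vector_mult_scaleR inner_sum_right sum_distrib_left mult.assoc
          linear_sum[OF matrix_vector_mul_linear])
    finally show ?thesis by (simp add: w_def)
  qed
  have "(\<Sum>j\<in>J. b j *\<^sub>R (A *v x j)) = A *v z"
    by (simp add: z_def matrix_vector_mult_scaleR linear_sum[OF matrix_vector_mul_linear])
  then have "(\<Sum>j\<in>J. \<Sum>k\<in>J. b j * b k * (r * (x j \<bullet> (S *v x k)) - (A *v x j) \<bullet> (S *v (A *v x k)))) = 2 * (r * q z - q (A *v z))"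
    using q[of x] q[of "\<lambda>j. A *v x j"]
    by (simp add: right_diff_distrib sum_subtractf z_def mult.left_commute[of _ r] flip: sum_distrib_left)
  then show "0 \<le> (\<Sum>j\<in>J. \<Sum>k\<in>J. b j * b k * (r * (x j \<bullet> (S *v x k)) - (A *v x j) \<bullet> (S *v (A *v x k))))"
    using assms[of z] by simp
qed

text \<open>The squared \<open>L2(\<mu>)\<close> norm of a centred sum of waves with frequencies
  \<open>A *v x j\<close>, normalised so that the j-th wave has mean
  \<open>cos (\<theta> j)\<close>; see \<open>variance_identity\<close>. The \<open>- 1\<close>
  beside \<open>cosh\<close> removes the mean.\<close>

definition variance_form :: "real^'n^'n \<Rightarrow> nat \<Rightarrow> (nat \<Rightarrow> real) \<Rightarrow> (nat \<Rightarrow> real^'n) \<Rightarrow> (nat \<Rightarrow> real) \<Rightarrow> real" where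
  "variance_form A n b x \<theta> = (\<Sum>j<n. \<Sum>k<n. b j * b k *
     (cos (\<theta> j) * cos (\<theta> k) * (cosh (form (A *v x j) (A *v x k)) - 1) +
      sin (\<theta> j) * sin (\<theta> k) * sinh (form (A *v x j) (A *v x k))))"

text \<open>The factors \<open>cos (\<theta> j)\<close> and \<open>sin (\<theta> j)\<close> go into
  the coefficients. This leaves two kernels, power series with nonnegative coefficients and no
  constant term in the Gram matrices.\<close>

lemma variance_form_contraction:
  assumes r: "r \<le> 1" and A: "\<And>\<xi>. q (A *v \<xi>) \<le> r * q \<xi>"
  shows "variance_form A n b x \<theta> \<le> r * variance_form (mat 1) n b x \<theta>"
proof -
  \<comment> \<open>Besides \<open>r * G - H\<close>, the Schur argument uses that
    \<open>G - H\<close> is positive semidefinite; this is where \<open>r \<le> 1\<close>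
    enters.\<close>
  have A1: "q (A *v \<xi>) \<le> 1 * q \<xi>" for \<xi>
    using A[of \<xi>] mult_right_mono[OF r q_nonneg[of \<xi>]] by simp
  let ?J = "{..<n}"
  let ?G = "\<lambda>j k. x j \<bullet> (S *v x k)" and ?H = "\<lambda>j k. (A *v x j) \<bullet> (S *v (A *v x k))"
  have pw: "psd_kernel_on ?J (\<lambda>j k. r * ?G j k ^ m - ?H j k ^ m)" if "0 < m" for m
    by (rule psd_kernel_power_diff[OF S_sym S_psd psd_kernel_contraction[OF A] _ that])
      (use psd_kernel_contraction[OF A1, of ?J x] in simp)
  have "psd_kernel_on ?J (\<lambda>j k. r * (cosh (?G j k) - 1) - (cosh (?H j k) - 1))"
    by (rule psd_kernel_series[OF cosh_minus_one_sums _ _ pw]) auto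
  then have 1: "0 \<le> (\<Sum>j<n. \<Sum>k<n. (b j * cos (\<theta> j)) * (b k * cos (\<theta> k)) * (r * (cosh (?G j k) - 1) - (cosh (?H j k) - 1)))"
    unfolding psd_kernel_on_def by (rule spec)
  have "psd_kernel_on ?J (\<lambda>j k. r * sinh (?G j k) - sinh (?H j k))"
    by (rule psd_kernel_series[OF sinh_sums _ _ pw]) auto
  then have 2: "0 \<le> (\<Sum>j<n. \<Sum>k<n. (b j * sin (\<theta> j)) * (b k * sin (\<theta> k)) * (r * sinh (?G j k) - sinh (?H j k)))"
    unfolding psd_kernel_on_def by (rule spec)
  have "r * variance_form (mat 1) n b x \<theta> - variance_form A n b x \<theta> =
    (\<Sum>j<n. \<Sum>k<n. (b j * cos (\<theta> j)) * (b k * cos (\<theta> k)) * (r * (cosh (?G j k) - 1) - (cosh (?H j k) - 1))) +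
    (\<Sum>j<n. \<Sum>k<n. (b j * sin (\<theta> j)) * (b k * sin (\<theta> k)) * (r * sinh (?G j k) - sinh (?H j k)))"
    unfolding variance_form_def form_def sum_distrib_left matrix_vector_mul_lid sum_subtractf[symmetric] sum.distrib[symmetric]
    by (intro sum.cong refl) (simp add: algebra_simps)
  then show ?thesis using 1 2 by linarith
qed

end

section \<open>The deviation norm\<close>

lemma l2_norm_square: "(l2_norm M f)\<^sup>2 = (\<integral>\<^sup>+x. ennreal ((f x)\<^sup>2) \<partial>M)"
proof -
  define I where "I = (\<integral>\<^sup>+x. ennreal ((f x)\<^sup>2) \<partial>M)"
  have "(l2_norm M f)\<^sup>2 = I"
  proof (cases I)
    case (real r)
    then show ?thesis by (simp add: l2_norm_def I_def[symmetric] ennreal_power)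
  next
    case top
    then have "l2_norm M f = \<infinity>" by (simp add: l2_norm_def I_def)
    then show ?thesis using top by (simp add: power2_eq_square ennreal_top_mult)
  qed
  then show ?thesis by (simp add: I_def)
qed

lemma l2_norm_le:
  assumes "(\<integral>\<^sup>+x. ennreal ((f x)\<^sup>2) \<partial>M) \<le> ennreal c" "0 \<le> c"
  shows "l2_norm M f \<le> ennreal (sqrt c)"
proof -
  have "(\<integral>\<^sup>+x. ennreal ((f x)\<^sup>2) \<partial>M) \<noteq> \<infinity>" using assms(1) by (auto simp: top_unique)
  moreover have "enn2real (\<integral>\<^sup>+x. ennreal ((f x)\<^sup>2) \<partial>M) \<le> c" using enn2real_mono[OF assms(1)] assms(2) by simp
  ultimately show ?thesis by (simp add: l2_norm_def ennreal_leI)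
qed

lemma (in prob_space) nn_integral_square_mean:
  fixes h :: "'a \<Rightarrow> real"
  assumes [measurable]: "h \<in> borel_measurable M"
  shows "ennreal ((\<integral>x. h x \<partial>M)\<^sup>2) \<le> (\<integral>\<^sup>+x. ennreal ((h x)\<^sup>2) \<partial>M)"
proof (cases "(\<integral>\<^sup>+x. ennreal ((h x)\<^sup>2) \<partial>M) < \<infinity>")
  case True
  then have sqi: "integrable M (\<lambda>x. (h x)\<^sup>2)" by (intro integrableI_bounded) auto
  have "integrable M h" by (rule square_integrable_imp_integrable[OF _ sqi]) simp
  then have "(\<integral>x. h x \<partial>M)\<^sup>2 \<le> (\<integral>x. (h x)\<^sup>2 \<partial>M)"
    using variance_eq[OF _ sqi] variance_positive[of h] by simp
  then show ?thesis using sqi by (simp add: nn_integral_eq_integral ennreal_leI)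
next
  case False
  then have "(\<integral>\<^sup>+x. ennreal ((h x)\<^sup>2) \<partial>M) = \<top>" by (simp add: not_less top_unique)
  then show ?thesis by simp
qed

lemma le_sinh: "x \<le> sinh x" if "0 \<le> x" for x :: real
proof -
  have "(\<lambda>n. if n = 1 then x else 0) sums x" by (rule sums_single)
  then show ?thesis
    by (rule sums_le[OF _ _ sinh_sums[of x], rotated]) (use that in auto)
qed

locale ou_stationary = ou_process P B D S E + borel_prob \<mu>
  for P :: "real \<Rightarrow> real^'n::finite \<Rightarrow> (real^'n) measure" and B D S E
    and \<mu> :: "(real^'n) measure" +
  assumes invariant: "0 \<le> t \<Longrightarrow> \<mu> \<bind> P t = \<mu>"
    and plane_wave: "(\<integral>y. cos (\<xi> \<bullet> y + \<theta>) \<partial>\<mu>) = exp (- q \<xi>) * cos \<theta>"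
begin

text \<open>Product-to-sum gives the frequencies \<open>\<alpha> - \<beta>\<close> and
  \<open>\<alpha> + \<beta>\<close>; polarising \<open>q\<close> there produces
  \<open>exp (form \<alpha> \<beta>)\<close> and \<open>exp (- form \<alpha> \<beta>)\<close>, which
  recombine into \<open>cosh\<close> and \<open>sinh\<close>.\<close>

lemma cos_product_integral:
  "(\<integral>y. cos (\<alpha> \<bullet> y + \<theta>) * cos (\<beta> \<bullet> y + \<phi>) \<partial>\<mu>) = exp (- q \<alpha>) * exp (- q \<beta>) *
     (cos \<theta> * cos \<phi> * cosh (form \<alpha> \<beta>) + sin \<theta> * sin \<phi> * sinh (form \<alpha> \<beta>))"
proof -
  have i: "integrable \<mu> (\<lambda>y. cos (\<xi> \<bullet> y + \<psi>))" for \<xi> \<psi>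
    by (rule bounded_integral(1)[where b = 1]) (auto simp: measurable_borel)
  have "cos (\<alpha> \<bullet> y + \<theta>) * cos (\<beta> \<bullet> y + \<phi>) =
      (cos ((\<alpha> - \<beta>) \<bullet> y + (\<theta> - \<phi>)) + cos ((\<alpha> + \<beta>) \<bullet> y + (\<theta> + \<phi>))) / 2" for y
  proof -
    have "(\<alpha> - \<beta>) \<bullet> y + (\<theta> - \<phi>) = (\<alpha> \<bullet> y + \<theta>) - (\<beta> \<bullet> y + \<phi>)" "(\<alpha> + \<beta>) \<bullet> y + (\<theta> + \<phi>) = (\<alpha> \<bullet> y + \<theta>) + (\<beta> \<bullet> y + \<phi>)"
      by (simp_all add: inner_diff_left inner_add_left)
    then show ?thesis by (simp only: cos_times_cos)
  qed
  then have "(\<integral>y. cos (\<alpha> \<bullet> y + \<theta>) * cos (\<beta> \<bullet> y + \<phi>) \<partial>\<mu>) =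
      (\<integral>y. (cos ((\<alpha> - \<beta>) \<bullet> y + (\<theta> - \<phi>)) + cos ((\<alpha> + \<beta>) \<bullet> y + (\<theta> + \<phi>))) / 2 \<partial>\<mu>)"
    by (simp only:)
  also have "\<dots> = (exp (- q (\<alpha> - \<beta>)) * cos (\<theta> - \<phi>) + exp (- q (\<alpha> + \<beta>)) * cos (\<theta> + \<phi>)) / 2"
    using i by (simp add: plane_wave)
  also have "exp (- q (\<alpha> - \<beta>)) = exp (- q \<alpha>) * exp (- q \<beta>) * exp (form \<alpha> \<beta>)"
    by (simp add: q_diff flip: exp_add)
  also have "exp (- q (\<alpha> + \<beta>)) = exp (- q \<alpha>) * exp (- q \<beta>) * exp (- form \<alpha> \<beta>)"
    by (simp add: q_add flip: exp_add)
  finally show ?thesis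
    by (simp add: cosh_def sinh_def cos_diff cos_add field_simps)
qed

text \<open>The weight \<open>exp (q (A *v x j))\<close> gives the j-th wave the mean
  \<open>cos (\<theta> j)\<close> and cancels all Gaussian factors in the second moments.\<close>

lemma variance_identity:
  "(\<integral>y. ((\<Sum>j<n. b j * (exp (q (A *v x j)) * cos ((A *v x j) \<bullet> y + \<theta> j) - cos (\<theta> j))))\<^sup>2 \<partial>\<mu>) = variance_form A n b x \<theta>"
proof -
  define u where "u j y = exp (q (A *v x j)) * cos ((A *v x j) \<bullet> y + \<theta> j) - cos (\<theta> j)" for j y
  define C where "C j k y = cos ((A *v x j) \<bullet> y + \<theta> j) * cos ((A *v x k) \<bullet> y + \<theta> k)" for j k y
  have i1: "integrable \<mu> (\<lambda>y. cos (\<xi> \<bullet> y + \<psi>))" for \<xi> \<psi>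
    by (rule bounded_integral(1)[where b = 1]) (auto simp: measurable_borel)
  have i2: "integrable \<mu> (C j k)" for j k
  proof (rule bounded_integral(1)[where b = 1])
    show "\<bar>C j k y\<bar> \<le> 1" for y
      unfolding C_def abs_mult by (intro mult_le_one) auto
    show "C j k \<in> borel_measurable \<mu>" unfolding C_def[abs_def] measurable_borel by measurable
  qed
  have uu: "u j y * u k y = exp (q (A *v x j)) * exp (q (A *v x k)) * C j k y
      - cos (\<theta> k) * exp (q (A *v x j)) * cos ((A *v x j) \<bullet> y + \<theta> j)
      - cos (\<theta> j) * exp (q (A *v x k)) * cos ((A *v x k) \<bullet> y + \<theta> k) + cos (\<theta> j) * cos (\<theta> k)" for j k y
    by (simp add: u_def C_def algebra_simps)
  have iu: "integrable \<mu> (\<lambda>y. u j y * u k y)" for j k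
    unfolding uu using i1 i2 by simp
  have "(\<integral>y. u j y * u k y \<partial>\<mu>) =
      cos (\<theta> j) * cos (\<theta> k) * (cosh (form (A *v x j) (A *v x k)) - 1) +
      sin (\<theta> j) * sin (\<theta> k) * sinh (form (A *v x j) (A *v x k))" for j k
  proof -
    have "(\<integral>y. u j y * u k y \<partial>\<mu>) = exp (q (A *v x j)) * exp (q (A *v x k)) * (\<integral>y. C j k y \<partial>\<mu>)
      - cos (\<theta> k) * exp (q (A *v x j)) * (\<integral>y. cos ((A *v x j) \<bullet> y + \<theta> j) \<partial>\<mu>)
      - cos (\<theta> j) * exp (q (A *v x k)) * (\<integral>y. cos ((A *v x k) \<bullet> y + \<theta> k) \<partial>\<mu>) + cos (\<theta> j) * cos (\<theta> k)"
      unfolding uu using i1 i2 by (simp add: prob_space)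
    also have "(\<integral>y. C j k y \<partial>\<mu>) = exp (- q (A *v x j)) * exp (- q (A *v x k)) *
      (cos (\<theta> j) * cos (\<theta> k) * cosh (form (A *v x j) (A *v x k)) + sin (\<theta> j) * sin (\<theta> k) * sinh (form (A *v x j) (A *v x k)))"
      unfolding C_def by (rule cos_product_integral)
    finally have eq: "(\<integral>y. u j y * u k y \<partial>\<mu>) = exp (q (A *v x j)) * exp (q (A *v x k)) *
      (exp (- q (A *v x j)) * exp (- q (A *v x k)) * (cos (\<theta> j) * cos (\<theta> k) * cosh (form (A *v x j) (A *v x k)) + sin (\<theta> j) * sin (\<theta> k) * sinh (form (A *v x j) (A *v x k))))
      - cos (\<theta> k) * exp (q (A *v x j)) * (exp (- q (A *v x j)) * cos (\<theta> j))
      - cos (\<theta> j) * exp (q (A *v x k)) * (exp (- q (A *v x k)) * cos (\<theta> k)) + cos (\<theta> j) * cos (\<theta> k)"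
      unfolding plane_wave .
    \<comment> \<open>The exponentials as abstract numbers: \<open>c\<close> and \<open>d\<close>
      stand for \<open>exp (q _)\<close>, and \<open>c'\<close> and \<open>d'\<close> for their
      inverses.\<close>
    have cancel: "c * d * (c' * d' * Z) - m * c * (c' * l) - l * d * (d' * m) + l * m = Z - l * m"
      if "c * c' = 1" "d * d' = 1" for c d c' d' Z l m :: real
    proof -
      have e: "c * d * (c' * d' * Z) = (c * c') * (d * d') * Z" "m * c * (c' * l) = (c * c') * (l * m)"
        "l * d * (d' * m) = (d * d') * (l * m)" by (simp_all only: mult_ac)
      show ?thesis unfolding e that by simp
    qed
    show ?thesis
      unfolding eq by (subst cancel) (simp_all add: algebra_simps flip: exp_add)
  qed
  moreover have "(\<Sum>j<n. b j * u j y)\<^sup>2 = (\<Sum>j<n. \<Sum>k<n. b j * b k * (u j y * u k y))" for y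
    by (simp add: power2_eq_square sum_product mult_ac)
  ultimately show ?thesis using iu
    unfolding u_def[symmetric] by (simp add: variance_form_def)
qed

abbreviation "amp l j \<equiv> fst (l ! j)"
abbreviation "freq l j \<equiv> fst (snd (l ! j))"
abbreviation "phase l j \<equiv> snd (snd (l ! j))"

lemma trig_sum_nth:
  "trig_sum l y = (\<Sum>j<length l. amp l j * cos (freq l j \<bullet> y + phase l j))"
  by (simp add: trig_sum_def sum_list_sum_nth atLeast0LessThan split_def)

text \<open>After \<open>exp (- q (freq l j))\<close> is pulled out, the coefficients no longer
  depend on \<open>t\<close>: time acts only by moving the frequencies, so different times can be
  compared with the same coefficients.\<close>

lemma trig_semigroup:
  assumes t: "0 \<le> t"
  shows "semigroup_op P t (trig_sum l) y - (\<integral>y. trig_sum l y \<partial>\<mu>) =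
    (\<Sum>j<length l. amp l j * exp (- q (freq l j)) *
       (exp (q (E t *v freq l j)) * cos ((E t *v freq l j) \<bullet> y + phase l j) - cos (phase l j)))"
proof -
  have i: "integrable (P t y) (\<lambda>y. cos (\<xi> \<bullet> y + \<psi>))" for \<xi> \<psi>
    by (rule kernel_bounded_integral(1)[OF t, where b = 1]) auto
  have i': "integrable \<mu> (\<lambda>y. cos (\<xi> \<bullet> y + \<psi>))" for \<xi> \<psi>
    by (rule bounded_integral(1)[where b = 1]) (auto simp: measurable_borel)
  have "semigroup_op P t (trig_sum l) y =
      (\<Sum>j<length l. amp l j * semigroup_op P t (\<lambda>y. cos (freq l j \<bullet> y + phase l j)) y)"
    unfolding semigroup_op_def trig_sum_nth using i by simp
  also have "\<dots> = (\<Sum>j<length l. amp l j * (exp (- (q (freq l j) - q (E t *v freq l j))) *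
      cos ((E t *v freq l j) \<bullet> y + phase l j)))"
    unfolding semigroup_plane_wave[OF t] ..
  finally have "semigroup_op P t (trig_sum l) y = \<dots>" .
  moreover have "(\<integral>y. trig_sum l y \<partial>\<mu>) = (\<Sum>j<length l. amp l j * (exp (- q (freq l j)) * cos (phase l j)))"
    unfolding trig_sum_nth using i' by (simp add: plane_wave)
  moreover have "exp (- (q \<xi> - q \<zeta>)) = exp (- q \<xi>) * exp (q \<zeta>)" for \<xi> \<zeta> by (simp flip: exp_add)
  ultimately show ?thesis
    by (simp only: sum_subtractf[symmetric] right_diff_distrib mult.assoc)
qed

lemma bounded_square_integral:
  assumes "f \<in> borel_measurable borel" "\<And>x. \<bar>f x\<bar> \<le> b"
  shows "integrable \<mu> (\<lambda>x. (f x)\<^sup>2)" "sq f = ennreal (\<integral>x. (f x)\<^sup>2 \<partial>\<mu>)"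
proof -
  have "\<bar>(f x)\<^sup>2\<bar> \<le> b\<^sup>2" for x
    using assms(2)[of x] power_mono[of "\<bar>f x\<bar>" b 2] by simp
  then show "integrable \<mu> (\<lambda>x. (f x)\<^sup>2)"
    using assms(1) by (intro bounded_integral(1)) (auto simp: measurable_borel)
  then show "sq f = ennreal (\<integral>x. (f x)\<^sup>2 \<partial>\<mu>)" by (simp add: sq_def nn_integral_eq_integral)
qed

lemma trig_deviation_variance:
  assumes t: "0 \<le> t"
  defines "a \<equiv> \<lambda>l j. amp l j * exp (- q (freq l j))"
  shows "sq (\<lambda>y. semigroup_op P t (trig_sum l) y - (\<integral>y. trig_sum l y \<partial>\<mu>)) =
    ennreal (variance_form (E t) (length l) (a l) (freq l) (phase l))"
proof -
  obtain b where b: "\<And>x. \<bar>trig_sum l x\<bar> \<le> b" using trig_sum_bounded by blast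
  have "\<bar>semigroup_op P t (trig_sum l) y - (\<integral>y. trig_sum l y \<partial>\<mu>)\<bar> \<le> b + \<bar>\<integral>y. trig_sum l y \<partial>\<mu>\<bar>" for y
    using kernel_bounded_integral(2)[OF t trig_sum_borel b, of y] unfolding semigroup_op_def by linarith
  from bounded_square_integral(2)[OF _ this] semigroup_op_measurable[OF t trig_sum_borel[of l]]
  have "sq (\<lambda>y. semigroup_op P t (trig_sum l) y - (\<integral>y. trig_sum l y \<partial>\<mu>)) =
      ennreal (\<integral>y. (semigroup_op P t (trig_sum l) y - (\<integral>y. trig_sum l y \<partial>\<mu>))\<^sup>2 \<partial>\<mu>)" by simp
  then show ?thesis unfolding trig_semigroup[OF t] variance_identity a_def .
qed

lemma semigroup_zero: "f \<in> borel_measurable borel \<Longrightarrow> semigroup_op P 0 f y = f y"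
  using semigroup by (simp add: semigroup_op_def markov_semigroup_def integral_return)

text \<open>At time 0 the variance formula has the identity in place of \<open>E t\<close> and the
  same coefficients, so contraction of the forms applies; the variance of the sum is at most its
  second moment.\<close>

lemma trig_contraction:
  assumes t: "0 \<le> t" and r: "0 \<le> r" "r \<le> 1" "\<And>\<xi>. q (E t *v \<xi>) \<le> r * q \<xi>"
  shows "sq (\<lambda>y. semigroup_op P t (trig_sum l) y - (\<integral>y. trig_sum l y \<partial>\<mu>)) \<le> ennreal r * sq (trig_sum l)"
proof -
  let ?m = "\<integral>y. trig_sum l y \<partial>\<mu>"
  obtain b where b: "\<And>x. \<bar>trig_sum l x\<bar> \<le> b" using trig_sum_bounded by blast
  have i: "integrable \<mu> (trig_sum l)" using bounded_integral(1)[of "trig_sum l" b] b by (simp add: measurable_borel)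
  have i2: "integrable \<mu> (\<lambda>y. (trig_sum l y)\<^sup>2)" by (rule bounded_square_integral(1)[OF trig_sum_borel b])
  have "sq (\<lambda>y. trig_sum l y - ?m) \<le> sq (trig_sum l)"
  proof -
    have "\<bar>trig_sum l y - ?m\<bar> \<le> b + \<bar>?m\<bar>" for y using b[of y] by linarith
    from bounded_square_integral(2)[OF _ this]
    have "sq (\<lambda>y. trig_sum l y - ?m) = ennreal (\<integral>y. (trig_sum l y - ?m)\<^sup>2 \<partial>\<mu>)" by simp
    also have "\<dots> \<le> ennreal (\<integral>y. (trig_sum l y)\<^sup>2 \<partial>\<mu>)"
      using variance_eq[OF i i2] by (intro ennreal_leI) simp
    finally show ?thesis by (simp add: bounded_square_integral(2)[OF trig_sum_borel b])
  qed
  then have "ennreal r * sq (\<lambda>y. trig_sum l y - ?m) \<le> ennreal r * sq (trig_sum l)" by (rule mult_left_mono) simp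
  moreover have "sq (\<lambda>y. semigroup_op P t (trig_sum l) y - ?m) \<le> ennreal r * sq (\<lambda>y. trig_sum l y - ?m)"
    using trig_deviation_variance[of 0 l] r
    by (simp add: trig_deviation_variance[OF t] semigroup_zero flow_0 variance_form_contraction[OF r(2,3)]
        ennreal_leI flip: ennreal_mult')
  ultimately show ?thesis by (rule order_trans[rotated])
qed

text \<open>Jensen for each kernel, followed by invariance.\<close>

lemma semigroup_sq_le:
  assumes t: "0 \<le> t" and [measurable]: "h \<in> borel_measurable borel"
  shows "sq (semigroup_op P t h) \<le> sq h"
proof -
  have "sq (semigroup_op P t h) \<le> (\<integral>\<^sup>+x. \<integral>\<^sup>+y. ennreal ((h y)\<^sup>2) \<partial>P t x \<partial>\<mu>)"
    unfolding sq_def semigroup_op_def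
    by (intro nn_integral_mono prob_space.nn_integral_square_mean[OF prob_kernel[OF t]]) (simp add: measurable_kernel[OF t])
  also have "\<dots> = (\<integral>\<^sup>+y. ennreal ((h y)\<^sup>2) \<partial>(\<mu> \<bind> P t))"
    by (rule nn_integral_bind[symmetric, where B = borel]) (use kernel_measurable[OF t] in \<open>auto simp: measurable_borel\<close>)
  finally show ?thesis by (simp add: invariant[OF t] sq_def)
qed

text \<open>Where \<open>f\<close> is not integrable, the Bochner integral takes its default value 0
  and additivity can fail; invariance makes these points negligible, so
  \<open>deviation_upper\<close> may split \<open>f\<close>.\<close>

lemma semigroup_integrable_AE:
  assumes t: "0 \<le> t" and [measurable]: "f \<in> borel_measurable borel" and fin: "sq f < \<infinity>"
  shows "AE x in \<mu>. integrable (P t x) f"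
proof -
  have k [measurable]: "P t \<in> \<mu> \<rightarrow>\<^sub>M subprob_algebra borel" using kernel_measurable[OF t] by (simp add: measurable_borel)
  have "(\<integral>\<^sup>+x. \<integral>\<^sup>+y. ennreal ((f y)\<^sup>2) \<partial>P t x \<partial>\<mu>) = (\<integral>\<^sup>+y. ennreal ((f y)\<^sup>2) \<partial>(\<mu> \<bind> P t))"
    by (rule nn_integral_bind[symmetric, where B = borel]) (auto simp: k)
  also have "\<dots> \<noteq> \<infinity>" using fin by (simp add: invariant[OF t] sq_def)
  finally have fin': "(\<integral>\<^sup>+x. \<integral>\<^sup>+y. ennreal ((f y)\<^sup>2) \<partial>P t x \<partial>\<mu>) \<noteq> \<infinity>" .
  have "(\<lambda>M. \<integral>\<^sup>+y. ennreal ((f y)\<^sup>2) \<partial>M) \<in> borel_measurable (subprob_algebra borel)"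
    by (rule nn_integral_measurable_subprob_algebra) simp
  from measurable_compose[OF k this]
  have "AE x in \<mu>. (\<integral>\<^sup>+y. ennreal ((f y)\<^sup>2) \<partial>P t x) \<noteq> \<infinity>"
    using fin' by (rule nn_integral_PInf_AE)
  then show ?thesis
  proof eventually_elim
    fix x assume "(\<integral>\<^sup>+y. ennreal ((f y)\<^sup>2) \<partial>P t x) \<noteq> \<infinity>"
    then have "integrable (P t x) (\<lambda>y. (f y)\<^sup>2)"
      by (intro integrableI_bounded) (auto simp: measurable_kernel[OF t] less_top)
    then show "integrable (P t x) f"
      by (rule finite_measure.square_integrable_imp_integrable[OF prob_space.finite_measure[OF prob_kernel[OF t]], rotated])
        (simp add: measurable_kernel[OF t])
  qed
qed

text \<open>The factor 4 comes from two uses of the inequality with constant 2: splitting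
  \<open>f\<close> into a trigonometric sum and a small remainder, and bounding the square of that
  sum by that of \<open>f\<close>.\<close>

lemma deviation_upper:
  assumes t: "0 \<le> t" and r: "0 \<le> r" "r \<le> 1" "\<And>\<xi>. q (E t *v \<xi>) \<le> r * q \<xi>"
    and f [measurable]: "f \<in> borel_measurable borel" and f1: "sq f = 1"
  shows "sq (\<lambda>x. semigroup_op P t f x - (\<integral>y. f y \<partial>\<mu>)) \<le> ennreal (4 * r)"
proof (rule ennreal_le_epsilon)
  fix e :: real assume e: "0 < e"
  \<comment> \<open>The errors add up to \<open>8 * d + 4 * (r * d)\<close>, at most
    \<open>12 * d\<close>.\<close>
  define d where "d = e / 12"
  have d: "0 < d" using e by (simp add: d_def)
  have "approx f" by (rule trig_sum_dense) (simp_all add: f1)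
  then obtain l where l: "sq (\<lambda>x. f x - trig_sum l x) < ennreal d" using d by (auto simp: approx_def)
  define h where "h x = f x - trig_sum l x" for x
  have h [measurable]: "h \<in> borel_measurable borel" unfolding h_def by measurable
  have hd: "sq h \<le> ennreal d" using l by (simp add: h_def[abs_def])
  obtain b where b: "\<And>x. \<bar>trig_sum l x\<bar> \<le> b" using trig_sum_bounded by blast
  let ?g = "\<lambda>x. semigroup_op P t (trig_sum l) x - (\<integral>y. trig_sum l y \<partial>\<mu>)"
  let ?h = "\<lambda>x. semigroup_op P t h x + - (\<integral>y. h y \<partial>\<mu>)"
  have mf: "\<And>u. u \<in> borel_measurable borel \<Longrightarrow> u \<in> borel_measurable \<mu>" by (simp add: measurable_borel)
  have if\<mu>: "integrable \<mu> f"
  proof (rule square_integrable_imp_integrable)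
    show "integrable \<mu> (\<lambda>x. (f x)\<^sup>2)"
      by (rule integrableI_bounded) (use f1 in \<open>simp_all add: mf sq_def\<close>)
  qed (simp add: mf)
  have it\<mu>: "integrable \<mu> (trig_sum l)" using bounded_integral(1)[OF mf[OF trig_sum_borel] b] .
  have "sq f < \<infinity>" using f1 by simp
  from semigroup_integrable_AE[OF t f this]
  have "AE x in \<mu>. semigroup_op P t f x - (\<integral>y. f y \<partial>\<mu>) = ?h x + ?g x"
  proof eventually_elim
    fix x assume "integrable (P t x) f"
    then show "semigroup_op P t f x - (\<integral>y. f y \<partial>\<mu>) =
        semigroup_op P t h x + - (\<integral>y. h y \<partial>\<mu>) + (semigroup_op P t (trig_sum l) x - (\<integral>y. trig_sum l y \<partial>\<mu>))"
      using if\<mu> it\<mu> kernel_bounded_integral(1)[OF t trig_sum_borel b, of x]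
      by (simp add: semigroup_op_def h_def[abs_def])
  qed
  then have "sq (\<lambda>x. semigroup_op P t f x - (\<integral>y. f y \<partial>\<mu>)) = sq (\<lambda>x. ?h x + ?g x)"
    unfolding sq_def by (intro nn_integral_cong_AE) auto
  also have "\<dots> \<le> 2 * sq ?h + 2 * sq ?g"
    by (rule sq_add) (use semigroup_op_measurable[OF t h] semigroup_op_measurable[OF t trig_sum_borel] in simp_all)
  also have "sq ?h \<le> 2 * sq (semigroup_op P t h) + 2 * sq (\<lambda>_. - (\<integral>y. h y \<partial>\<mu>))"
    by (rule sq_add) (use semigroup_op_measurable[OF t h] in simp_all)
  also have "sq (\<lambda>_. - (\<integral>y. h y \<partial>\<mu>)) \<le> ennreal d"
    using nn_integral_square_mean[OF mf[OF h]] hd by (simp add: sq_def emeasure_space_1)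
  also have "sq (semigroup_op P t h) \<le> ennreal d" using semigroup_sq_le[OF t h] hd by (rule order_trans)
  also have "sq ?g \<le> ennreal r * sq (trig_sum l)" by (rule trig_contraction[OF t r])
  also have "sq (trig_sum l) \<le> 2 * 1 + 2 * ennreal d"
  proof -
    have "sq (trig_sum l) = sq (\<lambda>x. f x + - h x)" by (simp add: h_def)
    also have "\<dots> \<le> 2 * sq f + 2 * sq (\<lambda>x. - h x)" by (rule sq_add) simp_all
    also have "sq (\<lambda>x. - h x) = sq h" by (simp add: sq_def)
    finally show ?thesis using hd f1 by (metis add_left_mono mult_left_mono order_trans zero_le)
  qed
  finally have "sq (\<lambda>x. semigroup_op P t f x - (\<integral>y. f y \<partial>\<mu>)) \<le>
      2 * (2 * ennreal d + 2 * ennreal d) + 2 * (ennreal r * (2 * 1 + 2 * ennreal d))"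
    by (simp add: mult_left_mono add_mono)
  also have "\<dots> = ennreal (2 * (2 * d + 2 * d) + 2 * (r * (2 * 1 + 2 * d)))"
    using d r by (simp flip: ennreal_plus ennreal_mult ennreal_numeral ennreal_1)
  also have "\<dots> \<le> ennreal (4 * r + e)"
  proof (rule ennreal_leI)
    have "r * d \<le> 1 * d" using d r by (intro mult_right_mono) auto
    moreover have "2 * (2 * d + 2 * d) + 2 * (r * (2 * 1 + 2 * d)) = 8 * d + 4 * r + 4 * (r * d)"
      by (simp add: algebra_simps)
    moreover have "e = 12 * d" by (simp add: d_def)
    ultimately show "2 * (2 * d + 2 * d) + 2 * (r * (2 * 1 + 2 * d)) \<le> 4 * r + e" by linarith
  qed
  finally show "sq (\<lambda>x. semigroup_op P t f x - (\<integral>y. f y \<partial>\<mu>)) \<le> ennreal (4 * r) + ennreal e"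
    using e r by (simp add: ennreal_plus)
qed

text \<open>The test function is a multiple of \<open>sin (\<xi> \<bullet> x)\<close>: it has mean
  0, and its evolved variance is proportional to \<open>sinh (2 * q (E t *v \<xi>))\<close>, which
  \<open>le_sinh\<close> bounds below linearly. The \<open>cosh\<close> terms of a cosine would only
  be of second order.\<close>

lemma deviation_lower:
  assumes t: "0 \<le> t" and \<xi>: "q \<xi> = 1"
  shows "\<exists>f\<in>borel_measurable borel. sq f = 1 \<and>
    ennreal (2 * q (E t *v \<xi>) / sinh 2) \<le> sq (\<lambda>x. semigroup_op P t f x - (\<integral>y. f y \<partial>\<mu>))"
proof -
  have sh: "0 < sinh (2::real)" by simp
  \<comment> \<open>With \<open>q \<xi> = 1\<close> the variance at time 0 is
    \<open>b\<^sup>2 * sinh 2\<close>, so this \<open>b\<close> normalises it to 1.\<close>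
  define b where "b = 1 / sqrt (sinh (2::real))"
  have b: "b * b = 1 / sinh 2" using sh by (simp add: b_def)
  define l where "l = [(b * exp (q \<xi>), \<xi>, - pi / 2)]"
  have form: "form \<zeta> \<zeta> = 2 * q \<zeta>" for \<zeta> by (simp add: form_def q_def)
  have var: "sq (\<lambda>y. semigroup_op P s (trig_sum l) y - (\<integral>y. trig_sum l y \<partial>\<mu>)) =
      ennreal (sinh (2 * q (E s *v \<xi>)) / sinh 2)" if "0 \<le> s" for s
    using b by (subst trig_deviation_variance[OF that]) (simp add: l_def variance_form_def form exp_minus mult_ac)
  have "(\<integral>y. trig_sum l y \<partial>\<mu>) = 0"
    using plane_wave[of \<xi> "- pi / 2"] by (simp add: l_def)
  then have "sq (trig_sum l) = 1"
    using var[of 0] \<xi> sh by (simp add: semigroup_zero flow_0)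
  moreover have "ennreal (2 * q (E t *v \<xi>) / sinh 2) \<le> sq (\<lambda>x. semigroup_op P t (trig_sum l) x - (\<integral>y. trig_sum l y \<partial>\<mu>))"
    unfolding var[OF t] using le_sinh[of "2 * q (E t *v \<xi>)"] q_nonneg[of "E t *v \<xi>"] sh
    by (intro ennreal_leI divide_right_mono) auto
  ultimately show ?thesis using trig_sum_borel by blast
qed

lemma deviation_norm_upper:
  assumes t: "0 \<le> t" and r: "0 \<le> r" "r \<le> 1" "\<And>\<xi>. q (E t *v \<xi>) \<le> r * q \<xi>"
  shows "(deviation_norm P \<mu> t)\<^sup>2 \<le> ennreal (4 * r)"
proof -
  have "deviation_norm P \<mu> t \<le> ennreal (sqrt (4 * r))"
    unfolding deviation_norm_def
  proof (rule SUP_least)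
    fix f assume "f \<in> {f \<in> borel_measurable borel. l2_norm \<mu> f = 1}"
    then have f: "f \<in> borel_measurable borel" "sq f = 1"
      using l2_norm_square[of \<mu> f] by (auto simp: sq_def)
    from deviation_upper[OF t r f]
    show "l2_norm \<mu> (\<lambda>x. semigroup_op P t f x - (\<integral>y. f y \<partial>\<mu>)) \<le> ennreal (sqrt (4 * r))"
      using r by (intro l2_norm_le) (auto simp: sq_def)
  qed
  then have "(deviation_norm P \<mu> t)\<^sup>2 \<le> (ennreal (sqrt (4 * r)))\<^sup>2" by (rule power_mono) simp
  then show ?thesis using r by (simp add: ennreal_power)
qed

lemma deviation_norm_lower:
  assumes t: "0 \<le> t" and \<xi>: "q \<xi> = 1"
  shows "ennreal (2 * q (E t *v \<xi>) / sinh 2) \<le> (deviation_norm P \<mu> t)\<^sup>2"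
proof -
  obtain f where f: "f \<in> borel_measurable borel" "sq f = 1"
    "ennreal (2 * q (E t *v \<xi>) / sinh 2) \<le> sq (\<lambda>x. semigroup_op P t f x - (\<integral>y. f y \<partial>\<mu>))"
    using deviation_lower[OF assms] by blast
  have "l2_norm \<mu> f = 1" using f(2) by (simp add: l2_norm_def sq_def)
  then have "l2_norm \<mu> (\<lambda>x. semigroup_op P t f x - (\<integral>y. f y \<partial>\<mu>)) \<le> deviation_norm P \<mu> t"
    unfolding deviation_norm_def using f(1) by (intro SUP_upper) simp
  then have "(l2_norm \<mu> (\<lambda>x. semigroup_op P t f x - (\<integral>y. f y \<partial>\<mu>)))\<^sup>2 \<le> (deviation_norm P \<mu> t)\<^sup>2"
    by (rule power_mono) simp
  then show ?thesis using f(3) by (simp add: l2_norm_square sq_def)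
qed

end

section \<open>Sharp rate\<close>

text \<open>Compactness of the unit sphere and homogeneity of degree 2.\<close>

lemma (in stationary_flow) q_equivalent_norm:
  assumes pos: "\<And>\<xi>. \<xi> \<noteq> 0 \<Longrightarrow> 0 < q \<xi>"
  obtains m M where "0 < m" "0 < M" "\<And>\<xi>. m * (norm \<xi>)\<^sup>2 \<le> q \<xi>" "\<And>\<xi>. q \<xi> \<le> M * (norm \<xi>)\<^sup>2"
proof -
  let ?K = "sphere (0::real^'n) 1"
  have cont: "continuous_on ?K q"
    unfolding q_def by (intro continuous_intros linear_continuous_on[OF matrix_vector_mul_bounded_linear]) simp
  have ne: "?K \<noteq> {}" by simp
  obtain a where a: "a \<in> ?K" "\<And>\<xi>. \<xi> \<in> ?K \<Longrightarrow> q a \<le> q \<xi>"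
    using continuous_attains_inf[OF compact_sphere ne cont] by blast
  obtain b where b: "b \<in> ?K" "\<And>\<xi>. \<xi> \<in> ?K \<Longrightarrow> q \<xi> \<le> q b"
    using continuous_attains_sup[OF compact_sphere ne cont] by blast
  have unit: "\<xi> /\<^sub>R norm \<xi> \<in> ?K" and eq: "q \<xi> = q (\<xi> /\<^sub>R norm \<xi>) * (norm \<xi>)\<^sup>2" if "\<xi> \<noteq> 0" for \<xi>
    using that by (auto simp: q_scaleR power_inverse)
  have "q a * (norm \<xi>)\<^sup>2 \<le> q \<xi> \<and> q \<xi> \<le> q b * (norm \<xi>)\<^sup>2" for \<xi>
  proof (cases "\<xi> = 0")
    case False
    then show ?thesis
      using a(2)[OF unit] b(2)[OF unit] by (subst (2 3) eq) (auto intro: mult_right_mono)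
  qed (simp add: q_zero)
  moreover have "0 < q a" "0 < q b" using a(1) b(1) by (auto intro!: pos)
  ultimately show ?thesis using that by blast
qed

lemma one_plus_power_square:
  fixes t :: real assumes "0 \<le> t"
  shows "1 + t ^ (2 * k) \<le> (1 + t ^ k)\<^sup>2" "(1 + t ^ k)\<^sup>2 \<le> 2 * (1 + t ^ (2 * k))"
proof -
  have e: "t ^ (2 * k) = (t ^ k)\<^sup>2" by (simp add: power_even_eq)
  show "1 + t ^ (2 * k) \<le> (1 + t ^ k)\<^sup>2" using assms by (simp add: e power2_sum)
  show "(1 + t ^ k)\<^sup>2 \<le> 2 * (1 + t ^ (2 * k))" using sum_squares_bound[of 1 "t ^ k"] by (simp add: e power2_sum)
qed

lemma flow_rate_square:
  fixes B :: "real^'n::finite^'n" and t :: real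
  assumes "0 \<le> t"
  defines "g \<equiv> (1 + t ^ (2 * (max_jordan_block B - 1))) * exp (- 2 * least_real_part B * t)"
  shows "g \<le> (flow_rate B t)\<^sup>2" "(flow_rate B t)\<^sup>2 \<le> 2 * g"
proof -
  have e: "(exp (- least_real_part B * t))\<^sup>2 = exp (- 2 * least_real_part B * t)" by (simp add: exp_double[symmetric])
  show "g \<le> (flow_rate B t)\<^sup>2" "(flow_rate B t)\<^sup>2 \<le> 2 * g"
    unfolding g_def flow_rate_def power_mult_distrib e mult.assoc[symmetric]
    using one_plus_power_square[OF assms(1)] by (intro mult_right_mono; simp)+
qed

theorem proposition13:
  fixes B D :: "real^'n::finite^'n"
    and P :: "real \<Rightarrow> real^'n \<Rightarrow> (real^'n) measure"
    and \<mu> :: "(real^'n) measure"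
    and \<rho> :: real
    and N :: nat
  assumes D_sym: "transpose D = D"
    and D_psd: "\<forall>x. 0 \<le> x \<bullet> (D *v x)"
    and P_semigroup: "markov_semigroup P"
    and P_generator: "has_generator P (ou_generator B D)"
    and ker_D: "\<not> (\<exists>V. subspace V \<and> V \<noteq> {0} \<and> V \<subseteq> {x. D *v x = 0} \<and>
                      (\<lambda>v. transpose B *v v) ` V \<subseteq> V)"
    and rho_def: "\<rho> = least_real_part B"
    and rho_pos: "\<rho> > 0"
    and N_def: "N = max_jordan_block B"
    and mu_invariant: "invariant_measure P \<mu>"
  shows "\<exists>c>0. \<forall>t\<ge>0.
           ennreal (1 / c * (1 + t ^ (2 * (N - 1))) * exp (- 2 * \<rho> * t)) \<le> (deviation_norm P \<mu> t)\<^sup>2 \<and>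
           (deviation_norm P \<mu> t)\<^sup>2 \<le> ennreal (c * (1 + t ^ (2 * (N - 1))) * exp (- 2 * \<rho> * t))"
proof -
  obtain E c C where flow: "adjoint_flow B E" and c: "0 < c" and C: "0 < C"
    and up: "\<And>t \<xi>. 0 \<le> t \<Longrightarrow> norm (E t *v \<xi>) \<le> C * flow_rate B t * norm \<xi>"
    and low: "\<And>t. 0 \<le> t \<Longrightarrow> \<exists>\<xi>. \<xi> \<noteq> 0 \<and> c * flow_rate B t * norm \<xi> \<le> norm (E t *v \<xi>)"
    using adjoint_flow_exists[of B] rho_pos unfolding rho_def by metis
  obtain S where S: "transpose S = S" "B ** S + S ** transpose B = 2 *\<^sub>R D"
    by (rule adjoint_flow.lyapunov_solution[OF flow D_sym])
  interpret adjoint_flow B E by (rule flow)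
  interpret ou_process P B D S E
    by unfold_locales (use P_semigroup P_generator D_sym D_psd S in auto)
  interpret prob_space \<mu>
    using mu_invariant by (simp add: invariant_measure_def space_prob_algebra)
  interpret ou_stationary P B D S E \<mu>
    by unfold_locales
      (use mu_invariant invariant_plane_wave[OF mu_invariant] in \<open>auto simp: invariant_measure_def space_prob_algebra\<close>)
  obtain m M where m: "0 < m" "\<And>\<xi>. m * (norm \<xi>)\<^sup>2 \<le> q \<xi>" and M: "0 < M" "\<And>\<xi>. q \<xi> \<le> M * (norm \<xi>)\<^sup>2"
    using q_equivalent_norm q_positive[OF ker_D] by metis
  define g where "g t = (1 + t ^ (2 * (N - 1))) * exp (- 2 * \<rho> * t)" for t
  have g: "0 \<le> g t" "g t \<le> (flow_rate B t)\<^sup>2" "(flow_rate B t)\<^sup>2 \<le> 2 * g t" if "0 \<le> t" for t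
    using flow_rate_square[OF that, of B] that by (simp_all add: g_def N_def rho_def)
  \<comment> \<open>\<open>M / m\<close> compares \<open>q\<close> with the Euclidean norm,
    \<open>C\<^sup>2\<close> bounds the flow, and 2 is the loss in
    \<open>flow_rate_square\<close>.\<close>
  define K where "K = 2 * M * C\<^sup>2 / m"
  have K: "0 < K" using m M C by (simp add: K_def)
  have upper: "(deviation_norm P \<mu> t)\<^sup>2 \<le> ennreal (4 * K * g t)" if t: "0 \<le> t" for t
  proof -
    have "q (E t *v \<xi>) \<le> K * g t * q \<xi>" for \<xi>
    proof -
      have "q (E t *v \<xi>) \<le> M * (norm (E t *v \<xi>))\<^sup>2" by (rule M(2))
      also have "\<dots> \<le> M * (C * flow_rate B t * norm \<xi>)\<^sup>2"
        using M(1) up[OF t] by (intro mult_left_mono power_mono) auto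
      also have "\<dots> = M * C\<^sup>2 / m * (flow_rate B t)\<^sup>2 * (m * (norm \<xi>)\<^sup>2)"
        using m(1) by (simp add: power_mult_distrib)
      also have "\<dots> \<le> M * C\<^sup>2 / m * (2 * g t) * q \<xi>"
        using m M C g[OF t] by (intro mult_mono) auto
      finally show ?thesis by (simp add: K_def mult_ac)
    qed
    \<comment> \<open>The contraction requires a factor at most 1, which \<open>K * g t\<close> may
      exceed; \<open>q_flow_le\<close> supplies the bound 1.\<close>
    then have "q (E t *v \<xi>) \<le> min 1 (K * g t) * q \<xi>" for \<xi>
      using q_flow_le[OF t, of \<xi>] by (simp add: min_def)
    then have "(deviation_norm P \<mu> t)\<^sup>2 \<le> ennreal (4 * min 1 (K * g t))"
      using K g[OF t] by (intro deviation_norm_upper[OF t]) auto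
    also have "\<dots> \<le> ennreal (4 * K * g t)" by (intro ennreal_leI) simp
    finally show ?thesis .
  qed
  \<comment> \<open>\<open>2 / sinh 2\<close> comes from \<open>deviation_norm_lower\<close>, and
    \<open>m * c\<^sup>2 / M\<close> from the lower bound for the flow expressed through
    \<open>q\<close>.\<close>
  define L where "L = 2 * m * c\<^sup>2 / (M * sinh 2)"
  have L: "0 < L" using m M c by (simp add: L_def)
  have lower: "ennreal (L * g t) \<le> (deviation_norm P \<mu> t)\<^sup>2" if t: "0 \<le> t" for t
  proof -
    obtain \<xi> where \<xi>: "\<xi> \<noteq> 0" "c * flow_rate B t * norm \<xi> \<le> norm (E t *v \<xi>)" using low[OF t] by blast
    have q\<xi>: "0 < q \<xi>" by (rule q_positive[OF ker_D \<xi>(1)])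
    \<comment> \<open>Rescaling to \<open>q \<zeta> = 1\<close> keeps the ratio of \<open>q\<close>
      after and before the flow and fits the normalised test function.\<close>
    define \<zeta> where "\<zeta> = (1 / sqrt (q \<xi>)) *\<^sub>R \<xi>"
    have q\<zeta>: "q \<zeta> = 1" "q (E t *v \<zeta>) = q (E t *v \<xi>) / q \<xi>"
      using q\<xi> by (simp_all add: \<zeta>_def matrix_vector_mult_scaleR q_scaleR power_divide)
    have "m * c\<^sup>2 / M * g t * q \<xi> \<le> m * c\<^sup>2 / M * (flow_rate B t)\<^sup>2 * (M * (norm \<xi>)\<^sup>2)"
      using m M c q\<xi> g[OF t] by (intro mult_mono M(2)) auto
    also have "\<dots> = m * (c * flow_rate B t * norm \<xi>)\<^sup>2" using M(1) by (simp add: power_mult_distrib)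
    also have "\<dots> \<le> m * (norm (E t *v \<xi>))\<^sup>2"
      using \<xi>(2) m(1) c t by (intro mult_left_mono power_mono) (auto simp: flow_rate_def)
    also have "\<dots> \<le> q (E t *v \<xi>)" by (rule m(2))
    finally have "m * c\<^sup>2 / M * g t \<le> q (E t *v \<zeta>)" using q\<xi> by (simp add: q\<zeta> le_divide_eq)
    then have "2 / sinh 2 * (m * c\<^sup>2 / M * g t) \<le> 2 / sinh 2 * q (E t *v \<zeta>)" by (intro mult_left_mono) auto
    then have "ennreal (L * g t) \<le> ennreal (2 * q (E t *v \<zeta>) / sinh 2)"
      by (intro ennreal_leI) (simp add: L_def mult_ac)
    also have "\<dots> \<le> (deviation_norm P \<mu> t)\<^sup>2" by (rule deviation_norm_lower[OF t q\<zeta>(1)])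
    finally show ?thesis .
  qed
  define A where "A = max (4 * K) (1 / L)"
  have A: "0 < A" "4 * K \<le> A" "1 / A \<le> L" using K L by (auto simp: A_def max_def field_simps)
  show ?thesis
  proof (intro exI[of _ A] conjI allI impI A(1))
    fix t :: real assume t: "0 \<le> t"
    have "ennreal (1 / A * g t) \<le> ennreal (L * g t)" using A g[OF t] by (intro ennreal_leI mult_right_mono) auto
    from order_trans[OF this lower[OF t]]
    show "ennreal (1 / A * (1 + t ^ (2 * (N - 1))) * exp (- 2 * \<rho> * t)) \<le> (deviation_norm P \<mu> t)\<^sup>2"
      by (simp only: g_def mult.assoc)
    have "ennreal (4 * K * g t) \<le> ennreal (A * g t)" using A g[OF t] by (intro ennreal_leI mult_right_mono) auto
    from order_trans[OF upper[OF t] this]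
    show "(deviation_norm P \<mu> t)\<^sup>2 \<le> ennreal (A * (1 + t ^ (2 * (N - 1))) * exp (- 2 * \<rho> * t))"
      by (simp only: g_def mult.assoc)
  qed
qed

end
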